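(* Let $Y_m$ be a generic $m\times m$ skew-symmetric matrix (with $y_{ij}$, $i<j$, distinct indeterminates, $y_{ji}=-y_{ij}$, $y_{ii}=0$) and let $I_m$ be the ideal generated by the $4\times4$ Pfaffians of $Y_m$ in the polynomial ring $\mathbb{K}[y_{ij}\mid 1\le i<j\le m]$. Then $I_m$ is differentially perfect. In particular, for all integers $r,s\ge1$ the set $$\Big\{\prod_{i=1}^{l}f_i\ \Big|\ f_i\in\mathcal{P}_{r+1}(Y_m),\ \sum_{i=1}^{l}(\deg f_i-r)=s\Big\}$$ forms a Gröbner basis for the symbolic power $\left(I_m^{\{r\}}\right)^{(s)}$ with respect to any antidiagonal term order.
   Context: $\mathbb{K}$ is an algebraically closed field and $R$ is the polynomial ring in the indeterminates. For a skew-symmetric matrix $Y$, $\mathcal{P}_r(Y)$ is the set of all $2t\times2t$ subPfaffians of $Y$ (Pfaffians of the principal $2t\times 2t$ submatrices) for all $t\ge r$; $l\ge1$ is arbitrary. An antidiagonal term order is any term order for which the leading monomial of the Pfaffian on rows and columns $i_1<i_2<\cdots<i_{2t}$ is the antidiagonal monomial $y_{i_1i_{2t}}y_{i_2i_{2t-1}}\cdots y_{i_ti_{t+1}}$, for every subPfaffian of $Y_m$. Symbolic power: $I^{(r)}=(R_I^{-1}I^r)\cap R$, where $R_I$ is the complement of the union of the minimal primes of $I$. Join and secant ideals: for ideals $I,J$ in a polynomial ring $\mathbb{K}[\mathbf{x}]$ with variables $x_a$, $I\ast J=\big(I(\mathbf{x}')+J(\mathbf{x}'')+\langle x_a-x_a'-x_a''\mid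 a\rangle\big)\cap\mathbb{K}[\mathbf{x}]$, where $\mathbf{x}',\mathbf{x}''$ are two new copies of the variables and $I(\mathbf{x}')$ is $I$ with $x'_a$ substituted for $x_a$; the $r$-th secant ideal is the $r$-fold join $I^{\{r\}}=I\ast\cdots\ast I$ (so $I^{\{1\}}=I$). An ideal $I$ is $r$-differentially perfect if for all $s\ge1$, $(I^{\{r\}})^{(s)}=I^{\{r+s-1\}}+\sum_{i=1}^{s-1}(I^{\{r\}})^{(i)}(I^{\{r\}})^{(s-i)}$; it is differentially perfect if it is $r$-differentially perfect for all $r\ge1$. *)

theory Defs
  imports
    "HOL-Algebra.Ideal_Product"
    "HOL-Library.Poly_Mapping"
    "HOL-Computational_Algebra.Polynomial"
    "HOL-Combinatorics.Permutations"
begin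

section \<open>Polynomial rings in a set of variables\<close>

text \<open>
  Monomials are exponent vectors with finite support and polynomials are finitely supported
  coefficient functions on monomials; multiplication on the type is convolution.
  The ring \<open>K[x\<^sub>v | v \<in> V]\<close> is carved out by its carrier: the polynomials in which only
  variables from \<open>V\<close> occur.
\<close>

type_synonym 'v mono = "'v \<Rightarrow>\<^sub>0 nat"
type_synonym ('v, 'k) mpol = "'v mono \<Rightarrow>\<^sub>0 'k"

definition monomials_in :: "'v set \<Rightarrow> 'v mono set" where
  "monomials_in V = {t. Poly_Mapping.keys t \<subseteq> V}"

definition poly_ring :: "'v set \<Rightarrow> ('v, 'k::comm_ring_1) mpol ring" where
  "poly_ring V = \<lparr>carrier = {p. Poly_Mapping.keys p \<subseteq> monomials_in V}, monoid.mult = (*), one = 1, zero = 0, add = (+)\<rparr>"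

definition mconst :: "'k \<Rightarrow> ('v, 'k::comm_ring_1) mpol" where
  "mconst c = Poly_Mapping.single 0 c"

definition mvar :: "'v \<Rightarrow> ('v, 'k::comm_ring_1) mpol" where
  "mvar v = Poly_Mapping.single (Poly_Mapping.single v 1) 1"

definition poly_subst :: "('v \<Rightarrow> ('w, 'k) mpol) \<Rightarrow> ('v, 'k::comm_ring_1) mpol \<Rightarrow> ('w, 'k) mpol" where
  "poly_subst \<sigma> p =
     (\<Sum>t\<in>Poly_Mapping.keys p. mconst (Poly_Mapping.lookup p t) * (\<Prod>v\<in>Poly_Mapping.keys t. \<sigma> v ^ Poly_Mapping.lookup t v))"

definition total_degree :: "('v, 'k::zero) mpol \<Rightarrow> nat" where
  "total_degree p = Max (insert 0 ((\<lambda>t. \<Sum>v\<in>Poly_Mapping.keys t. Poly_Mapping.lookup t v) ` Poly_Mapping.keys p))"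


section \<open>Term orders and Groebner bases\<close>

text \<open>
  An order is a reflexive relation on the monomials in \<open>V\<close>, with \<open>(t, u) \<in> r\<close> for \<open>t \<le> u\<close>.
  For finite \<open>V\<close> such an order is automatically a well-order.
\<close>

definition term_order :: "'v set \<Rightarrow> 'v mono rel \<Rightarrow> bool" where
  "term_order V r \<longleftrightarrow>
     linear_order_on (monomials_in V) r \<and>
     (\<forall>t\<in>monomials_in V. (0, t) \<in> r) \<and>
     (\<forall>t u w. (t, u) \<in> r \<and> w \<in> monomials_in V \<longrightarrow> (t + w, u + w) \<in> r)"

definition lead_mono :: "'v mono rel \<Rightarrow> ('v, 'k::zero) mpol \<Rightarrow> 'v mono" where
  "lead_mono r p = (THE t. t \<in> Poly_Mapping.keys p \<and> (\<forall>u\<in>Poly_Mapping.keys p. (u, t) \<in> r))"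

definition initial_ideal :: "'v set \<Rightarrow> 'v mono rel \<Rightarrow> ('v, 'k::comm_ring_1) mpol set \<Rightarrow> ('v, 'k) mpol set" where
  "initial_ideal V r F =
     Idl\<^bsub>poly_ring V\<^esub> {Poly_Mapping.single (lead_mono r f) 1 | f. f \<in> F \<and> f \<noteq> 0}"

definition is_groebner_basis ::
  "'v set \<Rightarrow> 'v mono rel \<Rightarrow> ('v, 'k::comm_ring_1) mpol set \<Rightarrow> ('v, 'k) mpol set \<Rightarrow> bool" where
  "is_groebner_basis V r G I \<longleftrightarrow>
     finite G \<and> G \<subseteq> I \<and> initial_ideal V r G = initial_ideal V r I"


section \<open>Symbolic powers\<close>

definition minimal_primes :: "('a, 'b) ring_scheme \<Rightarrow> 'a set \<Rightarrow> 'a set set" where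
  "minimal_primes R I =
     {P. primeideal P R \<and> I \<subseteq> P \<and> (\<forall>Q. primeideal Q R \<and> I \<subseteq> Q \<and> Q \<subseteq> P \<longrightarrow> Q = P)}"

text \<open>
  Elements of the localization \<open>S\<^sup>-\<^sup>1 R\<close> are equivalence classes of pairs (numerator, denominator),
  and \<open>S\<^sup>-\<^sup>1 J\<close> is the set of fractions with numerator in \<open>J\<close>.
\<close>

definition loc_rel :: "('a, 'b) ring_scheme \<Rightarrow> 'a set \<Rightarrow> ('a \<times> 'a) rel" where
  "loc_rel R S =
     {((a, s), (b, t)). a \<in> carrier R \<and> b \<in> carrier R \<and> s \<in> S \<and> t \<in> S \<and>
        (\<exists>u\<in>S. u \<otimes>\<^bsub>R\<^esub> (a \<otimes>\<^bsub>R\<^esub> t \<ominus>\<^bsub>R\<^esub> b \<otimes>\<^bsub>R\<^esub> s) = \<zero>\<^bsub>R\<^esub>)}"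

definition loc_frac :: "('a, 'b) ring_scheme \<Rightarrow> 'a set \<Rightarrow> 'a \<Rightarrow> 'a \<Rightarrow> ('a \<times> 'a) set" where
  "loc_frac R S a s = loc_rel R S `` {(a, s)}"

definition localized_ideal :: "('a, 'b) ring_scheme \<Rightarrow> 'a set \<Rightarrow> 'a set \<Rightarrow> ('a \<times> 'a) set set" where
  "localized_ideal R S J = {loc_frac R S a s | a s. a \<in> J \<and> s \<in> S}"

definition ideal_pow :: "('a, 'b) ring_scheme \<Rightarrow> 'a set \<Rightarrow> nat \<Rightarrow> 'a set" where
  "ideal_pow R I n = I [^]\<^bsub>ideals_set R\<^esub> n"

definition symbolic_power :: "('a, 'b) ring_scheme \<Rightarrow> 'a set \<Rightarrow> nat \<Rightarrow> 'a set" where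
  "symbolic_power R I n =
     (let S = carrier R - \<Union>(minimal_primes R I)
      in {f \<in> carrier R. loc_frac R S f \<one>\<^bsub>R\<^esub> \<in> localized_ideal R S (ideal_pow R I n)})"


section \<open>Joins, secant ideals and differentially perfect ideals\<close>

text \<open>The variables \<open>x\<close>, \<open>x'\<close>, \<open>x''\<close> of the ambient ring of a join.\<close>

datatype 'v tripled = Orig 'v | Copy1 'v | Copy2 'v

definition tripled_vars :: "'v set \<Rightarrow> 'v tripled set" where
  "tripled_vars V = Orig ` V \<union> Copy1 ` V \<union> Copy2 ` V"

text \<open>
  The intersection with \<open>K[x]\<close> is the preimage under the inclusion \<open>x\<^sub>a \<mapsto> x\<^sub>a\<close> of \<open>K[x]\<close>
  into \<open>K[x, x', x'']\<close>.
\<close>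

definition join_ideal ::
  "'v set \<Rightarrow> ('v, 'k::comm_ring_1) mpol set \<Rightarrow> ('v, 'k) mpol set \<Rightarrow> ('v, 'k) mpol set" where
  "join_ideal V I J =
     (let T = poly_ring (tripled_vars V) in
      {f \<in> carrier (poly_ring V).
         poly_subst (\<lambda>a. mvar (Orig a)) f \<in>
           Idl\<^bsub>T\<^esub> (poly_subst (\<lambda>a. mvar (Copy1 a)) ` I) <+>\<^bsub>T\<^esub>
           Idl\<^bsub>T\<^esub> (poly_subst (\<lambda>a. mvar (Copy2 a)) ` J) <+>\<^bsub>T\<^esub>
           Idl\<^bsub>T\<^esub> {mvar (Orig a) - mvar (Copy1 a) - mvar (Copy2 a) | a. a \<in> V}})"

text \<open>The \<open>r\<close>-fold join is only meaningful for \<open>r \<ge> 1\<close>; the value at \<open>r = 0\<close> is not used.\<close>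

definition secant_ideal :: "'v set \<Rightarrow> ('v, 'k::comm_ring_1) mpol set \<Rightarrow> nat \<Rightarrow> ('v, 'k) mpol set" where
  "secant_ideal V I r = (join_ideal V I ^^ (r - 1)) I"

text \<open>
  The sum of ideals is taken in the semiring of ideals of the ring, so that for \<open>s = 1\<close> the empty
  sum is the zero ideal.
\<close>

definition diff_perfect_at :: "'v set \<Rightarrow> ('v, 'k::comm_ring_1) mpol set \<Rightarrow> nat \<Rightarrow> bool" where
  "diff_perfect_at V I r \<longleftrightarrow>
     (let R = poly_ring V; J = secant_ideal V I r in
      \<forall>s\<ge>1. symbolic_power R J s =
        secant_ideal V I (r + s - 1) <+>\<^bsub>R\<^esub>
        (\<Oplus>\<^bsub>ideals_set R\<^esub>i\<in>{1..s-1}.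
           ideal_prod R (symbolic_power R J i) (symbolic_power R J (s - i))))"

definition differentially_perfect :: "'v set \<Rightarrow> ('v, 'k::comm_ring_1) mpol set \<Rightarrow> bool" where
  "differentially_perfect V I \<longleftrightarrow> (\<forall>r\<ge>1. diff_perfect_at V I r)"


section \<open>Pfaffians of the generic skew-symmetric matrix\<close>

text \<open>
  Signed sum over the perfect matchings of \<open>{0, ..., 2t-1}\<close>. Each matching is written uniquely as
  \<open>{\<sigma> 0, \<sigma> 1}, {\<sigma> 2, \<sigma> 3}, ...\<close> with increasing pairs that are ordered by their first
  elements, so no division is needed and the definition is valid in every characteristic.
\<close>

definition pfaffian :: "nat \<Rightarrow> (nat \<Rightarrow> nat \<Rightarrow> 'a::comm_ring_1) \<Rightarrow> 'a" where
  "pfaffian t A =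
     (\<Sum>\<sigma> | \<sigma> permutes {..<2*t} \<and> (\<forall>k<t. \<sigma> (2*k) < \<sigma> (2*k+1)) \<and>
            (\<forall>k. k + 1 < t \<longrightarrow> \<sigma> (2*k) < \<sigma> (2*k+2)).
        of_int (sign \<sigma>) * (\<Prod>k<t. A (\<sigma> (2*k)) (\<sigma> (2*k+1))))"

text \<open>Pfaffian of the principal submatrix on the rows and columns in \<open>U\<close> (\<open>U\<close> of even size).\<close>

definition subpfaffian :: "(nat \<Rightarrow> nat \<Rightarrow> 'a::comm_ring_1) \<Rightarrow> nat set \<Rightarrow> 'a" where
  "subpfaffian A U =
     (let idx = sorted_list_of_set U
      in pfaffian (card U div 2) (\<lambda>i j. A (idx ! i) (idx ! j)))"

definition subpfaffians_ge :: "nat \<Rightarrow> nat \<Rightarrow> (nat \<Rightarrow> nat \<Rightarrow> 'a::comm_ring_1) \<Rightarrow> 'a set" where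
  "subpfaffians_ge m r A = {subpfaffian A U | U t. U \<subseteq> {1..m} \<and> card U = 2 * t \<and> t \<ge> r}"

definition skew_vars :: "nat \<Rightarrow> (nat \<times> nat) set" where
  "skew_vars m = {(i, j). 1 \<le> i \<and> i < j \<and> j \<le> m}"

definition generic_skew :: "nat \<Rightarrow> nat \<Rightarrow> (nat \<times> nat, 'k::comm_ring_1) mpol" where
  "generic_skew i j = (if i < j then mvar (i, j) else if j < i then - mvar (j, i) else 0)"

definition pf4_ideal :: "nat \<Rightarrow> (nat \<times> nat, 'k::comm_ring_1) mpol set" where
  "pf4_ideal m =
     Idl\<^bsub>poly_ring (skew_vars m)\<^esub> {subpfaffian generic_skew U | U. U \<subseteq> {1..m} \<and> card U = 4}"

definition antidiagonal_mono :: "nat set \<Rightarrow> (nat \<times> nat) mono" where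
  "antidiagonal_mono U =
     (let idx = sorted_list_of_set U; n = card U
      in \<Sum>k<n div 2. Poly_Mapping.single (idx ! k, idx ! (n - 1 - k)) 1)"

text \<open>The coefficient field enters through the itself argument.\<close>

definition antidiagonal_term_order ::
  "'k::comm_ring_1 itself \<Rightarrow> nat \<Rightarrow> (nat \<times> nat) mono rel \<Rightarrow> bool" where
  "antidiagonal_term_order K m r \<longleftrightarrow>
     term_order (skew_vars m) r \<and>
     (\<forall>U t. U \<subseteq> {1..m} \<and> card U = 2 * t \<longrightarrow>
        lead_mono r (subpfaffian generic_skew U :: (nat \<times> nat, 'k) mpol) = antidiagonal_mono U)"

definition pfaffian_products :: "nat \<Rightarrow> nat \<Rightarrow> nat \<Rightarrow> (nat \<times> nat, 'k::comm_ring_1) mpol set" where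
  "pfaffian_products m r s =
     {\<Prod>i=1..l. f i | f l.
        (l::nat) \<ge> 1 \<and> (\<forall>i\<in>{1..l}. f i \<in> subpfaffians_ge m (r + 1) generic_skew) \<and>
        (\<Sum>i=1..l. (int (total_degree (f i)) - int r)) = int s}"

end

theory Submission
  imports Defs
    "HOL-Library.Product_Lexorder"
    "HOL-Combinatorics.Cycles"
begin

text \<open>
  Write \<open>J\<^sub>r\<close> for the \<open>r\<close>-th secant ideal, \<open>P\<^sub>r\<close> for the ideal of Pfaffians of size at least \<open>2r + 2\<close>
  and \<open>K\<^sub>r\<close> for the ideal of polynomials vanishing at the generic matrix \<open>\<Sum>\<^sub>k a\<^sub>k \<and> b\<^sub>k\<close> of rank \<open>2r\<close>.
  Expanding the Pfaffian of a sum gives \<open>P\<^sub>r \<subseteq> J\<^sub>r\<close>, and substitution gives \<open>J\<^sub>r \<subseteq> K\<^sub>r\<close>. Order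
  the variables by strict nesting, so that the antidiagonal monomials are the chains. A monomial that is
  not divisible by a chain of length \<open>r + 1\<close> is supported on a union of \<open>r\<close> antichains, and such
  monomials are linearly independent modulo \<open>K\<^sub>r\<close>; as they span modulo \<open>P\<^sub>r\<close>, the three ideals
  agree. Hence \<open>J\<^sub>r\<close> is prime and its initial ideal is generated by chains of length \<open>r + 1\<close>.

  All Hasse derivatives of order less than \<open>s\<close> of an element of the \<open>s\<close>-th symbolic power of \<open>J\<^sub>r\<close>
  lie in \<open>J\<^sub>r\<close>. Differentiating away the part of its leading monomial on a set \<open>C\<close> of variables whose
  complement is a union of \<open>r\<close> antichains shows that this part has degree at least \<open>s\<close>. By a weighted
  Greene--Kleitman theorem the leading monomial is then divisible by disjoint chains whose lengths
  exceed \<open>r\<close> by \<open>s\<close> in total, that is, by the leading monomial of a product of Pfaffians. Conversely,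
  a Pluecker relation puts the Pfaffians of size \<open>2t\<close> into the symbolic power of order \<open>t - r\<close>.
  Differential perfection can be read off from the generators obtained in this way.
\<close>

text \<open>Every characteristic has to be covered, and this shapes the tools: Pfaffians are handled
  by row expansion on arbitrary words, without division; the antidiagonal monomials have unit
  coefficients; derivatives are Hasse derivatives, and a leading monomial is always differentiated
  by its full exponent in a variable, where the binomial coefficient is 1.

  The two bounds on a leading monomial are dual. Membership in the symbolic power forces degree at
  least s on every C with a height function outside C: this is the minimum side. A product of
  Pfaffians of sizes 2t_i is a family of chains with surpluses t_i - r: this is the maximum side. As
  exponents may exceed 1, the equality of the two is needed for multisets; it is derived from
  optimal assignments and their integral dual potentials.

  Independence modulo K_r is shown by one coefficient that only a single standard monomial can
  produce; the choice of r antichains is recorded by which vectors a_k, b_k enter it. K_r is the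
  kernel of a substitution into polynomials over a field, so primality comes with the identification
  of the ideals.\<close>

abbreviation supp :: "('a \<Rightarrow>\<^sub>0 'b::zero) \<Rightarrow> 'a set" where "supp \<equiv> Poly_Mapping.keys"
abbreviation cf :: "('a \<Rightarrow>\<^sub>0 'b::zero) \<Rightarrow> 'a \<Rightarrow> 'b" where "cf \<equiv> Poly_Mapping.lookup"
abbreviation sgl :: "'a \<Rightarrow> 'b \<Rightarrow> 'a \<Rightarrow>\<^sub>0 'b::zero" where "sgl \<equiv> Poly_Mapping.single"

section \<open>Polynomial rings, their ideals and evaluation\<close>

lemma poly_ring_simps [simp]:
  "carrier (poly_ring V) = {p. supp p \<subseteq> monomials_in V}"
  "x \<otimes>\<^bsub>poly_ring V\<^esub> y = x * y" "\<one>\<^bsub>poly_ring V\<^esub> = 1" "\<zero>\<^bsub>poly_ring V\<^esub> = 0"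
  "x \<oplus>\<^bsub>poly_ring V\<^esub> y = x + y"
  by (simp_all add: poly_ring_def)

lemma supp_add_nat: "supp (s + t) = supp s \<union> supp (t :: 'a \<Rightarrow>\<^sub>0 nat)"
  by (auto simp: in_keys_iff lookup_add)

lemma monomials_in_add [simp]: "s + t \<in> monomials_in V \<longleftrightarrow> s \<in> monomials_in V \<and> t \<in> monomials_in V"
  by (auto simp: monomials_in_def supp_add_nat)

lemma monomials_in_zero [simp]: "0 \<in> monomials_in V"
  by (simp add: monomials_in_def)

text \<open>A named copy of the carrier: closure rules about it can serve as introduction rules,
  while the simplifier unfolds the carrier itself.\<close>

definition polys :: "'v set \<Rightarrow> ('v, 'k::comm_ring_1) mpol set" where
  "polys V = {p. supp p \<subseteq> monomials_in V}"

lemma carrier_poly_ring: "carrier (poly_ring V) = polys V"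
  by (simp add: polys_def)

lemma supp_uminus [simp]: "supp (- p :: 'a \<Rightarrow>\<^sub>0 'k::ab_group_add) = supp p"
  by (auto simp: in_keys_iff)

lemma polys_zero [simp]: "0 \<in> polys V" and polys_one [simp]: "1 \<in> polys V"
  by (auto simp: polys_def)

lemma polys_add [intro]: "p \<in> polys V \<Longrightarrow> q \<in> polys V \<Longrightarrow> p + q \<in> polys V"
  using keys_add[of p q] by (auto simp: polys_def)

lemma polys_uminus [intro]: "p \<in> polys V \<Longrightarrow> - p \<in> polys V"
  by (auto simp: polys_def)

lemma polys_diff [intro]: "p \<in> polys V \<Longrightarrow> q \<in> polys V \<Longrightarrow> p - q \<in> polys V"
  using polys_add[of p V "- q"] by auto

lemma polys_mult [intro]: "p \<in> polys V \<Longrightarrow> q \<in> polys V \<Longrightarrow> p * q \<in> polys V"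
  using keys_mult[of p q] by (fastforce simp: polys_def)

lemma polys_sum [intro]: "(\<And>i. i \<in> A \<Longrightarrow> f i \<in> polys V) \<Longrightarrow> sum f A \<in> polys V"
  by (induction A rule: infinite_finite_induct) (auto intro!: polys_add)

lemma polys_prod [intro]: "(\<And>i. i \<in> A \<Longrightarrow> f i \<in> polys V) \<Longrightarrow> prod f A \<in> polys V"
  by (induction A rule: infinite_finite_induct) (auto intro!: polys_mult)

lemma polys_power [intro]: "p \<in> polys V \<Longrightarrow> p ^ n \<in> polys V"
  by (induction n) (auto intro!: polys_mult)

lemma polys_single [intro]: "t \<in> monomials_in V \<Longrightarrow> sgl t c \<in> polys V"
  by (auto simp: polys_def)

lemma polys_mvar [intro]: "v \<in> V \<Longrightarrow> mvar v \<in> polys V"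
  by (auto simp: polys_def mvar_def monomials_in_def)

lemma polys_mconst [intro]: "mconst c \<in> polys V"
  by (auto simp: polys_def mconst_def monomials_in_def)

lemma cring_poly_ring: "cring (poly_ring V :: ('v, 'k::comm_ring_1) mpol ring)"
proof (rule cringI)
  show "abelian_group (poly_ring V :: ('v, 'k) mpol ring)"
  proof (rule abelian_groupI, goal_cases)
    case (6 x)
    then show ?case
      by (intro bexI[of _ "- x"]) (auto simp: carrier_poly_ring)
  qed (auto simp: carrier_poly_ring add_ac simp del: poly_ring_simps(1))
  show "Group.comm_monoid (poly_ring V :: ('v, 'k) mpol ring)"
    by (rule comm_monoidI) (auto simp: carrier_poly_ring mult_ac simp del: poly_ring_simps(1))
qed (auto simp: distrib_right)

lemma ring_poly_ring: "ring (poly_ring V :: ('v, 'k::comm_ring_1) mpol ring)"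
  using cring_poly_ring by (rule cring.axioms)

lemma a_inv_poly_ring: "x \<in> polys V \<Longrightarrow> \<ominus>\<^bsub>poly_ring V\<^esub> x = - x"
proof -
  interpret cring "poly_ring V" by (rule cring_poly_ring)
  assume "x \<in> polys V"
  then show ?thesis
    by (intro minus_equality) (auto simp: polys_def simp flip: polys_def)
qed

lemma a_minus_poly_ring: "y \<in> polys V \<Longrightarrow> x \<ominus>\<^bsub>poly_ring V\<^esub> y = x - y"
  by (simp add: a_minus_def a_inv_poly_ring)

lemma ideal_poly_ringI:
  assumes "I \<subseteq> polys V" "0 \<in> I" "\<And>a b. a \<in> I \<Longrightarrow> b \<in> I \<Longrightarrow> a + b \<in> I"
    and mult: "\<And>a c. a \<in> I \<Longrightarrow> c \<in> polys V \<Longrightarrow> c * a \<in> I"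
  shows "ideal I (poly_ring V :: ('v, 'k::comm_ring_1) mpol ring)"
proof (rule idealI[OF ring_poly_ring])
  have minus: "- a \<in> I" if "a \<in> I" for a
    using mult[OF that polys_uminus[OF polys_one]] by simp
  show "subgroup I (add_monoid (poly_ring V))"
  proof (rule subgroup.intro)
    fix x assume "x \<in> I"
    then show "inv\<^bsub>add_monoid (poly_ring V)\<^esub> x \<in> I"
      using a_inv_poly_ring[of x V] minus assms(1) by (auto simp: a_inv_def)
  qed (use assms in \<open>auto simp: carrier_poly_ring simp del: poly_ring_simps(1)\<close>)
qed (use mult in \<open>auto simp: carrier_poly_ring mult.commute simp del: poly_ring_simps(1)\<close>)

lemma ideal_poly_ringD:
  assumes "ideal I (poly_ring V :: ('v, 'k::comm_ring_1) mpol ring)"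
  shows "I \<subseteq> polys V" "0 \<in> I" "a \<in> I \<Longrightarrow> b \<in> I \<Longrightarrow> a + b \<in> I"
    "a \<in> I \<Longrightarrow> c \<in> polys V \<Longrightarrow> c * a \<in> I"
    "a \<in> I \<Longrightarrow> - a \<in> I" "a \<in> I \<Longrightarrow> b \<in> I \<Longrightarrow> a - b \<in> I"
proof -
  interpret ideal I "poly_ring V" by fact
  show *: "I \<subseteq> polys V" "0 \<in> I" "a \<in> I \<Longrightarrow> b \<in> I \<Longrightarrow> a + b \<in> I" for a b
    using additive_subgroup.a_subset[OF ideal.axioms(1)[OF assms]]
      additive_subgroup.zero_closed[OF ideal.axioms(1)[OF assms]]
      additive_subgroup.a_closed[OF ideal.axioms(1)[OF assms], of a b]
    by (auto simp: carrier_poly_ring simp del: poly_ring_simps(1))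
  show m: "a \<in> I \<Longrightarrow> c \<in> polys V \<Longrightarrow> c * a \<in> I" for a c
    using I_l_closed[of a c] by (auto simp: carrier_poly_ring simp del: poly_ring_simps(1))
  show n: "a \<in> I \<Longrightarrow> - a \<in> I" for a
    using m[OF _ polys_uminus[OF polys_one], of a] by simp
  show "a \<in> I \<Longrightarrow> b \<in> I \<Longrightarrow> a - b \<in> I"
    using *(3)[OF _ n, of a b] by auto
qed

lemma ideal_poly_ring_sum:
  assumes "ideal I (poly_ring V :: ('v, 'k::comm_ring_1) mpol ring)" "\<And>i. i \<in> A \<Longrightarrow> f i \<in> I"
  shows "sum f A \<in> I"
  using assms(2) by (induction A rule: infinite_finite_induct) (auto simp: ideal_poly_ringD[OF assms(1)])

lemma Idl_ideal: "S \<subseteq> polys V \<Longrightarrow> ideal (Idl\<^bsub>poly_ring V\<^esub> S) (poly_ring V :: ('v, 'k::comm_ring_1) mpol ring)"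
  by (rule ring.genideal_ideal[OF ring_poly_ring]) (simp add: polys_def)

lemma Idl_self: "S \<subseteq> polys V \<Longrightarrow> S \<subseteq> Idl\<^bsub>poly_ring V\<^esub> S"
  by (rule ring.genideal_self[OF ring_poly_ring]) (simp add: polys_def)

lemma Idl_minimal: "ideal I (poly_ring V) \<Longrightarrow> S \<subseteq> I \<Longrightarrow> Idl\<^bsub>poly_ring V\<^esub> S \<subseteq> I"
  by (rule ring.genideal_minimal[OF ring_poly_ring])

lemma set_add_poly_ring: "I <+>\<^bsub>poly_ring V\<^esub> J = {a + b |a b. a \<in> I \<and> b \<in> J}"
  by (auto simp: set_add_def')

lemma ideal_set_add:
  "ideal I (poly_ring V) \<Longrightarrow> ideal J (poly_ring V) \<Longrightarrow> ideal (I <+>\<^bsub>poly_ring V\<^esub> J) (poly_ring V)"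
  by (rule ring.add_ideals[OF ring_poly_ring])

lemma set_add_superset:
  assumes "ideal I (poly_ring V)" "ideal J (poly_ring V)"
  shows "I \<subseteq> I <+>\<^bsub>poly_ring V\<^esub> J" "J \<subseteq> I <+>\<^bsub>poly_ring V\<^esub> J"
  unfolding set_add_poly_ring
  using ideal_poly_ringD(2)[OF assms(1)] ideal_poly_ringD(2)[OF assms(2)] by (auto, metis add.right_neutral, metis add.left_neutral)

section \<open>Evaluation homomorphisms\<close>

lemma poly_decomp: "p = (\<Sum>t\<in>supp p. sgl t (cf p t))"
  by (rule poly_mapping_eqI) (simp add: lookup_sum lookup_single when_def in_keys_iff)

definition mono_val :: "('v \<Rightarrow> 'a::comm_monoid_mult) \<Rightarrow> 'v mono \<Rightarrow> 'a" where
  "mono_val \<sigma> t = (\<Prod>v\<in>supp t. \<sigma> v ^ cf t v)"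

lemma mono_val_superset: "finite A \<Longrightarrow> supp t \<subseteq> A \<Longrightarrow> mono_val \<sigma> t = (\<Prod>v\<in>A. \<sigma> v ^ cf t v)"
  unfolding mono_val_def by (rule prod.mono_neutral_left) (auto simp: in_keys_iff)

lemma mono_val_add: "mono_val \<sigma> (s + t) = mono_val \<sigma> s * mono_val \<sigma> t"
  by (simp add: mono_val_superset[of "supp s \<union> supp t"] supp_add_nat lookup_add power_add prod.distrib)

lemma mono_val_zero [simp]: "mono_val \<sigma> 0 = 1"
  by (simp add: mono_val_def)

lemma mono_val_single [simp]: "mono_val \<sigma> (sgl v n) = \<sigma> v ^ n"
  by (simp add: mono_val_def)

text \<open>The coefficient map is a parameter because two are used: \<open>mconst\<close> gives
  substitution, and constant univariate polynomials give the Taylor expansion behind the Hasse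
  derivatives.\<close>

definition ev :: "('k \<Rightarrow> 'a) \<Rightarrow> ('v \<Rightarrow> 'a::comm_ring_1) \<Rightarrow> ('v, 'k::comm_ring_1) mpol \<Rightarrow> 'a" where
  "ev \<kappa> \<sigma> p = (\<Sum>t\<in>supp p. \<kappa> (cf p t) * mono_val \<sigma> t)"

locale coeff_hom =
  fixes \<kappa> :: "'k::comm_ring_1 \<Rightarrow> 'a::comm_ring_1"
  assumes zero [simp]: "\<kappa> 0 = 0" and one [simp]: "\<kappa> 1 = 1"
    and add: "\<kappa> (a + b) = \<kappa> a + \<kappa> b" and mult: "\<kappa> (a * b) = \<kappa> a * \<kappa> b"
begin

lemma ev_superset: "finite A \<Longrightarrow> supp p \<subseteq> A \<Longrightarrow> ev \<kappa> \<sigma> p = (\<Sum>t\<in>A. \<kappa> (cf p t) * mono_val \<sigma> t)"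
  unfolding ev_def by (rule sum.mono_neutral_left) (auto simp: in_keys_iff)

lemma ev_zero [simp]: "ev \<kappa> \<sigma> 0 = 0"
  by (simp add: ev_def)

lemma ev_add: "ev \<kappa> \<sigma> (p + q) = ev \<kappa> \<sigma> p + ev \<kappa> \<sigma> q"
  using keys_add[of p q]
  by (simp add: ev_superset[of "supp p \<union> supp q"] lookup_add add algebra_simps sum.distrib)

lemma ev_single: "ev \<kappa> \<sigma> (sgl t c) = \<kappa> c * mono_val \<sigma> t"
  by (simp add: ev_superset[of "{t}"])

lemma ev_mvar [simp]: "ev \<kappa> \<sigma> (mvar v) = \<sigma> v"
  by (simp add: mvar_def ev_single)

lemma ev_mconst [simp]: "ev \<kappa> \<sigma> (mconst c) = \<kappa> c"
  by (simp add: mconst_def ev_single)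

lemma ev_one [simp]: "ev \<kappa> \<sigma> 1 = 1"
  using ev_single[of \<sigma> 0 1] by simp

lemma ev_uminus: "ev \<kappa> \<sigma> (- p) = - ev \<kappa> \<sigma> p"
  using ev_add[of \<sigma> p "- p"] by (simp add: eq_neg_iff_add_eq_0 add.commute)

lemma ev_diff: "ev \<kappa> \<sigma> (p - q) = ev \<kappa> \<sigma> p - ev \<kappa> \<sigma> q"
  using ev_add[of \<sigma> p "- q"] by (simp add: ev_uminus)

lemma ev_sum: "ev \<kappa> \<sigma> (sum f A) = (\<Sum>i\<in>A. ev \<kappa> \<sigma> (f i))"
  by (induction A rule: infinite_finite_induct) (simp_all add: ev_add)

lemma ev_mult: "ev \<kappa> \<sigma> (p * q) = ev \<kappa> \<sigma> p * ev \<kappa> \<sigma> q"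
proof -
  have "ev \<kappa> \<sigma> (p * q) = ev \<kappa> \<sigma> (\<Sum>s\<in>supp p. \<Sum>t\<in>supp q. sgl (s + t) (cf p s * cf q t))"
    by (subst (1) poly_decomp[of p], subst (1) poly_decomp[of q])
      (simp add: sum_product mult_single)
  also have "\<dots> = ev \<kappa> \<sigma> p * ev \<kappa> \<sigma> q"
    by (simp add: ev_sum ev_single mult mono_val_add ev_def[of _ _ p] ev_def[of _ _ q] sum_product mult_ac)
  finally show ?thesis .
qed

lemma ev_power: "ev \<kappa> \<sigma> (p ^ n) = ev \<kappa> \<sigma> p ^ n"
  by (induction n) (simp_all add: ev_mult)

lemma ev_prod: "ev \<kappa> \<sigma> (prod f A) = (\<Prod>i\<in>A. ev \<kappa> \<sigma> (f i))"
  by (induction A rule: infinite_finite_induct) (simp_all add: ev_mult)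

lemma ev_mono_val: "ev \<kappa> \<sigma> (mono_val f t) = mono_val (\<lambda>v. ev \<kappa> \<sigma> (f v)) t"
  by (simp add: mono_val_def ev_prod ev_power)

end

lemma mono_val_cong: "(\<And>v. v \<in> supp t \<Longrightarrow> \<sigma> v = \<tau> v) \<Longrightarrow> mono_val \<sigma> t = mono_val \<tau> t"
  by (simp add: mono_val_def)

interpretation mconst: coeff_hom "mconst :: 'k \<Rightarrow> ('v, 'k::comm_ring_1) mpol"
  by unfold_locales (simp_all add: mconst_def single_add mult_single)

lemma poly_subst_eq_ev: "poly_subst \<sigma> = ev mconst \<sigma>"
  by (auto simp: poly_subst_def ev_def mono_val_def)

lemma ev_mconst_comp: "ev mconst \<tau> (ev mconst \<sigma> p) = ev mconst (\<lambda>v. ev mconst \<tau> (\<sigma> v)) p"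
  by (simp add: ev_def[of mconst \<sigma>] mconst.ev_sum mconst.ev_mult mconst.ev_mono_val)
    (simp add: ev_def)

lemma polys_ev:
  assumes "p \<in> polys V" "\<And>v. v \<in> V \<Longrightarrow> \<sigma> v \<in> polys W"
  shows "ev mconst \<sigma> p \<in> polys W"
  unfolding ev_def mono_val_def
  using assms by (intro polys_sum polys_mult polys_mconst polys_prod polys_power assms(2))
    (auto simp: polys_def monomials_in_def)

section \<open>Pfaffians of words\<close>

definition del :: "nat \<Rightarrow> 'a list \<Rightarrow> 'a list" where
  "del k xs = take k xs @ drop (Suc k) xs"

lemma length_del [simp]: "k < length xs \<Longrightarrow> length (del k xs) = length xs - 1"
  by (simp add: del_def)

lemma del_Suc_Cons [simp]: "del (Suc k) (x # xs) = x # del k xs"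
  and del_0_Cons [simp]: "del 0 (x # xs) = xs"
  by (simp_all add: del_def)

lemma nth_del: "k < length xs \<Longrightarrow> i < length xs - 1 \<Longrightarrow> del k xs ! i = (if i < k then xs ! i else xs ! Suc i)"
  by (auto simp: del_def nth_append min_def)

lemma del_append: "del k (xs @ ys) = (if k < length xs then del k xs @ ys else xs @ del (k - length xs) ys)"
  by (auto simp: del_def Suc_diff_le)

lemma del_del: "l < k \<Longrightarrow> k < length xs \<Longrightarrow> del (k - 1) (del l xs) = del l (del k xs)"
  by (rule nth_equalityI) (auto simp: nth_del)

lemma set_del: "set (del k xs) \<subseteq> set xs"
  using set_take_subset set_drop_subset by (fastforce simp: del_def)

lemma map_del: "map f (del k xs) = del k (map f xs)"
  by (simp add: del_def take_map drop_map)

text \<open>Expansion along the first letter, for words that may be unsorted or repeat letters, so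
  that exchange arguments can be carried out before any sorting.\<close>

fun pfl :: "('x \<Rightarrow> 'x \<Rightarrow> 'a::comm_ring_1) \<Rightarrow> 'x list \<Rightarrow> 'a" where
  "pfl A [] = 1"
| "pfl A (x # xs) = (\<Sum>k<length xs. (-1) ^ k * A x (xs ! k) * pfl A (del k xs))"

lemma pfl_map: "pfl A (map f xs) = pfl (\<lambda>i j. A (f i) (f j)) xs"
  by (induction "\<lambda>i j. A (f i) (f j)" xs rule: pfl.induct) (simp_all flip: map_del)

lemma pfl_odd: "odd (length xs) \<Longrightarrow> pfl A xs = 0"
proof (induction A xs rule: pfl.induct)
  case (2 A x xs)
  have "pfl A (del k xs) = 0" if "k < length xs" for k
    using 2 that by (intro "2.IH") auto
  then show ?case by simp
qed simp

text \<open>One term of the expansion along two letters: \<open>x\<close> is matched with position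
  \<open>k\<close> of \<open>v\<close>, and \<open>y\<close> with position \<open>l\<close> of what
  remains.\<close>

definition pfl_pair :: "('x \<Rightarrow> 'x \<Rightarrow> 'a::comm_ring_1) \<Rightarrow> 'x \<Rightarrow> 'x \<Rightarrow> 'x list \<Rightarrow> nat \<Rightarrow> nat \<Rightarrow> 'a" where
  "pfl_pair A x y v k l = (-1) ^ (k + l) * A x (v ! k) * A y (del k v ! l) * pfl A (del l (del k v))"

text \<open>Of the terms that match \<open>x\<close> and \<open>y\<close> into \<open>v\<close>,
  those with \<open>l \<ge> k\<close> are renumbered by deleting the two letters in the other order.
  One index rises by 1, the sign flips and \<open>x\<close> and \<open>y\<close> exchange their
  roles, so the sum becomes visibly antisymmetric.\<close>

lemma pfl_Cons_Cons:
  "pfl A (x # y # v) = A x y * pfl A v -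
     (\<Sum>(k, l)\<in>(SIGMA k:{..<length v}. {..<k}). pfl_pair A x y v k l - pfl_pair A y x v k l)"
proof -
  let ?n = "length v"
  let ?L = "SIGMA k:{..<?n}. {..<k}" and ?U = "SIGMA k:{..<?n}. {k..<?n - 1}"
  have "(\<Sum>k<?n. (-1) ^ Suc k * A x (v ! k) * pfl A (y # del k v))
      = - (\<Sum>k<?n. \<Sum>l<?n - 1. pfl_pair A x y v k l)"
    by (simp add: sum_distrib_left sum_negf[symmetric] pfl_pair_def power_add algebra_simps)
  also have "(\<Sum>k<?n. \<Sum>l<?n - 1. pfl_pair A x y v k l)
      = (\<Sum>k<?n. (\<Sum>l<k. pfl_pair A x y v k l) + (\<Sum>l\<in>{k..<?n - 1}. pfl_pair A x y v k l))"
  proof (intro sum.cong refl)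
    fix k assume "k \<in> {..<?n}"
    then have "{..<?n - 1} = {..<k} \<union> {k..<?n - 1}" by auto
    then show "(\<Sum>l<?n - 1. pfl_pair A x y v k l)
      = (\<Sum>l<k. pfl_pair A x y v k l) + (\<Sum>l\<in>{k..<?n - 1}. pfl_pair A x y v k l)"
      by (simp add: sum.union_disjoint ivl_disj_int)
  qed
  also have "\<dots> = (\<Sum>(k, l)\<in>?L. pfl_pair A x y v k l) + (\<Sum>(k, l)\<in>?U. pfl_pair A x y v k l)"
    by (simp add: sum.distrib sum.Sigma)
  also have "(\<Sum>(k, l)\<in>?U. pfl_pair A x y v k l) = (\<Sum>(k, l)\<in>?L. - pfl_pair A y x v k l)"
  proof (rule sum.reindex_bij_witness[of _ "\<lambda>(k, l). (l, k - 1)" "\<lambda>(k, l). (Suc l, k)"])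
    fix p assume "p \<in> ?U"
    then obtain k l where p: "p = (k, l)" "k < ?n" "k \<le> l" "l < ?n - 1" by auto
    have "del (Suc l - 1) (del k v) = del k (del (Suc l) v)"
      using p by (intro del_del) auto
    then show "(case case p of (k, l) \<Rightarrow> (Suc l, k) of (k, l) \<Rightarrow> - pfl_pair A y x v k l)
        = (case p of (k, l) \<Rightarrow> pfl_pair A x y v k l)"
      using p by (simp add: pfl_pair_def nth_del power_add mult_ac)
  qed auto
  finally have "(\<Sum>k<?n. (-1) ^ Suc k * A x (v ! k) * pfl A (y # del k v))
      = - (\<Sum>(k, l)\<in>?L. pfl_pair A x y v k l - pfl_pair A y x v k l)"
    by (simp add: sum_subtractf case_prod_unfold sum_negf)
  moreover have "pfl A (x # y # v) = A x y * pfl A v + (\<Sum>k<?n. (-1) ^ Suc k * A x (v ! k) * pfl A (y # del k v))"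
    by (simp only: pfl.simps(2)[of A x] list.size add_Suc_right add_0_right sum.lessThan_Suc_shift) simp
  ultimately show ?thesis by simp
qed

locale skew_form =
  fixes A :: "'x \<Rightarrow> 'x \<Rightarrow> 'a::comm_ring_1"
  assumes skew: "A y x = - A x y" and diag: "A x x = 0"
begin

text \<open>Induction on the prefix. Expanding along its first letter, the transposition of the two
  positions interchanges the terms that delete \<open>x\<close> or \<open>y\<close>; in all other
  terms the swap happens behind a shorter prefix.\<close>

lemma pfl_swap: "pfl A (u @ x # y # v) = - pfl A (u @ y # x # v)"
proof (induction "length u" arbitrary: u v rule: less_induct)
  case less
  show ?case
  proof (cases u)
    case Nil
    have "(\<Sum>(k, l)\<in>S. pfl_pair A x y v k l - pfl_pair A y x v k l)
       = - (\<Sum>(k, l)\<in>S. pfl_pair A y x v k l - pfl_pair A x y v k l)" for S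
      by (simp add: case_prod_unfold sum_negf[symmetric])
    then show ?thesis
      unfolding Nil append_Nil pfl_Cons_Cons[of A x y v] pfl_Cons_Cons[of A y x v] skew[of y x]
      by simp
  next
    case (Cons z u')
    let ?n = "length u'"
    let ?\<tau> = "transpose ?n (Suc ?n)"
    let ?w = "u' @ x # y # v" and ?w' = "u' @ y # x # v"
    have "(\<Sum>k<length ?w. (-1) ^ k * A z (?w ! k) * pfl A (del k ?w))
        = (\<Sum>k<length ?w'. - ((-1) ^ k * A z (?w' ! k) * pfl A (del k ?w')))"
    proof (rule sum.reindex_bij_witness[of _ ?\<tau> ?\<tau>])
      fix k assume "k \<in> {..<length ?w}"
      then consider "k = ?n" | "k = Suc ?n" | "k < ?n" | "k > Suc ?n" "k < length ?w" by force
      then show "- ((-1) ^ ?\<tau> k * A z (?w' ! ?\<tau> k) * pfl A (del (?\<tau> k) ?w'))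
          = (-1) ^ k * A z (?w ! k) * pfl A (del k ?w)"
      proof cases
        case 3
        have "pfl A (del k u' @ x # y # v) = - pfl A (del k u' @ y # x # v)"
          using 3 Cons by (intro less) simp
        then show ?thesis using 3
          by (simp add: del_append nth_append transpose_apply_other)
      next
        case 4
        then obtain l where l: "k = Suc (Suc ?n) + l" by (metis Suc_leI le_Suc_ex)
        have "pfl A (u' @ x # y # del l v) = - pfl A (u' @ y # x # del l v)"
          using Cons by (intro less) simp
        then show ?thesis using l
          by (simp add: del_append nth_append transpose_apply_other)
      qed (simp_all add: del_append nth_append)
    qed (auto simp: transpose_def)
    then show ?thesis by (simp add: Cons sum_negf)
  qed
qed

text \<open>Antisymmetry would give only that twice the value is 0, which says nothing in
  characteristic 2. Here \<open>diag\<close> enters in the base case, and in the expansion the two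
  terms that delete an \<open>x\<close> cancel.\<close>

lemma pfl_adjacent_eq: "pfl A (u @ x # x # v) = 0"
proof (induction "length u" arbitrary: u v rule: less_induct)
  case less
  show ?case
  proof (cases u)
    case Nil
    then show ?thesis by (simp only: append_Nil pfl_Cons_Cons diag) simp
  next
    case (Cons z u')
    let ?n = "length u'" and ?w = "u' @ x # x # v"
    let ?f = "\<lambda>k. (-1) ^ k * A z (?w ! k) * pfl A (del k ?w)"
    have "(\<Sum>k<length ?w. ?f k) = (\<Sum>k\<in>{?n, Suc ?n}. ?f k)"
    proof (rule sum.mono_neutral_right)
      show "\<forall>k\<in>{..<length ?w} - {?n, Suc ?n}. ?f k = 0"
      proof
        fix k assume k: "k \<in> {..<length ?w} - {?n, Suc ?n}"
        then consider "k < ?n" | "k > Suc ?n" by force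
        then show "?f k = 0"
        proof cases
          case 1
          then show ?thesis using less[of "del k u'" v] Cons by (simp add: del_append)
        next
          case 2
          then obtain l where l: "k = Suc (Suc ?n) + l" by (metis Suc_leI le_Suc_ex)
          then show ?thesis using less[of u' "del l v"] Cons by (simp add: del_append)
        qed
      qed
    qed auto
    also have "\<dots> = 0" by (simp add: del_append nth_append)
    finally show ?thesis by (simp add: Cons)
  qed
qed

lemma pfl_move: "pfl A (u @ v @ x # w) = pfl A (u @ x # v @ w) \<or> pfl A (u @ v @ x # w) = - pfl A (u @ x # v @ w)"
proof (induction v arbitrary: u)
  case (Cons y v)
  then show ?case using Cons[of "u @ [y]"] pfl_swap[of u y x "v @ w"] by auto
qed simp

text \<open>The sign is left open, since the uses are vanishing and membership in ideals.\<close>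

lemma pfl_perm: "mset xs = mset ys \<Longrightarrow> pfl A (p @ xs) = pfl A (p @ ys) \<or> pfl A (p @ xs) = - pfl A (p @ ys)"
proof (induction xs arbitrary: p ys)
  case (Cons x xs)
  then have "x \<in> set ys" by (metis list.set_intros(1) set_mset_mset)
  then obtain u v where ys: "ys = u @ x # v" by (meson split_list)
  have "mset xs = mset (u @ v)" using Cons.prems ys by simp
  from Cons.IH[OF this, of "p @ [x]"] show ?case
    using pfl_move[of p u x v] by (auto simp: ys)
qed simp

lemma pfl_not_distinct: "\<not> distinct xs \<Longrightarrow> pfl A xs = 0"
proof -
  assume "\<not> distinct xs"
  then obtain u v w x where xs: "xs = u @ [x] @ v @ [x] @ w"
    using not_distinct_decomp by blast
  show ?thesis
    using pfl_perm[of xs "x # x # u @ v @ w" "[]"] pfl_adjacent_eq[of "[]" x] xs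
    by (auto simp del: pfl.simps)
qed

text \<open>Both sides expand into the same double sum, over a letter of \<open>\<alpha>\<close>
  matched with a letter of \<open>\<beta>\<close>; the sign is the skewness of that one
  entry.\<close>

lemma pfl_exchange:
  "(\<Sum>i<length \<alpha>. (-1) ^ i * pfl A (del i \<alpha>) * pfl A (\<alpha> ! i # \<beta>)) =
   - (\<Sum>j<length \<beta>. (-1) ^ j * pfl A (del j \<beta>) * pfl A (\<beta> ! j # \<alpha>))"
proof -
  have "(\<Sum>i<length \<alpha>. (-1) ^ i * pfl A (del i \<alpha>) * pfl A (\<alpha> ! i # \<beta>))
     = (\<Sum>j<length \<beta>. \<Sum>i<length \<alpha>. (-1) ^ i * pfl A (del i \<alpha>) * ((-1) ^ j * A (\<alpha> ! i) (\<beta> ! j) * pfl A (del j \<beta>)))"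
    by (subst sum.swap) (simp add: sum_distrib_left)
  also have "\<dots> = (\<Sum>j<length \<beta>. - ((-1) ^ j * pfl A (del j \<beta>) * pfl A (\<beta> ! j # \<alpha>)))"
    by (simp add: sum_distrib_left sum_negf[symmetric] skew[of "\<alpha> ! _"] mult_ac)
  finally show ?thesis by (simp add: sum_negf)
qed

text \<open>In the exchange relation for \<open>\<alpha> = S i\<close> and \<open>\<beta> = S T\<close> every term with a repeated letter vanishes.\<close>

lemma pfl_pluecker:
  assumes "even (length S)"
  shows "pfl A S * pfl A (i # S @ T) =
    - (\<Sum>q<length T. (-1) ^ q * pfl A (S @ del q T) * pfl A (T ! q # S @ [i]))"
proof -
  let ?n = "length S" and ?\<alpha> = "S @ [i]" and ?\<beta> = "S @ T"
  have z: "pfl A (S ! k # S @ w) = 0" if "k < ?n" for k w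
    using that by (intro pfl_not_distinct) auto
  have "(\<Sum>k<length ?\<alpha>. (-1) ^ k * pfl A (del k ?\<alpha>) * pfl A (?\<alpha> ! k # ?\<beta>)) = pfl A S * pfl A (i # S @ T)"
    using assms by (simp add: nth_append del_append z del: pfl.simps)
  moreover have "(\<Sum>j<length ?\<beta>. (-1) ^ j * pfl A (del j ?\<beta>) * pfl A (?\<beta> ! j # ?\<alpha>))
     = (\<Sum>q<length T. (-1) ^ q * pfl A (S @ del q T) * pfl A (T ! q # S @ [i]))"
  proof -
    have "(\<Sum>j<length ?\<beta>. (-1) ^ j * pfl A (del j ?\<beta>) * pfl A (?\<beta> ! j # ?\<alpha>))
      = (\<Sum>j\<in>{?n..<?n + length T}. (-1) ^ j * pfl A (del j ?\<beta>) * pfl A (?\<beta> ! j # ?\<alpha>))"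
      by (rule sum.mono_neutral_right) (auto simp: nth_append z simp del: pfl.simps)
    also have "\<dots> = (\<Sum>q<length T. (-1) ^ (?n + q) * pfl A (del (?n + q) ?\<beta>) * pfl A (?\<beta> ! (?n + q) # ?\<alpha>))"
      by (rule sum.reindex_bij_witness[of _ "\<lambda>q. ?n + q" "\<lambda>j. j - ?n"]) auto
    also have "\<dots> = (\<Sum>q<length T. (-1) ^ q * pfl A (S @ del q T) * pfl A (T ! q # S @ [i]))"
        using assms by (simp add: del_append power_add del: pfl.simps)
    finally show ?thesis .
  qed
  ultimately show ?thesis using pfl_exchange[of ?\<alpha> ?\<beta>] by (simp del: pfl.simps)
qed

end

subsection \<open>The Pfaffian of a sum\<close>

text \<open>The signed sum over all ways to append each letter of \<open>xs\<close> to \<open>ys\<close> or to \<open>zs\<close>.\<close>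

fun pfl_split :: "('x \<Rightarrow> 'x \<Rightarrow> 'a::comm_ring_1) \<Rightarrow> ('x \<Rightarrow> 'x \<Rightarrow> 'a) \<Rightarrow> 'x list \<Rightarrow> 'x list \<Rightarrow> 'x list \<Rightarrow> 'a" where
  "pfl_split A B [] ys zs = pfl A ys * pfl B zs"
| "pfl_split A B (x # xs) ys zs =
     (-1) ^ length zs * pfl_split A B xs (ys @ [x]) zs + pfl_split A B xs ys (zs @ [x])"

text \<open>The partner of \<open>y\<close> is a letter of \<open>ys\<close> or one still to be
  distributed. In the second case each of the \<open>k\<close> letters before it counts once in the
  sign, in the Pfaffian if it goes left and in the split if it goes right, so the exponent does not
  depend on the distribution.\<close>

lemma pfl_split_expand_left:
  "pfl_split A B xs (y # ys) zs =
     (\<Sum>k<length ys. (-1) ^ k * A y (ys ! k) * pfl_split A B xs (del k ys) zs) +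
     (\<Sum>k<length xs. (-1) ^ (length ys + length zs + k) * A y (xs ! k) * pfl_split A B (del k xs) ys zs)"
proof (induction xs arbitrary: ys zs)
  case Nil
  show ?case by (simp add: sum_distrib_left sum_distrib_right mult_ac)
next
  case (Cons x xs)
  have 1: "(\<Sum>k<Suc (length ys). (-1) ^ k * A y ((ys @ [x]) ! k) * pfl_split A B xs (del k (ys @ [x])) zs)
    = (\<Sum>k<length ys. (-1) ^ k * A y (ys ! k) * pfl_split A B xs (del k ys @ [x]) zs)
      + (-1) ^ length ys * A y x * pfl_split A B xs ys zs"
    by (simp add: del_append nth_append)
  have "pfl_split A B (x # xs) (y # ys) zs =
     (-1) ^ length zs * pfl_split A B xs (y # (ys @ [x])) zs + pfl_split A B xs (y # ys) (zs @ [x])"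
    by simp
  then show ?case
    unfolding Cons.IH[of "ys @ [x]"] Cons.IH[of ys]
    unfolding length_append_singleton 1
    by (simp only: list.size add_0_right add_Suc_right sum.lessThan_Suc_shift)
      (simp add: algebra_simps sum_distrib_left sum.distrib sum_subtractf power_add sum_negf)
qed

lemma pfl_split_expand_right:
  "pfl_split A B xs ys (z # zs) =
     (\<Sum>k<length zs. (-1) ^ k * B z (zs ! k) * pfl_split A B xs ys (del k zs)) +
     (\<Sum>k<length xs. (-1) ^ (length zs + k) * B z (xs ! k) * pfl_split A B (del k xs) ys zs)"
proof (induction xs arbitrary: ys zs)
  case Nil
  show ?case by (simp add: sum_distrib_left mult_ac)
next
  case (Cons x xs)
  have 1: "(\<Sum>k<Suc (length zs). (-1) ^ k * B z ((zs @ [x]) ! k) * pfl_split A B xs ys (del k (zs @ [x])))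
    = (\<Sum>k<length zs. (-1) ^ k * B z (zs ! k) * pfl_split A B xs ys (del k zs @ [x]))
      + (-1) ^ length zs * B z x * pfl_split A B xs ys zs"
    by (simp add: del_append nth_append)
  have 2: "(\<Sum>k<length zs. (-1) ^ k * B z (zs ! k) * pfl_split A B (x # xs) ys (del k zs))
    = (\<Sum>k<length zs. (-1) ^ k * B z (zs ! k) *
        (- ((-1) ^ length zs * pfl_split A B xs (ys @ [x]) (del k zs)) + pfl_split A B xs ys (del k zs @ [x])))"
  proof (intro sum.cong refl arg_cong2[of _ _ _ _ "(*)"])
    fix k assume "k \<in> {..<length zs}"
    then show "pfl_split A B (x # xs) ys (del k zs)
      = - ((-1) ^ length zs * pfl_split A B xs (ys @ [x]) (del k zs)) + pfl_split A B xs ys (del k zs @ [x])"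
      by (cases "length zs") auto
  qed
  have "pfl_split A B (x # xs) ys (z # zs) =
     - ((-1) ^ length zs * pfl_split A B xs (ys @ [x]) (z # zs)) + pfl_split A B xs ys (z # (zs @ [x]))"
    by simp
  then show ?case
    unfolding 2 unfolding Cons.IH[of "ys @ [x]"] Cons.IH[of ys]
    unfolding length_append_singleton 1
    by (simp only: list.size add_0_right add_Suc_right sum.lessThan_Suc_shift)
      (simp add: algebra_simps sum_distrib_left sum.distrib sum_subtractf power_add sum_negf)
qed

text \<open>The entry of the first letter in the sum is divided between the sides to which the
  letter may go; with no other letter placed yet, only the second sums of the two expansions
  remain.\<close>

lemma pfl_add: "pfl (\<lambda>x y. A x y + B x y) xs = pfl_split A B xs [] []"
proof (induction "\<lambda>x y. A x y + B x y" xs rule: pfl.induct)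
  case (2 x xs)
  then show ?case
    by (simp add: pfl_split_expand_left pfl_split_expand_right algebra_simps flip: sum.distrib)
qed simp

subsection \<open>Comparison with the signed sum over matchings\<close>

definition matchings :: "nat \<Rightarrow> (nat \<Rightarrow> nat) set" where
  "matchings t = {\<sigma>. \<sigma> permutes {..<2*t} \<and> (\<forall>k<t. \<sigma> (2*k) < \<sigma> (2*k+1)) \<and>
            (\<forall>k. k + 1 < t \<longrightarrow> \<sigma> (2*k) < \<sigma> (2*k+2))}"

text \<open>A matching of \<open>{0..2t+1}\<close> is given by the partner \<open>k + 1\<close> of \<open>0\<close> and a matching \<open>\<tau>\<close> of the
  remaining points, relabelled by \<open>skip k\<close>; its permutation is \<open>cyc k \<circ> shift2 t \<tau>\<close>.\<close>

definition skip :: "nat \<Rightarrow> nat \<Rightarrow> nat" where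
  "skip k i = (if i < k then i + 1 else i + 2)"

definition cyc :: "nat \<Rightarrow> nat \<Rightarrow> nat" where
  "cyc k i = (if i = 0 then 0 else if i = 1 then k + 1 else if i \<le> k + 1 then i - 1 else i)"

definition shift2 :: "nat \<Rightarrow> (nat \<Rightarrow> nat) \<Rightarrow> nat \<Rightarrow> nat" where
  "shift2 t = map_permutation {..<2*t} (\<lambda>i. i + 2)"

text \<open>Building the cycle from transpositions of neighbours yields both that it permutes the
  range and its sign.\<close>

lemma cyc_Suc: "cyc (Suc k) = transpose (k + 1) (k + 2) \<circ> cyc k"
  by (auto simp: cyc_def transpose_def fun_eq_iff)

lemma cyc_0: "cyc 0 = id"
  by (auto simp: cyc_def)

lemma cyc_permutes: "k < n - 1 \<Longrightarrow> cyc k permutes {..<n}"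
proof (induction k)
  case (Suc k)
  then show ?case unfolding cyc_Suc
    by (intro permutes_compose permutes_swap_id) auto
qed (simp add: cyc_0 permutes_id)

lemma sign_cyc: "sign (cyc k) = (-1) ^ k"
proof (induction k)
  case (Suc k)
  have "permutation (cyc k)" using cyc_permutes[of k "k + 2"] by (auto simp: permutation_permutes)
  then show ?case unfolding cyc_Suc
    by (subst sign_compose) (simp_all add: permutation_swap_id sign_swap_id Suc)
qed (simp add: cyc_0)

lemma shift2_apply:
  assumes "\<tau> permutes {..<2*t}"
  shows "i < 2 * t \<Longrightarrow> shift2 t \<tau> (i + 2) = \<tau> i + 2" "i < 2 \<Longrightarrow> shift2 t \<tau> i = i"
    "i \<ge> 2 * t \<Longrightarrow> shift2 t \<tau> (i + 2) = i + 2"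
  using map_permutation_apply[of "\<lambda>i. i + 2" "{..<2*t}" i \<tau>]
  by (auto simp: shift2_def map_permutation_def restrict_id_def inj_on_def)

lemma shift2_permutes:
  assumes "\<tau> permutes {..<2*t}" shows "shift2 t \<tau> permutes {..<2*Suc t}"
proof -
  have "shift2 t \<tau> permutes ((\<lambda>i. i + 2) ` {..<2*t})"
    unfolding shift2_def by (rule map_permutation_permutes) (auto simp: bij_betw_def inj_on_def assms)
  then show ?thesis by (rule permutes_subset) auto
qed

lemma sign_shift2: "\<tau> permutes {..<2*t} \<Longrightarrow> sign (shift2 t \<tau>) = sign \<tau>"
  unfolding shift2_def by (rule sign_map_permutation) (auto simp: inj_on_def)

text \<open>First elements increase and so does every pair, hence the smallest point can only stand
  in the first place.\<close>

lemma matching_zero: assumes "\<sigma> \<in> matchings (Suc t)" shows "\<sigma> 0 = 0"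
proof -
  have p: "\<sigma> permutes {..<2*Suc t}" using assms by (simp add: matchings_def)
  have ev: "\<sigma> 0 \<le> \<sigma> (2*k)" if "k < Suc t" for k
    using that
  proof (induction k)
    case (Suc k)
    then have "\<sigma> (2*k) < \<sigma> (2*k+2)" using assms by (auto simp: matchings_def)
    then show ?case using Suc by simp
  qed simp
  obtain j where j: "j < 2 * Suc t" "\<sigma> j = 0"
    using permutes_image[OF p] by (metis imageE lessThan_iff zero_less_Suc mult_pos_pos pos2)
  have "\<sigma> 0 \<le> \<sigma> j"
  proof (cases "even j")
    case True then show ?thesis using ev[of "j div 2"] j by auto
  next
    case False
    then obtain i where i: "j = 2 * i + 1" by (rule oddE)
    have "i < Suc t" using i j by simp
    then have "\<sigma> (2*i) < \<sigma> (2*i+1)" using assms unfolding matchings_def by blast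
    then show ?thesis using j i by simp
  qed
  then show ?thesis using j by simp
qed

lemma cyc_shift2_apply:
  assumes "\<tau> permutes {..<2*t}"
  shows "(cyc k \<circ> shift2 t \<tau>) 0 = 0" "(cyc k \<circ> shift2 t \<tau>) 1 = Suc k"
    "i < 2 * t \<Longrightarrow> (cyc k \<circ> shift2 t \<tau>) (i + 2) = skip k (\<tau> i)"
  using shift2_apply[OF assms] by (auto simp: cyc_def skip_def)

lemma cyc_shift2_matching:
  assumes "k < 2 * t + 1" "\<tau> \<in> matchings t"
  shows "cyc k \<circ> shift2 t \<tau> \<in> matchings (Suc t)"
proof -
  have p: "\<tau> permutes {..<2*t}" using assms by (simp add: matchings_def)
  have sk: "skip k a < skip k b" if "a < b" for a b using that by (auto simp: skip_def)
  have "cyc k \<circ> shift2 t \<tau> permutes {..<2*Suc t}"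
    using assms by (intro permutes_compose[OF shift2_permutes[OF p]] cyc_permutes) auto
  moreover have "(cyc k \<circ> shift2 t \<tau>) (2*i) < (cyc k \<circ> shift2 t \<tau>) (2*i+1)" if "i < Suc t" for i
  proof (cases i)
    case 0 then show ?thesis using cyc_shift2_apply(1,2)[OF p, of k] by simp
  next
    case (Suc i')
    have "skip k (\<tau> (2*i')) < skip k (\<tau> (2*i'+1))" using assms that Suc by (intro sk) (auto simp: matchings_def)
    then show ?thesis
      using cyc_shift2_apply(3)[OF p, of "2*i'" k] cyc_shift2_apply(3)[OF p, of "2*i'+1" k] that Suc by simp
  qed
  moreover have "(cyc k \<circ> shift2 t \<tau>) (2*i) < (cyc k \<circ> shift2 t \<tau>) (2*i+2)" if "i + 1 < Suc t" for i
  proof (cases i)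
    case 0 then show ?thesis
      using cyc_shift2_apply(1)[OF p, of k] cyc_shift2_apply(3)[OF p, of 0 k] that by (simp add: skip_def)
  next
    case (Suc i')
    have "skip k (\<tau> (2*i')) < skip k (\<tau> (2*i'+2))" using assms that Suc by (intro sk) (auto simp: matchings_def)
    then show ?thesis
      using cyc_shift2_apply(3)[OF p, of "2*i'" k] cyc_shift2_apply(3)[OF p, of "2*i'+2" k] that Suc by simp
  qed
  ultimately show ?thesis by (simp add: matchings_def)
qed

lemma matching_decompose:
  assumes \<sigma>: "\<sigma> \<in> matchings (Suc t)"
  obtains k \<tau> where "k < 2 * t + 1" "\<tau> \<in> matchings t" "\<sigma> = cyc k \<circ> shift2 t \<tau>"
proof -
  have p: "\<sigma> permutes {..<2*Suc t}" using \<sigma> by (simp add: matchings_def)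
  note [simp] = matching_zero[OF \<sigma>]
  have s1: "\<sigma> 0 < \<sigma> 1" using \<sigma> by (auto simp: matchings_def dest: spec[of _ 0])
  \<comment> \<open>\<open>\<sigma> 1\<close> is the partner of 0. Undoing the cycle that sends 1 to
    it leaves a permutation \<open>\<rho>\<close> that fixes 0 and 1 and acts on the rest as
    \<open>\<tau>\<close>.\<close>
  define k where "k = \<sigma> 1 - 1"
  have k: "\<sigma> 1 = Suc k" using s1 by (simp add: k_def)
  have "\<sigma> 1 < 2 * Suc t" using permutes_in_image[OF p, of 1] by simp
  then have k': "k < 2 * t + 1" using k by simp
  have cp: "cyc k permutes {..<2*Suc t}" using k' by (intro cyc_permutes) auto
  define \<rho> where "\<rho> = inv_into UNIV (cyc k) \<circ> \<sigma>"
  have \<rho>: "\<rho> permutes {..<2*Suc t}" unfolding \<rho>_def by (intro permutes_compose[OF p] permutes_inv cp)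
  have "\<rho> 0 = 0" "\<rho> 1 = 1" using k permutes_inv_eq[OF cp] by (auto simp: \<rho>_def cyc_def)
  then have ge: "\<rho> (i + 2) \<ge> 2" for i
    using inj_eq[OF permutes_inj[OF \<rho>], of "i + 2" 0] inj_eq[OF permutes_inj[OF \<rho>], of "i + 2" 1] by force
  define \<tau> where "\<tau> i = \<rho> (i + 2) - 2" for i
  have \<tau>2: "\<tau> i + 2 = \<rho> (i + 2)" for i using ge[of i] by (simp add: \<tau>_def)
  have \<tau>: "\<tau> permutes {..<2*t}"
  proof (rule bij_imp_permutes)
    have "inj_on \<tau> {..<2*t}"
      by (rule inj_onI) (metis \<tau>2 add_right_cancel inj_eq permutes_inj[OF \<rho>])
    moreover have "\<tau> ` {..<2*t} \<subseteq> {..<2*t}"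
    proof safe
      fix i assume "i < 2 * t"
      then have "i + 2 \<in> {..<2 * Suc t}" by simp
      then have "\<rho> (i + 2) \<in> {..<2 * Suc t}" by (simp only: permutes_in_image[OF \<rho>])
      then show "\<tau> i < 2 * t" unfolding \<tau>2[of i, symmetric] by simp
    qed
    ultimately show "bij_betw \<tau> {..<2*t} {..<2*t}" by (simp add: bij_betw_def endo_inj_surj)
    show "\<tau> i = i" if "i \<notin> {..<2*t}" for i using permutes_not_in[OF \<rho>, of "i + 2"] that \<tau>2[of i] by simp
  qed
  have "shift2 t \<tau> = \<rho>"
  proof
    fix i
    consider "i < 2" | j where "i = j + 2" "j < 2 * t" | j where "i = j + 2" "j \<ge> 2 * t"
      using that(2,3)[of "i - 2"] that(1) by (cases "i < 2"; cases "i - 2 < 2 * t") simp_all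
    then show "shift2 t \<tau> i = \<rho> i"
    proof cases
      case 1 then show ?thesis using shift2_apply(2)[OF \<tau>, of i] \<open>\<rho> 0 = 0\<close> \<open>\<rho> 1 = 1\<close> by (auto simp: less_2_cases_iff)
    next
      case 2 then show ?thesis using shift2_apply(1)[OF \<tau>, of j] \<tau>2 by simp
    next
      case 3 then show ?thesis using shift2_apply(3)[OF \<tau>, of j] permutes_not_in[OF \<rho>, of i] by simp
    qed
  qed
  then have eq: "\<sigma> = cyc k \<circ> shift2 t \<tau>"
    by (simp add: \<rho>_def comp_assoc[symmetric] permutes_inv_o[OF cp])
  have sk: "a < b" if "skip k a < skip k b" for a b using that by (auto simp: skip_def split: if_splits)
  note ap = cyc_shift2_apply(3)[OF \<tau>, of _ k, folded eq]
  have "\<tau> (2*i) < \<tau> (2*i+1)" if "i < t" for i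
  proof -
    have "\<sigma> (2 * Suc i) < \<sigma> (2 * Suc i + 1)" using \<sigma> that unfolding matchings_def by blast
    then show ?thesis using ap[of "2*i"] ap[of "2*i+1"] that by (simp add: sk)
  qed
  moreover have "\<tau> (2*i) < \<tau> (2*i+2)" if "i + 1 < t" for i
  proof -
    have "\<sigma> (2 * Suc i) < \<sigma> (2 * Suc i + 2)" using \<sigma> that unfolding matchings_def by (simp del: mult_Suc_right)
    then show ?thesis using ap[of "2*i"] ap[of "2*i+2"] that by (simp add: sk)
  qed
  ultimately have "\<tau> \<in> matchings t" using \<tau> by (simp add: matchings_def)
  then show thesis using that k' eq by blast
qed

lemma cyc_shift2_inject:
  assumes "\<tau> permutes {..<2*t}" "\<tau>' permutes {..<2*t}" "cyc k \<circ> shift2 t \<tau> = cyc k' \<circ> shift2 t \<tau>'"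
  shows "k = k' \<and> \<tau> = \<tau>'"
proof -
  have k: "k = k'" using cyc_shift2_apply(2)[OF assms(1), of k] cyc_shift2_apply(2)[OF assms(2), of k'] assms(3) by simp
  have "\<tau> i = \<tau>' i" for i
  proof (cases "i < 2 * t")
    case True
    have "skip k (\<tau> i) = (cyc k \<circ> shift2 t \<tau>) (i + 2)" by (rule cyc_shift2_apply(3)[OF assms(1) True, symmetric])
    also have "\<dots> = (cyc k' \<circ> shift2 t \<tau>') (i + 2)" by (rule fun_cong[OF assms(3)])
    also have "\<dots> = skip k' (\<tau>' i)" by (rule cyc_shift2_apply(3)[OF assms(2) True])
    finally have "skip k (\<tau> i) = skip k (\<tau>' i)" unfolding k .
    then show ?thesis by (auto simp: skip_def split: if_splits)
  next
    case False then show ?thesis using permutes_not_in[OF assms(1)] permutes_not_in[OF assms(2)] by simp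
  qed
  then show ?thesis using k by auto
qed

lemma pfaffian_matchings: "pfaffian t A = (\<Sum>\<sigma>\<in>matchings t. of_int (sign \<sigma>) * (\<Prod>k<t. A (\<sigma> (2*k)) (\<sigma> (2*k+1))))"
  by (simp add: pfaffian_def matchings_def)

lemma pfaffian_Suc:
  "pfaffian (Suc t) A = (\<Sum>k<2*t+1. (-1) ^ k * A 0 (Suc k) * pfaffian t (\<lambda>i j. A (skip k i) (skip k j)))"
proof -
  let ?g = "\<lambda>\<sigma>. of_int (sign \<sigma>) * (\<Prod>k<Suc t. A (\<sigma> (2*k)) (\<sigma> (2*k+1)))"
  let ?h = "\<lambda>(k, \<tau>). cyc k \<circ> shift2 t \<tau>"
  have bij: "bij_betw ?h ({..<2*t+1} \<times> matchings t) (matchings (Suc t))"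
    unfolding bij_betw_def
  proof
    show "inj_on ?h ({..<2*t+1} \<times> matchings t)"
      using cyc_shift2_inject by (auto simp: inj_on_def matchings_def)
    show "?h ` ({..<2*t+1} \<times> matchings t) = matchings (Suc t)"
      by (force simp: cyc_shift2_matching elim: matching_decompose)
  qed
  have "pfaffian (Suc t) A = (\<Sum>p\<in>{..<2*t+1} \<times> matchings t. ?g (?h p))"
    unfolding pfaffian_matchings by (rule sum.reindex_bij_betw[OF bij, symmetric])
  also have "\<dots> = (\<Sum>(k, \<tau>)\<in>{..<2*t+1} \<times> matchings t. (-1) ^ k * A 0 (Suc k) *
      (of_int (sign \<tau>) * (\<Prod>i<t. A (skip k (\<tau> (2*i))) (skip k (\<tau> (2*i+1))))))"
  proof (rule sum.cong[OF refl])
    fix p assume "p \<in> {..<2*t+1} \<times> matchings t"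
    then obtain k \<tau> where p: "p = (k, \<tau>)" and k: "k \<in> {..<2*t+1}" and "\<tau> \<in> matchings t" by blast
    then have \<tau>: "\<tau> permutes {..<2*t}" by (simp add: matchings_def)
    let ?\<sigma> = "cyc k \<circ> shift2 t \<tau>"
    have "permutation (cyc k)" "permutation (shift2 t \<tau>)"
      using cyc_permutes[of k "k + 2"] shift2_permutes[OF \<tau>] by (auto simp: permutation_permutes)
    then have "sign ?\<sigma> = (-1) ^ k * sign \<tau>"
      by (simp add: sign_compose sign_cyc sign_shift2[OF \<tau>])
    moreover have "(\<Prod>i<Suc t. A (?\<sigma> (2*i)) (?\<sigma> (2*i+1)))
       = A 0 (Suc k) * (\<Prod>i<t. A (skip k (\<tau> (2*i))) (skip k (\<tau> (2*i+1))))"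
    proof -
      have "(\<Prod>i<t. A (?\<sigma> (2*Suc i)) (?\<sigma> (2*Suc i+1))) = (\<Prod>i<t. A (skip k (\<tau> (2*i))) (skip k (\<tau> (2*i+1))))"
      proof (intro prod.cong refl)
        fix i assume "i \<in> {..<t}"
        then show "A (?\<sigma> (2*Suc i)) (?\<sigma> (2*Suc i+1)) = A (skip k (\<tau> (2*i))) (skip k (\<tau> (2*i+1)))"
          using cyc_shift2_apply(3)[OF \<tau>, of "2*i" k] cyc_shift2_apply(3)[OF \<tau>, of "2*i+1" k] by simp
      qed
      then show ?thesis
        unfolding prod.lessThan_Suc_shift using cyc_shift2_apply(1,2)[OF \<tau>, of k] by simp
    qed
    ultimately show "?g (?h p) = (case p of (k, \<tau>) \<Rightarrow> (-1) ^ k * A 0 (Suc k) *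
      (of_int (sign \<tau>) * (\<Prod>i<t. A (skip k (\<tau> (2*i))) (skip k (\<tau> (2*i+1))))))"
      unfolding p prod.case by (simp only: of_int_mult of_int_power of_int_minus of_int_1 mult_ac)
  qed
  also have "\<dots> = (\<Sum>k<2*t+1. (-1) ^ k * A 0 (Suc k) * pfaffian t (\<lambda>i j. A (skip k i) (skip k j)))"
    unfolding pfaffian_matchings sum_distrib_left by (rule sum.cartesian_product[symmetric])
  finally show ?thesis .
qed

lemma pfaffian_eq_pfl: "pfaffian t A = pfl A [0..<2*t]"
proof (induction t arbitrary: A)
  case 0
  have "matchings 0 = {id}" by (auto simp: matchings_def)
  then show ?case by (simp add: pfaffian_matchings)
next
  case (Suc t)
  have [simp]: "del k [Suc 0..<Suc (Suc (2*t))] = map (skip k) [0..<2*t]" if "k < Suc (2*t)" for k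
    using that by (intro nth_equalityI) (auto simp: nth_del skip_def simp del: upt_Suc)
  have "[0..<2*Suc t] = 0 # [Suc 0..<Suc (Suc (2*t))]" by (simp add: upt_conv_Cons del: upt_Suc)
  then show ?case
    by (simp add: pfaffian_Suc Suc pfl_map del: upt_Suc)
qed

lemma subpfaffian_eq_pfl:
  assumes "card U = 2 * t"
  shows "subpfaffian A U = pfl A (sorted_list_of_set U)"
proof -
  let ?idx = "sorted_list_of_set U"
  have "length ?idx = 2 * t" using assms by simp
  then have "map ((!) ?idx) [0..<2*t] = ?idx" by (metis map_nth)
  then show ?thesis using assms pfl_map[of A "(!) ?idx" "[0..<2*t]"]
    by (simp add: subpfaffian_def pfaffian_eq_pfl Let_def)
qed

section \<open>A weighted Greene--Kleitman theorem\<close>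

fun path_gain :: "('a \<Rightarrow> 'a \<Rightarrow> int) \<Rightarrow> 'a list \<Rightarrow> int" where
  "path_gain D (x # y # c) = D x y + path_gain D (y # c)"
| "path_gain D c = 0"

lemma path_gain_split: "path_gain D (p @ y # q) = path_gain D (p @ [y]) + path_gain D (y # q)"
  by (induction D p rule: path_gain.induct) (cases q; simp)+

lemma path_gain_snoc: "p \<noteq> [] \<Longrightarrow> path_gain D (p @ [y]) = path_gain D p + D (last p) y"
  by (induction D p rule: path_gain.induct) auto

text \<open>\<open>\<pi> y\<close> is the largest gain of a simple path ending in \<open>y\<close>.
  If an optimal path to \<open>x\<close> already passes \<open>y\<close>, its part from
  \<open>y\<close> on closes up to a cycle of gain at most 0, and its part up to \<open>y\<close> is
  a competitor.\<close>

lemma potentials: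
  assumes "finite X"
    and cyc: "\<And>c. c \<noteq> [] \<Longrightarrow> distinct c \<Longrightarrow> set c \<subseteq> X \<Longrightarrow> path_gain D c + D (last c) (hd c) \<le> 0"
  obtains \<pi> :: "'a \<Rightarrow> int" where "\<And>x y. x \<in> X \<Longrightarrow> y \<in> X \<Longrightarrow> \<pi> x + D x y \<le> \<pi> y"
proof -
  define S where "S y = {c. c \<noteq> [] \<and> distinct c \<and> set c \<subseteq> X \<and> last c = y}" for y
  define \<pi> where "\<pi> y = Max (path_gain D ` S y)" for y
  have fin: "finite (S y)" for y
    by (rule finite_subset[OF _ finite_subset_distinct[OF assms(1)]]) (auto simp: S_def)
  have ub: "path_gain D c \<le> \<pi> y" if "c \<in> S y" for c y
    unfolding \<pi>_def using that fin by (intro Max_ge) auto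
  show thesis
  proof (rule that[of \<pi>])
    fix x y assume x: "x \<in> X" and y: "y \<in> X"
    have "S x \<noteq> {}" using x by (auto simp: S_def intro!: exI[of _ "[x]"])
    then have "\<pi> x \<in> path_gain D ` S x" unfolding \<pi>_def using fin by (intro Max_in) auto
    then obtain p where p: "p \<in> S x" "\<pi> x = path_gain D p" by auto
    show "\<pi> x + D x y \<le> \<pi> y"
    proof (cases "y \<in> set p")
      case False
      then have "p @ [y] \<in> S y" using p y by (auto simp: S_def)
      from ub[OF this] show ?thesis using p path_gain_snoc[of p D y] by (simp add: S_def)
    next
      case True
      then obtain p1 p2 where q: "p = p1 @ y # p2" by (meson split_list)
      have "path_gain D (y # p2) + D (last (y # p2)) (hd (y # p2)) \<le> 0"
        using p q by (intro cyc) (auto simp: S_def)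
      moreover have "last (y # p2) = x" using p q by (auto simp: S_def)
      moreover have "p1 @ [y] \<in> S y" using p q by (auto simp: S_def)
      ultimately show ?thesis using ub[of "p1 @ [y]" y] p path_gain_split[of D p1 y p2] q by simp
    qed
  qed
qed

lemma sum_cycle_of_list:
  fixes D :: "'a \<Rightarrow> 'a \<Rightarrow> int"
  assumes "finite X" "c \<noteq> []" "distinct c" "set c \<subseteq> X" "\<And>x. D x x = 0"
  shows "(\<Sum>x\<in>X. D x (cycle_of_list c x)) = path_gain D c + D (last c) (hd c)"
proof -
  have "(\<Sum>x\<in>X. D x (cycle_of_list c x)) = (\<Sum>x\<in>set c. D x (cycle_of_list c x))"
    using assms by (intro sum.mono_neutral_right) (auto simp: id_outside_supp)
  also have "\<dots> = sum_list (map (\<lambda>x. D x (cycle_of_list c x)) c)"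
    using assms by (simp add: sum_list_distinct_conv_sum_set)
  also have "\<dots> = sum_list (map2 D c (map (cycle_of_list c) c))"
    by (rule arg_cong[where f = sum_list]) (simp add: list_eq_iff_nth_eq)
  also have "map (cycle_of_list c) c = rotate1 c"
    using cyclic_rotation[of c 1] assms by simp
  also have "sum_list (map2 D c (rotate1 c)) = path_gain D c + D (last c) (hd c)"
  proof -
    obtain x d where c: "c = x # d" using assms by (cases c) auto
    have "sum_list (map2 D (x # d) (d @ [z])) = path_gain D (x # d) + D (last (x # d)) z" for z
      by (induction d arbitrary: x) auto
    then show ?thesis by (simp add: c)
  qed
  finally show ?thesis .
qed

text \<open>Egervary's duality. An optimal permutation cannot be improved along a cycle, so the
  exchange gains \<open>D\<close> have no positive cycle and admit potentials, from which the dual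
  variables are read off. They are integers because the weights are.\<close>

lemma assignment_duality:
  fixes W :: "'a \<Rightarrow> 'a \<Rightarrow> int"
  assumes "finite P"
  obtains \<sigma> a b where "\<sigma> permutes P" "\<And>x y. x \<in> P \<Longrightarrow> y \<in> P \<Longrightarrow> W x y \<le> a x + b y"
    "(\<Sum>x\<in>P. a x + b x) = (\<Sum>x\<in>P. W x (\<sigma> x))"
proof -
  let ?w = "\<lambda>\<sigma>. \<Sum>x\<in>P. W x (\<sigma> x)"
  let ?S = "{\<sigma>. \<sigma> permutes P}"
  have fin: "finite (?w ` ?S)" "?w ` ?S \<noteq> {}" using finite_permutations[OF assms] by (auto intro: permutes_id)
  from Max_in[OF this] obtain \<sigma> where \<sigma>: "\<sigma> permutes P" "?w \<sigma> = Max (?w ` ?S)" by auto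
  have opt: "?w \<rho> \<le> ?w \<sigma>" if "\<rho> permutes P" for \<rho>
    unfolding \<sigma>(2) using fin(1) that by (intro Max_ge) auto
  define D where "D x y = W x (\<sigma> y) - W x (\<sigma> x)" for x y
  obtain \<pi> where \<pi>: "\<And>x y. x \<in> P \<Longrightarrow> y \<in> P \<Longrightarrow> \<pi> x + D x y \<le> \<pi> y"
  proof (rule potentials[OF assms, of D])
    fix c assume c: "c \<noteq> []" "distinct c" "set c \<subseteq> P"
    have "cycle_of_list c permutes P" using permutes_subset[OF cycle_permutes c(3)] .
    then have "?w (\<sigma> \<circ> cycle_of_list c) \<le> ?w \<sigma>" using \<sigma>(1) by (intro opt permutes_compose)
    moreover have "(\<Sum>x\<in>P. D x (cycle_of_list c x)) = path_gain D c + D (last c) (hd c)"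
      using c assms by (intro sum_cycle_of_list) (auto simp: D_def)
    ultimately show "path_gain D c + D (last c) (hd c) \<le> 0" by (simp add: D_def sum_subtractf)
  qed blast
  let ?i = "inv_into UNIV \<sigma>"
  have i: "?i permutes P" using \<sigma>(1) by (rule permutes_inv)
  show thesis
  proof (rule that[OF \<sigma>(1), of "\<lambda>x. W x (\<sigma> x) - \<pi> x" "\<lambda>z. \<pi> (?i z)"])
    fix x y assume "x \<in> P" "y \<in> P"
    moreover from this have "?i y \<in> P" by (simp only: permutes_in_image[OF i])
    ultimately show "W x y \<le> W x (\<sigma> x) - \<pi> x + \<pi> (?i y)"
      using \<pi>[of x "?i y"] permutes_inverses(1)[OF \<sigma>(1), of y] by (simp add: D_def)
  next
    have "(\<Sum>x\<in>P. \<pi> (?i x)) = (\<Sum>x\<in>P. \<pi> x)" using sum.permute[OF i, of \<pi>] by (simp add: comp_def)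
    then show "(\<Sum>x\<in>P. W x (\<sigma> x) - \<pi> x + \<pi> (?i x)) = (\<Sum>x\<in>P. W x (\<sigma> x))"
      by (simp add: sum.distrib sum_subtractf)
  qed
qed

text \<open>A permutation encodes a family of chains: its arcs along the order are the links, its other
  arcs close up a chain at the cost \<open>r\<close>, and its fixed points are the elements left out. The
  weight of the permutation is then the sum of \<open>length c - r\<close> over the chains \<open>c\<close>.\<close>

definition link_weight :: "('a \<Rightarrow> 'a \<Rightarrow> bool) \<Rightarrow> nat \<Rightarrow> 'a \<Rightarrow> 'a \<Rightarrow> int" where
  "link_weight lt r x y = (if x = y then 0 else if lt x y then 1 else 1 - int r)"

lemma finite_minimal:
  assumes "finite P" "P \<noteq> {}" "transp lt" "irreflp lt"
  obtains x where "x \<in> P" "\<And>y. y \<in> P \<Longrightarrow> \<not> lt y x"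
proof -
  have "\<exists>x\<in>P. \<forall>y\<in>P. \<not> lt y x"
    using assms(1,2)
  proof (induction P rule: finite_ne_induct)
    case (singleton x)
    then show ?case using assms(4) by (auto dest: irreflpD)
  next
    case (insert z F)
    then obtain x where x: "x \<in> F" "\<forall>y\<in>F. \<not> lt y x" by auto
    then show ?case using assms(3,4) by (cases "lt z x") (auto dest: irreflpD transpD)
  qed
  then show thesis using that by blast
qed

text \<open>Induction on the size of \<open>P\<close>. Fixed points are dropped. Otherwise the orbit
  of a minimal element \<open>x\<close> is followed as long as it ascends; this chain is removed
  with weight exactly \<open>length c - r\<close>, and the arc that entered \<open>x\<close> is
  redirected to the point behind the chain.\<close>

lemma chains_of_permutation:
  assumes lt: "transp lt" "irreflp lt" and r: "r \<ge> 1"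
  shows "finite P \<Longrightarrow> inj_on \<sigma> P \<Longrightarrow> \<sigma> ` P \<subseteq> P \<Longrightarrow>
    \<exists>cs. (\<forall>c\<in>set cs. sorted_wrt lt c) \<and> distinct (concat cs) \<and> set (concat cs) \<subseteq> P \<and>
      (\<Sum>x\<in>P. link_weight lt r x (\<sigma> x)) \<le> (\<Sum>c\<leftarrow>cs. int (length c) - int r)"
proof (induction "card P" arbitrary: P \<sigma> rule: less_induct)
  case less
  note fin = less.prems(1) and inj = less.prems(2) and im = less.prems(3)
  let ?W = "link_weight lt r"
  consider "P = {}" | x where "x \<in> P" "\<sigma> x = x" | "P \<noteq> {}" "\<And>x. x \<in> P \<Longrightarrow> \<sigma> x \<noteq> x" by blast
  then show ?case
  proof cases
    case 1
    then show ?thesis by (intro exI[of _ "[]"]) simp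
  next
    case 2
    have "\<sigma> ` (P - {x}) \<subseteq> P - {x}" using inj im 2 by (auto simp: inj_on_def)
    moreover have "inj_on \<sigma> (P - {x})" using inj by (rule inj_on_subset) auto
    moreover have "card (P - {x}) < card P" using fin 2 by (meson card_Diff1_less)
    ultimately obtain cs where cs: "\<forall>c\<in>set cs. sorted_wrt lt c" "distinct (concat cs)" "set (concat cs) \<subseteq> P - {x}"
      "(\<Sum>y\<in>P - {x}. ?W y (\<sigma> y)) \<le> (\<Sum>c\<leftarrow>cs. int (length c) - int r)"
      using less.hyps[of "P - {x}" \<sigma>] fin by auto
    have "(\<Sum>y\<in>P. ?W y (\<sigma> y)) = (\<Sum>y\<in>P - {x}. ?W y (\<sigma> y))"
      using sum.remove[OF fin 2(1), of "\<lambda>y. ?W y (\<sigma> y)"] 2 by (simp add: link_weight_def)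
    then show ?thesis using cs by (intro exI[of _ cs]) auto
  next
    case 3
    obtain x where x: "x \<in> P" "\<And>y. y \<in> P \<Longrightarrow> \<not> lt y x" using finite_minimal[OF fin 3(1) lt] by blast
    define f where "f i = (\<sigma> ^^ i) x" for i
    have f0: "f 0 = x" and fS: "f (Suc i) = \<sigma> (f i)" for i by (auto simp: f_def)
    have fP: "f i \<in> P" for i using im x by (induction i) (auto simp: f0 fS)
    have mono: "lt (f i) (f j)" if "i < j" "\<And>k. k < j \<Longrightarrow> lt (f k) (f (Suc k))" for i j
      using that
    proof (induction j)
      case (Suc j)
      then show ?case using transpD[OF lt(1), of "f i" "f j" "f (Suc j)"] by (cases "i = j") auto
    qed simp
    have "\<exists>k. \<not> lt (f k) (f (Suc k))"
    proof (rule ccontr)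
      assume "\<not> (\<exists>k. \<not> lt (f k) (f (Suc k)))"
      then have "inj f" using mono irreflpD[OF lt(2)] by (metis injI linorder_neqE_nat)
      moreover have "finite (range f)" using fP by (intro finite_subset[OF _ fin]) auto
      ultimately show False using finite_imageD infinite_UNIV_nat by blast
    qed
    define l where "l = (LEAST k. \<not> lt (f k) (f (Suc k)))"
    have l: "\<not> lt (f l) (f (Suc l))" unfolding l_def using \<open>\<exists>k. _\<close> by (rule LeastI_ex)
    have l': "lt (f k) (f (Suc k))" if "k < l" for k using not_less_Least[of k] that by (auto simp: l_def)
    have lt_f: "lt (f i) (f j)" if "i < j" "j \<le> l" for i j
      by (rule mono[OF that(1)]) (use that l' in auto)
    then have inj_f: "i = j" if "f i = f j" "i \<le> l" "j \<le> l" for i j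
      using that irreflpD[OF lt(2)] by (metis linorder_neqE_nat)
    define c where "c = map f [0..<Suc l]"
    define C where "C = f ` {..l}"
    have setc: "set c = C" by (auto simp: c_def C_def less_Suc_eq_le simp del: upt_Suc)
    have CP: "C \<subseteq> P" using fP by (auto simp: C_def)
    have dist: "distinct c"
      unfolding c_def distinct_map set_upt by (auto simp del: upt_Suc intro!: inj_onI inj_f)
    have sorted: "sorted_wrt lt c"
      by (auto simp: c_def sorted_wrt_iff_nth_less less_Suc_eq_le lt_f simp del: upt_Suc)
    define z where "z = f (Suc l)"
    \<comment> \<open>Bridges the gap left by the chain. If \<open>z = x\<close>, the arc into
      \<open>x\<close> starts at the top of the chain, and nothing is redirected outside it.\<close>
    define \<sigma>' where "\<sigma>' q = (if \<sigma> q = x then z else \<sigma> q)" for q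
    have xC: "x \<in> C" using f0 by (auto simp: C_def intro!: image_eqI[of _ _ 0])
    have pred: "q \<in> C" if q: "q \<in> P" "\<sigma> q = f j" "0 < j" "j \<le> Suc l" for q j
    proof -
      obtain i where i: "j = Suc i" using q(3) by (cases j) auto
      have "q = f i" using inj q fP i by (auto simp: fS inj_on_def)
      then show ?thesis using q i by (auto simp: C_def)
    qed
    have \<sigma>': "\<sigma>' q \<in> P - C" if q: "q \<in> P - C" for q
    proof (cases "\<sigma> q = x")
      case True
      have "z \<notin> C"
      proof
        assume "z \<in> C"
        then obtain j where j: "j \<le> l" "\<sigma> (f l) = f j" by (auto simp: z_def C_def fS)
        show False
        proof (cases j)
          case 0
          then have "q = f l" using inj q fP j True f0 by (auto simp: inj_on_def)
          then show False using q by (auto simp: C_def)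
        next
          case (Suc i)
          then have "f l = f i" using inj fP j by (auto simp: inj_on_def fS)
          then show False using inj_f[of l i] j Suc by auto
        qed
      qed
      then show ?thesis using True fP by (auto simp: \<sigma>'_def z_def)
    next
      case False
      have "\<sigma> q \<notin> C"
      proof
        assume "\<sigma> q \<in> C"
        then obtain j where "j \<le> l" "\<sigma> q = f j" by (auto simp: C_def)
        then show False using pred[of q j] q False f0 by (cases j) auto
      qed
      then show ?thesis using False q im by (auto simp: \<sigma>'_def)
    qed
    have inj': "inj_on \<sigma>' (P - C)"
    proof (rule inj_onI)
      fix p q assume pq: "p \<in> P - C" "q \<in> P - C" "\<sigma>' p = \<sigma>' q"
      have "\<sigma> p \<noteq> z" "\<sigma> q \<noteq> z" using pred[of p "Suc l"] pred[of q "Suc l"] pq by (auto simp: z_def)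
      then have "\<sigma> p = \<sigma> q" using pq by (auto simp: \<sigma>'_def split: if_splits)
      then show "p = q" using inj pq by (auto simp: inj_on_def)
    qed
    have "card (P - C) < card P" using fin CP xC by (intro psubset_card_mono) auto
    then obtain cs where cs: "\<forall>c\<in>set cs. sorted_wrt lt c" "distinct (concat cs)" "set (concat cs) \<subseteq> P - C"
      "(\<Sum>y\<in>P - C. ?W y (\<sigma>' y)) \<le> (\<Sum>c\<leftarrow>cs. int (length c) - int r)"
      using less.hyps[of "P - C" \<sigma>'] fin inj' \<sigma>' by blast
    \<comment> \<open>By minimality of \<open>x\<close> the old arc into \<open>x\<close> did not
      ascend and had weight \<open>1 - r\<close>, the least possible one as
      \<open>r \<ge> 1\<close>.\<close>
    have "(\<Sum>y\<in>P - C. ?W y (\<sigma> y)) \<le> (\<Sum>y\<in>P - C. ?W y (\<sigma>' y))"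
    proof (rule sum_mono)
      fix q assume q: "q \<in> P - C"
      show "?W q (\<sigma> q) \<le> ?W q (\<sigma>' q)"
        using q xC x(2)[of q] r by (auto simp: \<sigma>'_def link_weight_def)
    qed
    moreover have "(\<Sum>y\<in>C. ?W y (\<sigma> y)) = int (length c) - int r"
    proof -
      have ne: "f i \<noteq> f (Suc i)" for i using 3(2)[OF fP[of i]] unfolding fS by metis
      have "(\<Sum>y\<in>C. ?W y (\<sigma> y)) = (\<Sum>i\<le>l. ?W (f i) (f (Suc i)))"
        unfolding C_def by (subst sum.reindex) (use inj_f in \<open>auto simp: inj_on_def fS\<close>)
      also have "\<dots> = (\<Sum>i<l. ?W (f i) (f (Suc i))) + ?W (f l) (f (Suc l))"
        by (simp add: lessThan_Suc_atMost[symmetric])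
      also have "(\<Sum>i<l. ?W (f i) (f (Suc i))) = (\<Sum>i<l. 1)"
        using l' ne by (intro sum.cong) (auto simp: link_weight_def)
      also have "?W (f l) (f (Suc l)) = 1 - int r"
        using l 3(2)[OF fP, of l] by (auto simp: link_weight_def fS)
      finally show ?thesis by (simp add: c_def)
    qed
    moreover have "(\<Sum>y\<in>P. ?W y (\<sigma> y)) = (\<Sum>y\<in>P - C. ?W y (\<sigma> y)) + (\<Sum>y\<in>C. ?W y (\<sigma> y))"
      using sum.subset_diff[OF CP fin] .
    ultimately show ?thesis
      using cs sorted dist setc CP by (intro exI[of _ "c # cs"]) auto
  qed
qed

text \<open>Chains of at most \<open>r\<close> elements contribute nothing positive and are
  discarded; the chain that reaches the target is cut down to \<open>r + s\<close> elements, where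
  \<open>s\<close> is what is still missing.\<close>

lemma trim_chains:
  assumes "int s \<le> (\<Sum>c\<leftarrow>cs. int (length c) - int r)" "\<forall>c\<in>set cs. sorted_wrt lt c"
  shows "\<exists>cs'. (\<forall>c\<in>set cs'. sorted_wrt lt c \<and> length c > r) \<and> (\<Sum>c\<leftarrow>cs'. length c - r) = s \<and>
      mset (concat cs') \<subseteq># mset (concat cs)"
  using assms
proof (induction cs arbitrary: s)
  case Nil
  then show ?case by (intro exI[of _ "[]"]) simp
next
  case (Cons c cs)
  consider "s = 0" | "length c \<le> r" | "length c > r" "length c - r \<ge> s" "s > 0" | "length c > r" "length c - r < s"
    by linarith
  then show ?case
  proof cases
    case 1 then show ?thesis by (intro exI[of _ "[]"]) simp
  next
    case 2
    then obtain cs' where "\<forall>c\<in>set cs'. sorted_wrt lt c \<and> length c > r" "(\<Sum>c\<leftarrow>cs'. length c - r) = s"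
      "mset (concat cs') \<subseteq># mset (concat cs)"
      using Cons.IH[of s] Cons.prems by auto
    then show ?thesis by (intro exI[of _ cs']) (auto intro: subset_mset.order_trans)
  next
    case 3
    have "mset (take (r + s) c) \<subseteq># mset c" by (metis append_take_drop_id mset_append mset_subset_eq_add_left)
    then show ?thesis
      using 3 Cons.prems by (intro exI[of _ "[take (r + s) c]"])
        (auto simp: sorted_wrt_take intro: subset_mset.add_increasing2)
  next
    case 4
    then obtain cs' where "\<forall>c\<in>set cs'. sorted_wrt lt c \<and> length c > r"
      "(\<Sum>c\<leftarrow>cs'. length c - r) = s - (length c - r)" "mset (concat cs') \<subseteq># mset (concat cs)"
      using Cons.IH[of "s - (length c - r)"] Cons.prems by (auto simp: of_nat_diff)
    then show ?thesis using 4 Cons.prems by (intro exI[of _ "c # cs'"]) auto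
  qed
qed

text \<open>The level sets of \<open>h\<close> are antichains, and conversely the height inside a
  union of \<open>r\<close> antichains is such a function: this encodes covers by \<open>r\<close>
  antichains.\<close>

definition height_on :: "('v \<Rightarrow> 'v \<Rightarrow> bool) \<Rightarrow> nat \<Rightarrow> 'v set \<Rightarrow> ('v \<Rightarrow> nat) \<Rightarrow> bool" where
  "height_on lt r A h \<longleftrightarrow> (\<forall>v\<in>A. h v < r) \<and> (\<forall>v\<in>A. \<forall>w\<in>A. lt v w \<longrightarrow> h v < h w)"

text \<open>Each variable is split into as many copies as its exponent, copies of one variable being
  incomparable. An optimal assignment on the copies gives the chains. Its dual solution gives a set
  of weight at most the optimum and a height function outside it, and \<open>cover\<close> applies
  to these.\<close>

theorem greene_kleitman:
  fixes \<beta> :: "'v \<Rightarrow>\<^sub>0 nat"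
  assumes lt: "transp lt" "irreflp lt" and r: "r \<ge> 1"
    and cover: "\<And>C h. C \<subseteq> supp \<beta> \<Longrightarrow> height_on lt r (supp \<beta> - C) h \<Longrightarrow> s \<le> (\<Sum>v\<in>C. cf \<beta> v)"
  obtains cs \<delta> where "\<And>c. c \<in> set cs \<Longrightarrow> sorted_wrt lt c \<and> length c > r"
    "(\<Sum>c\<leftarrow>cs. length c - r) = s" "\<beta> = (\<Sum>c\<leftarrow>cs. \<Sum>v\<leftarrow>c. sgl v 1) + \<delta>"
proof -
  define P where "P = (SIGMA v:supp \<beta>. {..<cf \<beta> v})"
  have finP: "finite P" by (simp add: P_def)
  define lt' where "lt' p q \<longleftrightarrow> lt (fst p) (fst q)" for p q :: "'v \<times> nat"
  have lt': "transp lt'" "irreflp lt'"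
    unfolding lt'_def transp_def irreflp_def using transpD[OF lt(1)] irreflpD[OF lt(2)] by blast+
  let ?W = "link_weight lt' r"
  obtain \<sigma> a b where \<sigma>: "\<sigma> permutes P" and ab: "\<And>x y. x \<in> P \<Longrightarrow> y \<in> P \<Longrightarrow> ?W x y \<le> a x + b y"
    and opt: "(\<Sum>x\<in>P. a x + b x) = (\<Sum>x\<in>P. ?W x (\<sigma> x))"
    using assignment_duality[OF finP, of ?W] by blast
  obtain cs where cs: "\<forall>c\<in>set cs. sorted_wrt lt' c" "distinct (concat cs)" "set (concat cs) \<subseteq> P"
      "(\<Sum>x\<in>P. ?W x (\<sigma> x)) \<le> (\<Sum>c\<leftarrow>cs. int (length c) - int r)"
    using chains_of_permutation[OF lt' r finP, of \<sigma>] permutes_inj_on[OF \<sigma>, of P] permutes_image[OF \<sigma>] by auto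

  \<comment> \<open>Where \<open>a x + b x = 0\<close>, the dual inequality bounds the link weight
    of \<open>x\<close> and \<open>y\<close> by \<open>a x - a y\<close>: \<open>a\<close> drops
    along every link and rises by at most \<open>r - 1\<close> between any two points. Hence
    \<open>- a\<close>, suitably shifted, is a height function.\<close>
  define Z where "Z = {x \<in> P. a x + b x = 0}"
  define D where "D = fst ` Z"
  have nonneg: "0 \<le> a x + b x" if "x \<in> P" for x using ab[OF that that] by (simp add: link_weight_def)
  have DP: "D \<subseteq> supp \<beta>" by (auto simp: D_def Z_def P_def)
  define n where "n v = (SOME x. x \<in> Z \<and> fst x = v)" for v
  have n: "n v \<in> Z \<and> fst (n v) = v" if "v \<in> D" for v
    unfolding n_def by (rule someI_ex) (use that in \<open>auto simp: D_def\<close>)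
  define g where "g v = a (n v)" for v
  have g: "?W (n v) (n w) \<le> g v - g w" if "v \<in> D" "w \<in> D" for v w
    using ab[of "n v" "n w"] n[OF that(1)] n[OF that(2)] by (auto simp: g_def Z_def)
  have g_lt: "g w < g v" if "v \<in> D" "w \<in> D" "lt v w" for v w
  proof -
    have f: "fst (n v) = v" "fst (n w) = w" using n[OF that(1)] n[OF that(2)] by simp_all
    have "v \<noteq> w" using that irreflpD[OF lt(2), of v] by blast
    then have "n v \<noteq> n w" using f by metis
    then have "?W (n v) (n w) = 1" unfolding link_weight_def lt'_def f using that(3) by simp
    then show ?thesis using g[OF that(1,2)] by simp
  qed
  have g_le: "g w \<le> g v + int r - 1" if "v \<in> D" "w \<in> D" for v w
    using g[OF that] r by (auto simp: link_weight_def split: if_splits)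
  have finD: "finite D" using finite_subset[OF DP] by simp
  define h where "h v = nat (Max (g ` D) - g v)" for v
  have g_Max: "g v \<le> Max (g ` D)" if "v \<in> D" for v using finD that by simp
  have "height_on lt r D h"
    unfolding height_on_def
  proof (intro conjI ballI impI)
    fix v assume v: "v \<in> D"
    then have "Max (g ` D) \<in> g ` D" using finD by (intro Max_in) auto
    then obtain w where "w \<in> D" "Max (g ` D) = g w" by auto
    then show "h v < r" using g_le[OF v, of w] r by (auto simp: h_def)
  next
    fix v w assume "v \<in> D" "w \<in> D" "lt v w"
    then show "h v < h w" using g_lt[of v w] g_Max[of v] g_Max[of w] by (auto simp: h_def)
  qed
  moreover have "supp \<beta> - (supp \<beta> - D) = D" using DP by auto
  ultimately have "s \<le> (\<Sum>v\<in>supp \<beta> - D. cf \<beta> v)" using cover[of "supp \<beta> - D" h] by auto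
  also have "\<dots> = card (SIGMA v:supp \<beta> - D. {..<cf \<beta> v})" by simp
  \<comment> \<open>A variable outside \<open>D\<close> has all its copies outside \<open>Z\<close>,
    and there the integer \<open>a x + b x\<close> is at least 1.\<close>
  also have "\<dots> \<le> card (P - Z)"
    using finP by (intro card_mono) (force simp: P_def D_def image_iff)+
  finally have "int s \<le> int (card (P - Z))" by simp
  also have "\<dots> = (\<Sum>x\<in>P - Z. 1)" by simp
  also have "\<dots> \<le> (\<Sum>x\<in>P - Z. a x + b x)"
  proof (rule sum_mono)
    fix x assume "x \<in> P - Z"
    then show "1 \<le> a x + b x" using nonneg[of x] by (auto simp: Z_def)
  qed
  also have "\<dots> = (\<Sum>x\<in>P. a x + b x)"
    using finP by (intro sum.mono_neutral_left) (auto simp: Z_def)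
  also have "\<dots> \<le> (\<Sum>c\<leftarrow>cs. int (length c) - int r)" unfolding opt by (rule cs(4))
  finally obtain cs' where cs': "\<forall>c\<in>set cs'. sorted_wrt lt' c \<and> length c > r" "(\<Sum>c\<leftarrow>cs'. length c - r) = s"
      "mset (concat cs') \<subseteq># mset (concat cs)"
    using trim_chains[of s r cs lt'] cs(1) by blast

  \<comment> \<open>The trimmed chains use each copy at most once, so no variable is used beyond its
    exponent.\<close>
  let ?f = "\<lambda>x. sgl (fst x) 1 :: 'v \<Rightarrow>\<^sub>0 nat"
  have le: "cf (\<Sum>c\<leftarrow>cs'. \<Sum>x\<leftarrow>c. ?f x) v \<le> cf \<beta> v" for v
  proof -
    have dist: "distinct (concat cs')"
    proof -
      obtain ys where "mset ys = mset (concat cs) - mset (concat cs')" using ex_mset by blast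
      then have "mset (concat cs) = mset (concat cs' @ ys)"
        using cs'(3) by (simp add: subset_mset.add_diff_inverse del: mset_concat)
      then have "distinct (concat cs' @ ys)" using cs(2) mset_eq_imp_distinct_iff by blast
      then show ?thesis by simp
    qed
    have sub: "set (concat cs') \<subseteq> P"
      using set_mset_mono[OF cs'(3)] cs(3) by (simp only: set_mset_mset)
    have "(\<Sum>c\<leftarrow>cs'. \<Sum>x\<leftarrow>c. ?f x) = (\<Sum>x\<leftarrow>concat cs'. ?f x)"
      by (induction cs') auto
    also have "\<dots> = (\<Sum>x\<in>set (concat cs'). ?f x)"
      using dist by (rule sum_list_distinct_conv_sum_set)
    also have "cf \<dots> v = (\<Sum>x\<in>set (concat cs'). if fst x = v then 1 else 0)"
      by (simp only: lookup_sum lookup_single when_def)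
    also have "\<dots> = card {x \<in> set (concat cs'). fst x = v}"
      by (simp only: sum.inter_filter[symmetric] finite_set sum_constant mult_1_right of_nat_id)
    also have "\<dots> \<le> card ({v} \<times> {..<cf \<beta> v})"
      using sub by (intro card_mono) (auto simp: P_def)
    finally show ?thesis by simp
  qed
  have eq: "\<beta> = (\<Sum>c\<leftarrow>map (map fst) cs'. \<Sum>v\<leftarrow>c. sgl v 1) + (\<beta> - (\<Sum>c\<leftarrow>cs'. \<Sum>x\<leftarrow>c. ?f x))"
    by (rule poly_mapping_eqI) (use le in \<open>simp add: lookup_add lookup_minus comp_def\<close>)
  show thesis
    by (rule that[OF _ _ eq]) (use cs' in \<open>auto simp: comp_def lt'_def[abs_def] sorted_wrt_map\<close>)
qed

section \<open>Independence of the standard monomials on matrices of small rank\<close>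

definition nest :: "nat \<times> nat \<Rightarrow> nat \<times> nat \<Rightarrow> bool" where
  "nest v w \<longleftrightarrow> fst v < fst w \<and> snd w < snd v"

lemma transp_nest: "transp nest" and irreflp_nest: "irreflp nest"
  by (auto simp: transp_def irreflp_def nest_def)

definition copies :: "'v mono \<Rightarrow> ('v \<times> nat) set" where
  "copies t = (SIGMA v:supp t. {..<cf t v})"

lemma finite_copies [simp]: "finite (copies t)"
  by (simp add: copies_def)

lemma sum_copies: "(\<Sum>e\<in>copies t. f (fst e)) = (\<Sum>v\<in>supp t. of_nat (cf t v) * f v)"
  for f :: "_ \<Rightarrow> 'a::semiring_1"
  using sum.Sigma[of "supp t" "\<lambda>v. {..<cf t v}" "\<lambda>v _. f v"]
  by (simp add: copies_def case_prod_unfold)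

lemma prod_single: "finite A \<Longrightarrow> (\<Prod>e\<in>A. sgl (t e) (c e)) = sgl (\<Sum>e\<in>A. t e) (\<Prod>e\<in>A. c e :: 'k::comm_ring_1)"
  by (induction A rule: finite_induct) (simp_all add: mult_single)

text \<open>The indeterminates \<open>(k, 0, i)\<close> and \<open>(k, 1, i)\<close> are the entries of \<open>2r\<close> generic vectors \<open>a\<^sub>k\<close> and
  \<open>b\<^sub>k\<close>, and \<open>rank_point r\<close> is the generic skew-symmetric matrix \<open>\<Sum>\<^sub>k a\<^sub>k \<and> b\<^sub>k\<close> of rank \<open>2r\<close>.\<close>

definition wedge_entry :: "nat \<Rightarrow> nat \<times> nat \<Rightarrow> (nat \<times> nat \<times> nat, 'k::comm_ring_1) mpol" where
  "wedge_entry k v = mvar (k, 0, fst v) * mvar (k, 1, snd v) - mvar (k, 0, snd v) * mvar (k, 1, fst v)"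

definition rank_point :: "nat \<Rightarrow> nat \<times> nat \<Rightarrow> (nat \<times> nat \<times> nat, 'k::comm_ring_1) mpol" where
  "rank_point r v = (\<Sum>k<r. wedge_entry k v)"

text \<open>One of the two terms of \<open>wedge_entry (fst c) v\<close>; the flag marks the
  reversed one, which takes the vector a at \<open>snd v\<close> and has coefficient
  \<open>- 1\<close>.\<close>

definition arc_mono :: "nat \<times> bool \<Rightarrow> nat \<times> nat \<Rightarrow> (nat \<times> nat \<times> nat) mono" where
  "arc_mono c v = (if snd c then sgl (fst c, 0, snd v) 1 + sgl (fst c, 1, fst v) 1
     else sgl (fst c, 0, fst v) 1 + sgl (fst c, 1, snd v) 1)"

definition arc_sign :: "nat \<times> bool \<Rightarrow> 'k::comm_ring_1" where
  "arc_sign c = (if snd c then - 1 else 1)"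

lemma rank_point_expand:
  "rank_point r v = (\<Sum>c\<in>{..<r} \<times> UNIV. sgl (arc_mono c v) (arc_sign c))"
proof -
  have "rank_point r v = (\<Sum>k<r. \<Sum>b\<in>UNIV. sgl (arc_mono (k, b) v) (arc_sign (k, b) :: 'k::comm_ring_1))"
    by (simp add: rank_point_def wedge_entry_def UNIV_bool arc_mono_def arc_sign_def mvar_def mult_single single_uminus)
  also have "\<dots> = (\<Sum>c\<in>{..<r} \<times> UNIV. sgl (arc_mono c v) (arc_sign c))"
    by (subst sum.cartesian_product) (simp add: case_prod_unfold)
  finally show ?thesis .
qed

text \<open>The product multiplied out: \<open>\<phi>\<close> chooses for every factor of
  \<open>t\<close> a layer \<open>k\<close> and a direction of the arc.\<close>

lemma mono_val_rank_point:
  "mono_val (rank_point r) t = (\<Sum>\<phi>\<in>copies t \<rightarrow>\<^sub>E {..<r} \<times> UNIV.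
     sgl (\<Sum>e\<in>copies t. arc_mono (\<phi> e) (fst e)) (\<Prod>e\<in>copies t. arc_sign (\<phi> e) :: 'k::comm_ring_1))"
proof -
  have "mono_val (rank_point r :: _ \<Rightarrow> (_, 'k) mpol) t = (\<Prod>v\<in>supp t. \<Prod>n<cf t v. rank_point r v)"
    by (simp add: mono_val_def)
  also have "\<dots> = (\<Prod>e\<in>copies t. rank_point r (fst e))"
    unfolding copies_def by (subst prod.Sigma) (auto simp: case_prod_unfold)
  also have "\<dots> = (\<Prod>e\<in>copies t. \<Sum>c\<in>{..<r} \<times> UNIV. sgl (arc_mono c (fst e)) (arc_sign c))"
    by (simp add: rank_point_expand)
  also have "\<dots> = (\<Sum>\<phi>\<in>copies t \<rightarrow>\<^sub>E {..<r} \<times> UNIV. \<Prod>e\<in>copies t. sgl (arc_mono (\<phi> e) (fst e)) (arc_sign (\<phi> e)))"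
    by (rule prod_sum_PiE) auto
  finally show ?thesis by (simp add: prod_single)
qed

section \<open>Corner counts of multisets of arcs\<close>

definition corner :: "('e \<Rightarrow> nat \<times> nat) \<Rightarrow> 'e set \<Rightarrow> nat \<Rightarrow> nat \<Rightarrow> nat" where
  "corner g E p q = (\<Sum>e\<in>E. of_bool (p \<le> fst (g e) \<and> q \<le> snd (g e)))"

text \<open>Inclusion and exclusion on four quadrants: the corner counts determine the multiplicity
  of every arc.\<close>

lemma corner_cell:
  "(\<Sum>e\<in>E. of_bool (g e = (i, j))) + corner g E (Suc i) j + corner g E i (Suc j)
    = corner g E i j + corner g E (Suc i) (Suc j)"
  unfolding corner_def sum.distrib[symmetric]
  by (rule sum.cong[OF refl]) (auto simp: prod_eq_iff)

lemma corner_le: "corner g E p q \<le> corner g E p 0" "corner g E p q \<le> corner g E 0 q"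
  unfolding corner_def by (auto intro!: sum_mono)

text \<open>An antichain for nesting is totally ordered componentwise, so of the sets of arcs in the
  two half planes one contains the other. For any \<open>E\<close> the minimum is an upper bound;
  antichains therefore maximise all corner counts among multisets with the same margins.\<close>

lemma corner_antichain:
  assumes "\<And>d e. d \<in> E \<Longrightarrow> e \<in> E \<Longrightarrow> \<not> nest (g d) (g e)"
  shows "corner g E p q = min (corner g E p 0) (corner g E 0 q)"
proof (cases "\<exists>e\<in>E. p \<le> fst (g e) \<and> snd (g e) < q")
  case True
  then obtain e where e: "e \<in> E" "p \<le> fst (g e)" "snd (g e) < q" by blast
  have "corner g E p q = corner g E 0 q"
    unfolding corner_def
  proof (rule sum.cong[OF refl], goal_cases)
    case (1 d)
    then show ?case using assms[OF 1 e(1)] e by (auto simp: nest_def)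
  qed
  then show ?thesis using corner_le(1)[of g E p q] by simp
next
  case False
  then have "corner g E p q = corner g E p 0"
    unfolding corner_def by (intro sum.cong refl) (auto simp: not_less)
  then show ?thesis using corner_le(2)[of g E p q] by simp
qed

definition source_weight :: "(nat \<times> nat) mono \<Rightarrow> nat" where
  "source_weight t = (\<Sum>e\<in>copies t. fst (fst e))"

definition corner_weight :: "nat \<Rightarrow> (nat \<times> nat) mono \<Rightarrow> nat" where
  "corner_weight m t = (\<Sum>p\<le>m. \<Sum>q\<le>m. corner fst (copies t) p q)"

text \<open>The coefficient extracted from a polynomial evaluated at \<open>rank_point r\<close> is that of the product of
  the \<open>a\<^sub>k\<^sub>,\<^sub>i b\<^sub>k\<^sub>,\<^sub>j\<close> where \<open>(i, j)\<close> runs over \<open>\<beta>\<close> and \<open>k\<close> is its height. A monomial that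
  contributes to it has at most the source weight of \<open>\<beta>\<close>; in case of equality all arcs point forward
  and it has at most the corner weight of \<open>\<beta>\<close>; in case of equality again it is \<open>\<beta>\<close>.\<close>

lemma standard_arcs_unique:
  assumes \<beta>: "\<beta> \<in> monomials_in (skew_vars m)" and h: "height_on nest r (supp \<beta>) h"
    and \<gamma>: "\<gamma> \<in> monomials_in (skew_vars m)"
    and \<phi>: "\<phi> \<in> copies \<gamma> \<rightarrow>\<^sub>E {..<r} \<times> UNIV"
    and eq: "(\<Sum>e\<in>copies \<gamma>. arc_mono (\<phi> e) (fst e)) = (\<Sum>e\<in>copies \<beta>. arc_mono (h (fst e), False) (fst e))"
    and min: "(source_weight \<beta>, corner_weight m \<beta>) \<le> (source_weight \<gamma>, corner_weight m \<gamma>)"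
  shows "\<gamma> = \<beta> \<and> \<phi> = (\<lambda>e\<in>copies \<beta>. (h (fst e), False))"
proof -
  let ?V = "skew_vars m"
  have V: "fst (fst e) < snd (fst e) \<and> snd (fst e) \<le> m" if "e \<in> copies t" "t \<in> monomials_in ?V" for t e
    using that by (auto simp: copies_def monomials_in_def skew_vars_def)
  have \<phi>r: "fst (\<phi> e) < r" if "e \<in> copies \<gamma>" for e using PiE_mem[OF \<phi> that] by auto
  have hr: "h (fst e) < r" if "e \<in> copies \<beta>" for e using that h by (auto simp: copies_def height_on_def)

  \<comment> \<open>The sum of the indices at which the vectors a_k are taken: an arc contributes
    its smaller end if it points forward and its larger end if it is reversed.\<close>
  define S where "S t = (\<Sum>k<r. \<Sum>i\<le>m. i * cf t (k, 0::nat, i))" for t :: "(nat \<times> nat \<times> nat) mono"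
  have S_sum: "S (\<Sum>e\<in>E. t e) = (\<Sum>e\<in>E. S (t e))" for E :: "((nat \<times> nat) \<times> nat) set" and t
    unfolding S_def lookup_sum sum_distrib_left
    by (subst sum.swap, subst (2) sum.swap) (rule refl)
  have S_arc: "S (arc_mono c v) = (if snd c then snd v else fst v)" if "fst c < r" "fst v \<le> m" "snd v \<le> m" for c v
  proof -
    have "S (sgl (k, 0, j) 1 + sgl (k, 1, j') 1) = j" if "k < r" "j \<le> m" for k j j'
    proof -
      have "S (sgl (k, 0, j) 1 + sgl (k, 1, j') 1) = (\<Sum>k'<r. \<Sum>i\<le>m. if k' = k then if i = j then j else 0 else 0)"
        unfolding S_def by (intro sum.cong refl) (auto simp: lookup_add lookup_single when_def)
      also have "\<dots> = (\<Sum>k'<r. if k' = k then j else 0)"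
        using that by (intro sum.cong refl) auto
      finally show ?thesis using that by simp
    qed
    then show ?thesis using that by (simp add: arc_mono_def)
  qed
  have S\<gamma>: "S (\<Sum>e\<in>copies \<gamma>. arc_mono (\<phi> e) (fst e)) = (\<Sum>e\<in>copies \<gamma>. if snd (\<phi> e) then snd (fst e) else fst (fst e))"
    unfolding S_sum using V[OF _ \<gamma>] \<phi>r by (intro sum.cong refl S_arc) force+
  have S\<beta>: "S (\<Sum>e\<in>copies \<beta>. arc_mono (h (fst e), False) (fst e)) = source_weight \<beta>"
  proof -
    have "S (\<Sum>e\<in>copies \<beta>. arc_mono (h (fst e), False) (fst e)) = (\<Sum>e\<in>copies \<beta>. if snd (h (fst e), False) then snd (fst e) else fst (fst e))"
      unfolding S_sum using V[OF _ \<beta>] hr by (intro sum.cong refl S_arc) force+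
    then show ?thesis by (simp add: source_weight_def)
  qed
  have le: "source_weight \<gamma> \<le> S (\<Sum>e\<in>copies \<gamma>. arc_mono (\<phi> e) (fst e))"
    unfolding S\<gamma> source_weight_def using V[OF _ \<gamma>] by (intro sum_mono) (auto simp: less_imp_le)
  have sw: "source_weight \<gamma> = source_weight \<beta>"
    using le min unfolding eq S\<beta> by auto
  have forward: "\<phi> e = (fst (\<phi> e), False)" if "e \<in> copies \<gamma>" for e
  proof (rule ccontr)
    assume "\<phi> e \<noteq> (fst (\<phi> e), False)"
    then have "snd (\<phi> e)" by (cases "\<phi> e") auto
    have "source_weight \<gamma> < (\<Sum>e\<in>copies \<gamma>. if snd (\<phi> e) then snd (fst e) else fst (fst e))"
      unfolding source_weight_def
    proof (rule sum_strict_mono_ex1)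
      show "\<exists>e\<in>copies \<gamma>. fst (fst e) < (if snd (\<phi> e) then snd (fst e) else fst (fst e))"
        using V[OF that \<gamma>] \<open>snd (\<phi> e)\<close> that by (intro bexI[of _ e]) auto
    qed (use V[OF _ \<gamma>] in \<open>auto simp: less_imp_le\<close>)
    then show False using sw unfolding S\<gamma>[symmetric] eq S\<beta> by simp
  qed

  define E\<gamma> where "E\<gamma> k = {e \<in> copies \<gamma>. fst (\<phi> e) = k}" for k
  define E\<beta> where "E\<beta> k = {e \<in> copies \<beta>. h (fst e) = k}" for k
  \<comment> \<open>The extracted monomial shows, layer by layer, how many arcs start
    (\<open>x = 0\<close>) or end (\<open>x = 1\<close>) at \<open>p\<close> or later, so
    \<open>\<gamma>\<close> and \<open>\<beta>\<close> have the same margins in every layer.\<close>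
  have margin: "(\<Sum>i\<in>{p..m}. cf (\<Sum>e\<in>copies t. arc_mono (c e, False) (fst e)) (k, x, i))
      = (\<Sum>e\<in>{e \<in> copies t. c e = k}. of_bool (p \<le> (if x = 0 then fst (fst e) else snd (fst e))))"
    if "t \<in> monomials_in ?V" "x = 0 \<or> x = 1" for t c k p and x :: nat
  proof -
    let ?end = "\<lambda>e. if x = 0 then fst (fst e) else snd (fst e)"
    have "(\<Sum>i\<in>{p..m}. cf (\<Sum>e\<in>copies t. arc_mono (c e, False) (fst e)) (k, x, i))
      = (\<Sum>e\<in>copies t. \<Sum>i\<in>{p..m}. cf (arc_mono (c e, False) (fst e)) (k, x, i))"
      unfolding lookup_sum by (rule sum.swap)
    also have "\<dots> = (\<Sum>e\<in>copies t. if c e = k then of_bool (p \<le> ?end e) else 0)"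
    proof (intro sum.cong refl)
      fix e assume "e \<in> copies t"
      then have "?end e \<le> m" using V[OF _ that(1), of e] by simp
      moreover have "(\<Sum>i\<in>{p..m}. cf (arc_mono (c e, False) (fst e)) (k, x, i))
        = (\<Sum>i\<in>{p..m}. if i = ?end e then of_bool (c e = k) else 0)"
        using that(2) by (intro sum.cong refl) (auto simp: arc_mono_def lookup_add lookup_single when_def)
      ultimately show "(\<Sum>i\<in>{p..m}. cf (arc_mono (c e, False) (fst e)) (k, x, i)) = (if c e = k then of_bool (p \<le> ?end e) else 0)"
        by auto
    qed
    also have "\<dots> = (\<Sum>e\<in>{e \<in> copies t. c e = k}. of_bool (p \<le> ?end e))"
      by (subst sum.inter_filter) auto
    finally show ?thesis .
  qed
  have eq': "(\<Sum>e\<in>copies \<gamma>. arc_mono (fst (\<phi> e), False) (fst e)) = (\<Sum>e\<in>copies \<beta>. arc_mono (h (fst e), False) (fst e))"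
    unfolding eq[symmetric] using forward by (intro sum.cong) auto
  have rows: "corner fst (E\<gamma> k) p 0 = corner fst (E\<beta> k) p 0" for k p
    using margin[where p = p and c = "\<lambda>e. fst (\<phi> e)" and k = k and x = 0, OF \<gamma>] margin[where p = p and c = "\<lambda>e. h (fst e)" and k = k and x = 0, OF \<beta>]
    unfolding eq' E\<gamma>_def E\<beta>_def corner_def by simp
  have cols: "corner fst (E\<gamma> k) 0 q = corner fst (E\<beta> k) 0 q" for k q
    using margin[where p = q and c = "\<lambda>e. fst (\<phi> e)" and k = k and x = 1, OF \<gamma>] margin[where p = q and c = "\<lambda>e. h (fst e)" and k = k and x = 1, OF \<beta>]
    unfolding eq' E\<gamma>_def E\<beta>_def corner_def by simp
  have corner_E\<beta>: "corner fst (E\<beta> k) p q = min (corner fst (E\<beta> k) p 0) (corner fst (E\<beta> k) 0 q)" for k p q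
  proof (rule corner_antichain)
    fix d e assume "d \<in> E\<beta> k" "e \<in> E\<beta> k"
    then show "\<not> nest (fst d) (fst e)" using h by (fastforce simp: E\<beta>_def copies_def height_on_def)
  qed
  have corner_E_le: "corner fst (E\<gamma> k) p q \<le> corner fst (E\<beta> k) p q" for k p q
    using corner_le[of fst "E\<gamma> k" p q] corner_E\<beta>[of k p q] rows[of k p] cols[of k q] by simp
  have split\<gamma>: "(\<Sum>e\<in>copies \<gamma>. f e) = (\<Sum>k<r. \<Sum>e\<in>E\<gamma> k. f e)" for f :: "_ \<Rightarrow> nat"
    unfolding E\<gamma>_def using \<phi>r by (intro sum.group[symmetric]) auto
  have split\<beta>: "(\<Sum>e\<in>copies \<beta>. f e) = (\<Sum>k<r. \<Sum>e\<in>E\<beta> k. f e)" for f :: "_ \<Rightarrow> nat"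
    unfolding E\<beta>_def using hr by (intro sum.group[symmetric]) auto
  have corner_copies: "corner fst (copies \<gamma>) p q = (\<Sum>k<r. corner fst (E\<gamma> k) p q)"
    "corner fst (copies \<beta>) p q = (\<Sum>k<r. corner fst (E\<beta> k) p q)" for p q
    unfolding corner_def by (rule split\<gamma> split\<beta>)+
  \<comment> \<open>A strict inequality in a single corner would make the corner weight of
    \<open>\<gamma>\<close> smaller than that of \<open>\<beta>\<close>, against
    \<open>min\<close>.\<close>
  have corner_eq_small: "corner fst (E\<gamma> k) p q = corner fst (E\<beta> k) p q" if "k < r" "p \<le> m" "q \<le> m" for k p q
  proof (rule ccontr)
    assume ne: "corner fst (E\<gamma> k) p q \<noteq> corner fst (E\<beta> k) p q"
    let ?X = "{..m} \<times> {..m} \<times> {..<r}"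
    have cw: "corner_weight m \<gamma> = (\<Sum>(p, q, k)\<in>?X. corner fst (E\<gamma> k) p q)"
      "corner_weight m \<beta> = (\<Sum>(p, q, k)\<in>?X. corner fst (E\<beta> k) p q)"
      unfolding corner_weight_def corner_copies by (simp_all add: sum.cartesian_product)
    have "corner_weight m \<gamma> < corner_weight m \<beta>"
      unfolding cw
    proof (rule sum_strict_mono_ex1)
      show "\<exists>x\<in>?X. (case x of (p, q, k) \<Rightarrow> corner fst (E\<gamma> k) p q) < (case x of (p, q, k) \<Rightarrow> corner fst (E\<beta> k) p q)"
        using that ne corner_E_le[of k p q] by (intro bexI[of _ "(p, q, k)"]) auto
    qed (use corner_E_le in auto)
    then show False using min sw by simp
  qed
  have corner_eq: "corner fst (E\<gamma> k) p q = corner fst (E\<beta> k) p q" if "k < r" for k p q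
  proof (cases "p \<le> m \<and> q \<le> m")
    case False
    have "corner fst (E\<gamma> k) p q = 0" using False V[OF _ \<gamma>] by (force simp: corner_def E\<gamma>_def)
    moreover have "corner fst (E\<beta> k) p q = 0" using False V[OF _ \<beta>] by (force simp: corner_def E\<beta>_def)
    ultimately show ?thesis by simp
  qed (use corner_eq_small that in blast)
  have cell: "(\<Sum>e\<in>E\<gamma> k. of_bool (fst e = v) :: nat) = (\<Sum>e\<in>E\<beta> k. of_bool (fst e = v))" if "k < r" for k v
    using corner_cell[of fst "fst v" "snd v" "E\<gamma> k"] corner_cell[of fst "fst v" "snd v" "E\<beta> k"]
    unfolding corner_eq[OF that] prod.collapse by simp
  have count: "(\<Sum>e\<in>copies t. of_bool (fst e = v) :: nat) = cf t v" for t and v :: "nat \<times> nat"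
    unfolding sum_copies[of "\<lambda>x. of_bool (x = v)"]
    by (subst sum.cong[OF refl, of _ _ "\<lambda>x. if x = v then cf t v else 0"]) (auto simp: in_keys_iff)
  have "\<gamma> = \<beta>"
    by (rule poly_mapping_eqI) (simp add: count[symmetric] split\<gamma> split\<beta> cell)
  moreover have "\<phi> e = (h (fst e), False)" if e: "e \<in> copies \<gamma>" for e
  proof -
    let ?k = "fst (\<phi> e)"
    have "0 < (\<Sum>d\<in>E\<gamma> ?k. of_bool (fst d = fst e) :: nat)"
    proof (rule sum_pos2[of _ e])
      show "e \<in> E\<gamma> ?k" "finite (E\<gamma> ?k)" using e by (simp_all add: E\<gamma>_def)
    qed simp_all
    then have "0 < (\<Sum>d\<in>E\<beta> ?k. of_bool (fst d = fst e) :: nat)" using cell[OF \<phi>r[OF e]] by simp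
    then have "\<not> (\<forall>d\<in>E\<beta> ?k. of_bool (fst d = fst e) = (0 :: nat))" 
      using sum.neutral[of "E\<beta> ?k" "\<lambda>d. of_bool (fst d = fst e) :: nat"] by linarith
    then obtain d where "d \<in> E\<beta> ?k" "fst d = fst e" by auto
    then have "h (fst e) = ?k" by (simp add: E\<beta>_def)
    then show ?thesis using forward[OF e] by simp
  qed
  moreover have "\<phi> \<in> extensional (copies \<gamma>)" using \<phi> by (simp add: PiE_def)
  ultimately show ?thesis by (auto simp: fun_eq_iff extensional_def)
qed

definition standard :: "nat \<Rightarrow> (nat \<times> nat) mono \<Rightarrow> bool" where
  "standard r t \<longleftrightarrow> (\<exists>h. height_on nest r (supp t) h)"

text \<open>In the support of \<open>f\<close> a monomial is chosen that is least for the pair of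
  weights, compared lexicographically. The coefficient of \<open>T\<close>, the product of its
  forward arcs with a height function as layers, is then exactly its coefficient in
  \<open>f\<close>.\<close>

theorem standard_independent:
  fixes f :: "(nat \<times> nat, 'k::comm_ring_1) mpol"
  assumes f: "f \<in> polys (skew_vars m)" "f \<noteq> 0" and std: "\<And>t. t \<in> supp f \<Longrightarrow> standard r t"
  shows "poly_subst (rank_point r) f \<noteq> 0"
proof -
  let ?w = "\<lambda>t. (source_weight t, corner_weight m t)"
  have ne: "?w ` supp f \<noteq> {}" using f by auto
  from Min_in[OF _ this] obtain \<beta> where \<beta>: "\<beta> \<in> supp f" "?w \<beta> = Min (?w ` supp f)" by auto
  have min: "?w \<beta> \<le> ?w \<gamma>" if "\<gamma> \<in> supp f" for \<gamma>
    unfolding \<beta>(2) using that by (intro Min_le) auto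
  obtain h where h: "height_on nest r (supp \<beta>) h" using std[OF \<beta>(1)] by (auto simp: standard_def)
  define T where "T = (\<Sum>e\<in>copies \<beta>. arc_mono (h (fst e), False) (fst e))"
  define F where "F \<gamma> = copies \<gamma> \<rightarrow>\<^sub>E {..<r} \<times> (UNIV :: bool set)" for \<gamma> :: "(nat \<times> nat) mono"
  define \<phi>0 where "\<phi>0 = (\<lambda>e\<in>copies \<beta>. (h (fst e), False))"
  have finF: "finite (F \<gamma>)" for \<gamma> unfolding F_def by (intro finite_PiE) auto
  have mon: "\<gamma> \<in> monomials_in (skew_vars m)" if "\<gamma> \<in> supp f" for \<gamma>
    using f that by (auto simp: polys_def)
  have mc: "mconst c * sgl t d = sgl t (c * d :: 'k)" for c d t
    by (simp add: mconst_def mult_single)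
  have "cf (poly_subst (rank_point r) f) T = (\<Sum>\<gamma>\<in>supp f. \<Sum>\<phi>\<in>F \<gamma>.
      if (\<Sum>e\<in>copies \<gamma>. arc_mono (\<phi> e) (fst e)) = T then cf f \<gamma> * (\<Prod>e\<in>copies \<gamma>. arc_sign (\<phi> e)) else 0)"
    by (simp add: poly_subst_eq_ev ev_def mono_val_rank_point sum_distrib_left mc lookup_sum lookup_single when_def F_def)
  also have "\<dots> = (\<Sum>\<gamma>\<in>supp f. \<Sum>\<phi>\<in>F \<gamma>. if \<gamma> = \<beta> then if \<phi> = \<phi>0 then cf f \<beta> else 0 else 0)"
  proof (intro sum.cong refl)
    fix \<gamma> \<phi> assume \<gamma>: "\<gamma> \<in> supp f" and \<phi>: "\<phi> \<in> F \<gamma>"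
    have 1: "\<gamma> = \<beta> \<and> \<phi> = \<phi>0" if "(\<Sum>e\<in>copies \<gamma>. arc_mono (\<phi> e) (fst e)) = T"
      unfolding \<phi>0_def
      using that \<phi> by (intro standard_arcs_unique[OF mon[OF \<beta>(1)] h mon[OF \<gamma>] _ _ min[OF \<gamma>]]) (auto simp: F_def T_def)
    have 2: "(\<Sum>e\<in>copies \<beta>. arc_mono (\<phi>0 e) (fst e)) = T"
      unfolding T_def by (intro sum.cong refl) (simp add: \<phi>0_def)
    have 3: "(\<Prod>e\<in>copies \<beta>. arc_sign (\<phi>0 e)) = (1 :: 'k)"
      by (intro prod.neutral) (auto simp: \<phi>0_def arc_sign_def)
    show "(if (\<Sum>e\<in>copies \<gamma>. arc_mono (\<phi> e) (fst e)) = T then cf f \<gamma> * (\<Prod>e\<in>copies \<gamma>. arc_sign (\<phi> e)) else 0)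
        = (if \<gamma> = \<beta> then if \<phi> = \<phi>0 then cf f \<beta> else 0 else 0)"
    proof (cases "\<gamma> = \<beta> \<and> \<phi> = \<phi>0")
      case True
      then show ?thesis using 2 3 by simp
    next
      case False
      then have "(\<Sum>e\<in>copies \<gamma>. arc_mono (\<phi> e) (fst e)) \<noteq> T" using 1 by blast
      then show ?thesis using False by simp
    qed
  qed
  also have "\<dots> = (\<Sum>\<gamma>\<in>supp f. if \<gamma> = \<beta> then cf f \<beta> else 0)"
  proof (intro sum.cong refl)
    have "\<phi>0 \<in> F \<beta>" using h by (auto simp: F_def \<phi>0_def copies_def height_on_def)
    then show "(\<Sum>\<phi>\<in>F \<gamma>. if \<gamma> = \<beta> then if \<phi> = \<phi>0 then cf f \<beta> else 0 else 0) = (if \<gamma> = \<beta> then cf f \<beta> else 0)" for \<gamma>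
      using finF by auto
  qed
  also have "\<dots> = cf f \<beta>" using \<beta>(1) by simp
  also have "\<dots> \<noteq> 0" using \<beta>(1) by (simp add: in_keys_iff)
  finally show ?thesis by auto
qed

section \<open>Leading monomials of Pfaffians\<close>

lemma skew_form_generic_skew: "skew_form (generic_skew :: nat \<Rightarrow> nat \<Rightarrow> (nat \<times> nat, 'k::comm_ring_1) mpol)"
  by unfold_locales (auto simp: generic_skew_def)

lemma polys_generic_skew: "i \<in> {1..m} \<Longrightarrow> j \<in> {1..m} \<Longrightarrow> generic_skew i j \<in> polys (skew_vars m)"
  by (auto simp: generic_skew_def skew_vars_def intro!: polys_mvar polys_uminus)

lemma polys_pfl:
  assumes "\<And>i j. i \<in> set xs \<Longrightarrow> j \<in> set xs \<Longrightarrow> A i j \<in> polys V"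
  shows "pfl A xs \<in> polys V"
  using assms
proof (induction A xs rule: pfl.induct)
  case (2 A x xs)
  have "pfl A (del k xs) \<in> polys V" if "k < length xs" for k
    using that set_del[of k xs] by (intro "2.IH" "2.prems") auto
  moreover have "A x (xs ! k) \<in> polys V" if "k < length xs" for k
    using that by (intro "2.prems") auto
  ultimately show ?case
    by (auto intro!: polys_sum polys_mult polys_power polys_uminus)
qed simp

lemma polys_pfl_generic: "set xs \<subseteq> {1..m} \<Longrightarrow> pfl generic_skew xs \<in> polys (skew_vars m)"
  by (intro polys_pfl polys_generic_skew) auto

lemma ev_pfl: "ev mconst \<sigma> (pfl A xs) = pfl (\<lambda>i j. ev mconst \<sigma> (A i j)) xs"
  by (induction A xs rule: pfl.induct)
    (simp_all add: mconst.ev_sum mconst.ev_mult mconst.ev_power mconst.ev_uminus)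

section \<open>Weights of the antidiagonal monomials\<close>

function nested :: "nat list \<Rightarrow> (nat \<times> nat) mono" where
  "nested [] = 0"
| "nested (x # xs) = (if xs = [] then 0 else sgl (x, last xs) 1 + nested (butlast xs))"
  by pat_completeness auto
termination by (relation "measure length") auto

lemma nested_eq_sum:
  "even (length xs) \<Longrightarrow> nested xs = (\<Sum>k<length xs div 2. sgl (xs ! k, xs ! (length xs - 1 - k)) 1)"
proof (induction xs rule: nested.induct)
  case (2 x xs)
  then have ne: "xs \<noteq> []" by auto
  then obtain ys y where xs: "xs = ys @ [y]" by (cases xs rule: rev_cases) auto
  have ev: "even (length ys)" using 2(2) xs by simp
  have "nested ys = (\<Sum>k<length ys div 2. sgl (ys ! k, ys ! (length ys - 1 - k)) 1)"
    using 2(1)[OF ne] ev xs by simp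
  also have "\<dots> = (\<Sum>k<length ys div 2. sgl ((x # xs) ! Suc k, (x # xs) ! (length (x # xs) - 1 - Suc k)) 1)"
  proof (intro sum.cong refl)
    fix k assume "k \<in> {..<length ys div 2}"
    then have k: "k < length ys" "Suc k \<le> length ys" by auto
    have "length ys - Suc k < length ys" using k by simp
    moreover have "(x # xs) ! (length (x # xs) - 1 - Suc k) = (x # xs) ! (Suc (length ys - 1 - k))"
      using k by (simp add: xs Suc_diff_Suc)
    ultimately show "sgl (ys ! k, ys ! (length ys - 1 - k)) 1 = sgl ((x # xs) ! Suc k, (x # xs) ! (length (x # xs) - 1 - Suc k)) 1"
      using k by (simp add: xs nth_append)
  qed
  also have "sgl (x, y) 1 + \<dots> = (\<Sum>k<Suc (length ys div 2). sgl ((x # xs) ! k, (x # xs) ! (length (x # xs) - 1 - k)) 1)"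
    unfolding sum.lessThan_Suc_shift by (simp add: xs nth_append)
  also have "Suc (length ys div 2) = length (x # xs) div 2" using xs by simp
  finally show ?case using ne by (simp add: xs)
qed simp

lemma antidiagonal_mono_eq_nested:
  assumes "card U = 2 * t"
  shows "antidiagonal_mono U = nested (sorted_list_of_set U)"
  using assms by (simp add: antidiagonal_mono_def Let_def nested_eq_sum)

text \<open>The exponential weights make an arc that opens first dominate all later ones.\<close>

definition arc_weight :: "nat \<Rightarrow> nat \<times> nat \<Rightarrow> nat" where
  "arc_weight m v = snd v * (m + 1) ^ (m - fst v)"

definition mono_weight :: "nat \<Rightarrow> (nat \<times> nat) mono \<Rightarrow> nat" where
  "mono_weight m t = (\<Sum>v\<in>supp t. cf t v * arc_weight m v)"

lemma mono_weight_superset: "finite A \<Longrightarrow> supp t \<subseteq> A \<Longrightarrow> mono_weight m t = (\<Sum>v\<in>A. cf t v * arc_weight m v)"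
  unfolding mono_weight_def by (rule sum.mono_neutral_left) (auto simp: in_keys_iff)

lemma mono_weight_add [simp]: "mono_weight m (s + t) = mono_weight m s + mono_weight m t"
  by (simp add: mono_weight_superset[of "supp s \<union> supp t"] supp_add_nat lookup_add sum.distrib algebra_simps)

lemma mono_weight_zero [simp]: "mono_weight m 0 = 0"
  and mono_weight_single [simp]: "mono_weight m (sgl v n) = n * arc_weight m v"
  by (simp_all add: mono_weight_superset[of "{v}"] mono_weight_def)

lemma single_mult_eq_sum: "sgl u c * p = (\<Sum>t\<in>supp p. sgl (u + t) (c * cf p t))"
  by (subst (1) poly_decomp[of p]) (simp add: sum_distrib_left mult_single)

lemma lookup_single_mult: "cf (sgl u c * p) (u + t) = c * cf (p :: ('v, 'k::comm_ring_1) mpol) t"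
  by (auto simp: single_mult_eq_sum lookup_sum lookup_single when_def in_keys_iff)

lemma lookup_single_mult_0: "(\<And>t. t \<in> supp p \<Longrightarrow> s \<noteq> u + t) \<Longrightarrow> cf (sgl u c * (p :: ('v, 'k::comm_ring_1) mpol)) s = 0"
  unfolding single_mult_eq_sum lookup_sum
  by (intro sum.neutral ballI) (metis lookup_single_not_eq)

lemma pfl_generic_Cons:
  assumes "sorted_wrt (<) (x # xs)"
  shows "pfl generic_skew (x # xs) =
    (\<Sum>k<length xs. sgl (sgl (x, xs ! k) 1) ((-1) ^ k) * (pfl generic_skew (del k xs) :: (_, 'k::comm_ring_1) mpol))"
proof -
  have "(-1) ^ k * generic_skew x (xs ! k) = (sgl (sgl (x, xs ! k) 1) ((-1) ^ k) :: (_, 'k) mpol)" if "k < length xs" for k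
  proof -
    have "(-1) ^ k = (sgl 0 ((-1) ^ k) :: (nat \<times> nat, 'k) mpol)"
      by (induction k) (simp_all add: mult_single single_uminus)
    moreover have "x < xs ! k" using assms that by auto
    ultimately show ?thesis by (simp add: generic_skew_def mvar_def mult_single)
  qed
  then show ?thesis by simp
qed

lemma supp_pfl_generic_Cons:
  assumes "sorted_wrt (<) (x # xs)" "t \<in> supp (pfl generic_skew (x # xs) :: (_, 'k::comm_ring_1) mpol)"
  obtains k t' where "k < length xs" "t' \<in> supp (pfl generic_skew (del k xs) :: (_, 'k) mpol)"
    "t = sgl (x, xs ! k) 1 + t'"
proof (rule ccontr)
  note th = that
  assume "\<not> thesis"
  then have no: "t \<noteq> sgl (x, xs ! k) 1 + t'"
    if "k < length xs" "t' \<in> supp (pfl generic_skew (del k xs) :: (_, 'k) mpol)" for k t'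
    using that th by blast
  then have "cf (pfl generic_skew (x # xs) :: (_, 'k) mpol) t = 0"
    unfolding pfl_generic_Cons[OF assms(1)] lookup_sum
    by (intro sum.neutral ballI lookup_single_mult_0) auto
  then show False using assms(2) by (simp add: in_keys_iff)
qed

lemma in_set_delD: "x \<in> set (del k xs) \<Longrightarrow> x \<in> set xs"
  using set_del by fast

lemma sorted_wrt_del: "sorted_wrt P xs \<Longrightarrow> sorted_wrt P (del k xs)"
proof (cases "k < length xs")
  case True
  assume "sorted_wrt P xs"
  then have "sorted_wrt P (take k xs @ xs ! k # drop (Suc k) xs)"
    using id_take_nth_drop[OF True] by simp
  then show ?thesis by (simp add: del_def sorted_wrt_append)
qed (simp add: del_def)

lemma del_last: "xs \<noteq> [] \<Longrightarrow> del (length xs - 1) xs = butlast xs"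
  by (simp add: del_def butlast_conv_take)

definition mono_degree :: "'v mono \<Rightarrow> nat" where
  "mono_degree t = (\<Sum>v\<in>supp t. cf t v)"

lemma mono_degree_superset: "finite A \<Longrightarrow> supp t \<subseteq> A \<Longrightarrow> mono_degree t = (\<Sum>v\<in>A. cf t v)"
  unfolding mono_degree_def by (rule sum.mono_neutral_left) (auto simp: in_keys_iff)

lemma mono_degree_add [simp]: "mono_degree (s + t) = mono_degree s + mono_degree t"
  by (simp add: mono_degree_superset[of "supp s \<union> supp t"] supp_add_nat lookup_add sum.distrib)

lemma mono_degree_zero [simp]: "mono_degree 0 = 0"
  and mono_degree_single [simp]: "mono_degree (sgl v n) = n"
  by (simp_all add: mono_degree_superset[of "{v}"] mono_degree_def)

lemma mono_degree_pfl:
  assumes "sorted_wrt (<) xs" "t \<in> supp (pfl generic_skew xs :: (_, 'k::comm_ring_1) mpol)"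
  shows "2 * mono_degree t = length xs"
  using assms
proof (induction "length xs" arbitrary: xs t rule: less_induct)
  case less
  show ?case
  proof (cases xs)
    case Nil
    then show ?thesis using less.prems by (auto split: if_splits simp: keys_one)
  next
    case (Cons x ys)
    then obtain k t' where k: "k < length ys" "t' \<in> supp (pfl generic_skew (del k ys) :: (_, 'k) mpol)"
      "t = sgl (x, ys ! k) 1 + t'"
      using less.prems supp_pfl_generic_Cons by metis
    have "2 * mono_degree t' = length (del k ys)"
      using less.prems k Cons by (intro less.hyps) (auto intro: sorted_wrt_del)
    then show ?thesis using k Cons by simp
  qed
qed

text \<open>Every index opens at most one arc, so the weight is a number written in base
  \<open>m + 1\<close>; as the opening indices exceed \<open>a\<close>, it has at most
  \<open>m - a\<close> digits.\<close>

lemma mono_weight_pfl_less: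
  assumes "sorted_wrt (<) xs" "set xs \<subseteq> {a<..m}" "t \<in> supp (pfl generic_skew xs :: (_, 'k::comm_ring_1) mpol)"
  shows "mono_weight m t < (m + 1) ^ (m - a)"
  using assms
proof (induction "length xs" arbitrary: xs t a rule: less_induct)
  case less
  show ?case
  proof (cases xs)
    case Nil
    then show ?thesis using less.prems by (auto split: if_splits)
  next
    case (Cons x ys)
    then obtain k t' where k: "k < length ys" "t' \<in> supp (pfl generic_skew (del k ys) :: (_, 'k) mpol)"
      "t = sgl (x, ys ! k) 1 + t'"
      using less.prems supp_pfl_generic_Cons by metis
    have "mono_weight m t' < (m + 1) ^ (m - x)"
    proof (rule less.hyps)
      show "set (del k ys) \<subseteq> {x<..m}" using less.prems Cons by (auto dest!: in_set_delD)
    qed (use less.prems k Cons in \<open>auto intro: sorted_wrt_del\<close>)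
    moreover have "ys ! k \<in> set ys" using k by simp
    then have "ys ! k \<le> m" using less.prems Cons by auto
    then have "arc_weight m (x, ys ! k) \<le> m * (m + 1) ^ (m - x)" by (simp add: arc_weight_def)
    ultimately have "mono_weight m t < (m + 1) ^ Suc (m - x)" using k by simp
    also have "\<dots> \<le> (m + 1) ^ (m - a)"
      using less.prems Cons by (intro power_increasing) auto
    finally show ?thesis .
  qed
qed

text \<open>A partner of \<open>x\<close> other than the last letter lowers the leading digit by at
  least 1, which the lower digits cannot make up.\<close>

lemma mono_weight_pfl_Cons_less:
  assumes "sorted_wrt (<) (x # xs)" "set (x # xs) \<subseteq> {1..m}" "k < length xs - 1"
    "t \<in> supp (pfl generic_skew (del k xs) :: (_, 'k::comm_ring_1) mpol)"
  shows "mono_weight m (sgl (x, xs ! k) 1 + t) < mono_weight m (nested (x # xs))"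
proof -
  have ne: "xs \<noteq> []" using assms(3) by auto
  have "mono_weight m t < (m + 1) ^ (m - x)"
    using assms by (intro mono_weight_pfl_less[of "del k xs"]) (auto intro: sorted_wrt_del dest!: in_set_delD)
  then have "mono_weight m (sgl (x, xs ! k) 1 + t) < Suc (xs ! k) * (m + 1) ^ (m - x)"
    by (simp add: arc_weight_def)
  also have "\<dots> \<le> last xs * (m + 1) ^ (m - x)"
  proof (rule mult_right_mono)
    have "xs ! k < xs ! (length xs - 1)" using assms by (intro sorted_wrt_nth_less[of "(<)"]) auto
    then show "Suc (xs ! k) \<le> last xs" using ne by (simp add: last_conv_nth)
  qed simp
  also have "\<dots> \<le> mono_weight m (nested (x # xs))" using ne by (simp add: arc_weight_def)
  finally show ?thesis .
qed

lemma mono_weight_pfl_le_nested: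
  assumes "sorted_wrt (<) xs" "set xs \<subseteq> {1..m}" "t \<in> supp (pfl generic_skew xs :: (_, 'k::comm_ring_1) mpol)"
  shows "t = nested xs \<or> mono_weight m t < mono_weight m (nested xs)"
  using assms
proof (induction "length xs" arbitrary: xs t rule: less_induct)
  case less
  show ?case
  proof (cases xs)
    case Nil
    then show ?thesis using less.prems by (auto split: if_splits)
  next
    case (Cons x ys)
    then obtain k t' where k: "k < length ys" "t' \<in> supp (pfl generic_skew (del k ys) :: (_, 'k) mpol)"
      "t = sgl (x, ys ! k) 1 + t'"
      using less.prems supp_pfl_generic_Cons by metis
    show ?thesis
    proof (cases "k = length ys - 1")
      case True
      have "ys \<noteq> []" using k by auto
      then have d: "del k ys = butlast ys" using True del_last[of ys] by simp
      have "t' = nested (butlast ys) \<or> mono_weight m t' < mono_weight m (nested (butlast ys))"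
        using less.prems k Cons set_del[of k ys] unfolding d[symmetric]
        by (intro less.hyps) (auto intro: sorted_wrt_del)
      moreover have "ys ! k = last ys" using True \<open>ys \<noteq> []\<close> by (simp add: last_conv_nth)
      ultimately show ?thesis using k Cons \<open>ys \<noteq> []\<close> by auto
    next
      case False
      then have "k < length ys - 1" using k by linarith
      then have "mono_weight m t < mono_weight m (nested xs)"
        using less.prems(1,2) k(2) unfolding k(3) Cons by (intro mono_weight_pfl_Cons_less)
      then show ?thesis ..
    qed
  qed
qed

text \<open>Only the last term of the expansion can produce the nested monomial, the others being
  too light. The unit coefficient is what allows reduction without division.\<close>

lemma lookup_pfl_nested:
  assumes "sorted_wrt (<) xs" "set xs \<subseteq> {1..m}" "even (length xs)"
  shows "cf (pfl generic_skew xs :: (_, 'k::comm_ring_1) mpol) (nested xs) \<in> {1, - 1}"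
  using assms
proof (induction "length xs" arbitrary: xs rule: less_induct)
  case less
  show ?case
  proof (cases xs)
    case (Cons x ys)
    have ne: "ys \<noteq> []" using less.prems Cons by auto
    let ?l = "length ys - 1"
    have b: "butlast ys = del ?l ys" using del_last[OF ne] by simp
    have IH: "cf (pfl generic_skew (butlast ys) :: (_, 'k) mpol) (nested (butlast ys)) \<in> {1, - 1}"
    proof (rule less.hyps)
      show "set (butlast ys) \<subseteq> {1..m}" using less.prems Cons by (auto dest: in_set_butlastD)
      show "sorted_wrt (<) (butlast ys)" using less.prems Cons unfolding b by (auto intro: sorted_wrt_del)
    qed (use less.prems Cons in auto)
    let ?T = "\<lambda>k. sgl (sgl (x, ys ! k) 1) ((-1) ^ k) * (pfl generic_skew (del k ys) :: (_, 'k) mpol)"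
    have "cf (pfl generic_skew xs :: (_, 'k) mpol) (nested xs) = (\<Sum>k<length ys. cf (?T k) (nested xs))"
      using less.prems by (simp only: Cons pfl_generic_Cons lookup_sum)
    also have "\<dots> = (\<Sum>k\<in>{?l}. cf (?T k) (nested xs))"
    proof (rule sum.mono_neutral_right)
      show "\<forall>k\<in>{..<length ys} - {?l}. cf (?T k) (nested xs) = 0"
      proof (intro ballI lookup_single_mult_0)
        fix k t assume "k \<in> {..<length ys} - {?l}" "t \<in> supp (pfl generic_skew (del k ys) :: (_, 'k) mpol)"
        then have "mono_weight m (sgl (x, ys ! k) 1 + t) < mono_weight m (nested xs)"
          using less.prems unfolding Cons by (intro mono_weight_pfl_Cons_less) auto
        then show "nested xs \<noteq> sgl (x, ys ! k) 1 + t" by auto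
      qed
    qed (use ne in auto)
    also have "\<dots> = (-1) ^ ?l * cf (pfl generic_skew (butlast ys) :: (_, 'k) mpol) (nested (butlast ys))"
    proof -
      have "nested xs = sgl (x, ys ! ?l) 1 + nested (butlast ys)" using ne by (simp add: Cons last_conv_nth)
      then show ?thesis
        using lookup_single_mult[of "sgl (x, ys ! ?l) 1" "(-1) ^ ?l" "pfl generic_skew (del ?l ys) :: (_, 'k) mpol" "nested (butlast ys)"]
        unfolding b by simp
    qed
    finally have eq: "cf (pfl generic_skew xs :: (_, 'k) mpol) (nested xs)
      = (-1) ^ ?l * cf (pfl generic_skew (butlast ys) :: (_, 'k) mpol) (nested (butlast ys))" .
    have "(-1) ^ ?l \<in> {1, - 1 :: 'k}" by (cases "even ?l") auto
    then show ?thesis using IH unfolding eq by auto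
  qed simp
qed

text \<open>In a chain every left end is smaller than every right end, so the left ends followed by
  the right ends in reverse form a sorted word whose nested pairing is the chain.\<close>

lemma nest_chain_nested:
  assumes "sorted_wrt nest c" "set c \<subseteq> skew_vars m"
  obtains U where "U \<subseteq> {1..m}" "card U = 2 * length c" "antidiagonal_mono U = (\<Sum>v\<leftarrow>c. sgl v 1)"
proof -
  define xs where "xs = map fst c @ rev (map snd c)"
  have "fst v < snd w" if "v \<in> set c" "w \<in> set c" for v w
  proof -
    obtain i j where ij: "i < length c" "j < length c" "v = c ! i" "w = c ! j"
      using \<open>v \<in> set c\<close> \<open>w \<in> set c\<close> by (metis in_set_conv_nth)
    have "fst v < snd v" "fst w < snd w" using that assms(2) by (auto simp: skew_vars_def)
    moreover have "i = j \<or> nest v w \<or> nest w v"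
      using ij sorted_wrt_nth_less[OF assms(1)] by (metis linorder_neqE_nat)
    ultimately show ?thesis using ij by (auto simp: nest_def)
  qed
  moreover have "sorted_wrt (<) (map fst c)" "sorted_wrt (<) (rev (map snd c))"
    using assms(1) by (auto simp: sorted_wrt_map sorted_wrt_rev nest_def elim: sorted_wrt_mono_rel[rotated])
  ultimately have sorted: "sorted_wrt (<) xs"
    by (auto simp: xs_def sorted_wrt_append)
  then have l: "sorted_list_of_set (set xs) = xs"
    by (simp add: strict_sorted_iff sorted_list_of_set.idem_if_sorted_distinct)
  have c: "card (set xs) = 2 * length c"
  proof -
    have "card (set xs) = length xs" using sorted by (intro distinct_card) (simp add: strict_sorted_iff)
    also have "\<dots> = 2 * length c" by (simp add: xs_def)
    finally show ?thesis .
  qed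
  have "nested xs = (\<Sum>v\<leftarrow>c. sgl v 1)"
    unfolding xs_def by (induction c) (simp_all add: butlast_append)
  then have "antidiagonal_mono (set xs) = (\<Sum>v\<leftarrow>c. sgl v 1)"
    using antidiagonal_mono_eq_nested[OF c] l by simp
  moreover have "set xs \<subseteq> {1..m}" using assms(2) by (fastforce simp: xs_def skew_vars_def)
  ultimately show thesis using that c by blast
qed

text \<open>The case \<open>s = 1\<close> of the chain theorem: if the whole support has no height
  function, an admissible \<open>C\<close> is nonempty and has weight at least 1. A total surplus of
  1 then means a single chain of \<open>r + 1\<close> elements.\<close>

lemma not_standard_nested:
  assumes "r \<ge> 1" "\<gamma> \<in> monomials_in (skew_vars m)" "\<not> standard r \<gamma>"
  obtains U \<delta> where "U \<subseteq> {1..m}" "card U = 2 * Suc r" "\<gamma> = antidiagonal_mono U + \<delta>"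
proof -
  have cover: "1 \<le> (\<Sum>v\<in>C. cf \<gamma> v)" if C: "C \<subseteq> supp \<gamma>" "height_on nest r (supp \<gamma> - C) h" for C h
  proof -
    have "C \<noteq> {}" using C assms(3) by (auto simp: standard_def)
    then obtain v where v: "v \<in> C" by blast
    have "0 < (\<Sum>v\<in>C. cf \<gamma> v)"
      by (rule sum_pos2[OF finite_subset[OF C(1)] v]) (use v C in \<open>auto simp: in_keys_iff\<close>)
    then show ?thesis by simp
  qed
  obtain cs \<delta> where cs: "\<And>c. c \<in> set cs \<Longrightarrow> sorted_wrt nest c \<and> length c > r"
    "(\<Sum>c\<leftarrow>cs. length c - r) = 1" "\<gamma> = (\<Sum>c\<leftarrow>cs. \<Sum>v\<leftarrow>c. sgl v 1) + \<delta>"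
    by (rule greene_kleitman[OF transp_nest irreflp_nest assms(1), of \<gamma> 1]) (use cover in auto)
  obtain c cs' where c: "cs = c # cs'" using cs(2) by (cases cs) auto
  have "r < length c" using cs(1)[of c] c by simp
  moreover have "length c - r + (\<Sum>c\<leftarrow>cs'. length c - r) = 1" using cs(2) unfolding c list.map sum_list.Cons .
  ultimately have "length c = Suc r" "(\<Sum>c\<leftarrow>cs'. length c - r) = 0" by linarith+
  moreover have "cs' = []" using \<open>_ = 0\<close> cs(1) c by (cases cs') fastforce+
  ultimately have \<gamma>: "\<gamma> = (\<Sum>v\<leftarrow>c. sgl v 1) + \<delta>" using cs(3) c by simp
  have "cf (\<Sum>v\<leftarrow>c. sgl v (1::nat)) u > 0" if "u \<in> set c" for u :: "nat \<times> nat"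
    using that by (induction c) (auto simp: lookup_add lookup_single when_def)
  then have "set c \<subseteq> supp \<gamma>" unfolding \<gamma> by (auto simp: in_keys_iff lookup_add)
  then have "set c \<subseteq> skew_vars m" using assms(2) by (auto simp: monomials_in_def)
  then obtain U where "U \<subseteq> {1..m}" "card U = 2 * length c" "antidiagonal_mono U = (\<Sum>v\<leftarrow>c. sgl v 1)"
    using nest_chain_nested[of c m] cs(1)[of c] c by auto
  then show thesis using that \<gamma> \<open>length c = Suc r\<close> by metis
qed

lemma subpfaffian_facts:
  assumes "U \<subseteq> {1..m}" "card U = 2 * t"
  shows "subpfaffian generic_skew U \<in> (polys (skew_vars m) :: (_, 'k::comm_ring_1) mpol set)"
    "cf (subpfaffian generic_skew U :: (_, 'k) mpol) (antidiagonal_mono U) \<in> {1, - 1}"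
    "u \<in> supp (subpfaffian generic_skew U :: (_, 'k) mpol) \<Longrightarrow> u = antidiagonal_mono U \<or> mono_weight m u < mono_weight m (antidiagonal_mono U)"
    "u \<in> supp (subpfaffian generic_skew U :: (_, 'k) mpol) \<Longrightarrow> mono_degree u = t"
proof -
  let ?xs = "sorted_list_of_set U"
  have fin: "finite U" using assms(1) by (rule finite_subset) simp
  have xs: "sorted_wrt (<) ?xs" "set ?xs \<subseteq> {1..m}" "length ?xs = 2 * t"
    using assms fin by (simp_all add: strict_sorted_iff)
  note eq = subpfaffian_eq_pfl[OF assms(2)] antidiagonal_mono_eq_nested[OF assms(2)]
  show "subpfaffian generic_skew U \<in> (polys (skew_vars m) :: (_, 'k) mpol set)"
    unfolding eq using xs(2) by (rule polys_pfl_generic)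
  show "cf (subpfaffian generic_skew U :: (_, 'k) mpol) (antidiagonal_mono U) \<in> {1, - 1}"
    unfolding eq using xs by (intro lookup_pfl_nested) auto
  show "u \<in> supp (subpfaffian generic_skew U :: (_, 'k) mpol) \<Longrightarrow> u = antidiagonal_mono U \<or> mono_weight m u < mono_weight m (antidiagonal_mono U)"
    unfolding eq by (rule mono_weight_pfl_le_nested[OF xs(1,2)])
  show "mono_degree u = t" if "u \<in> supp (subpfaffian generic_skew U :: (_, 'k) mpol)"
    using mono_degree_pfl[OF xs(1), of u] that xs(3) unfolding eq by simp
qed

section \<open>Secant ideals of the Pfaffian ideal\<close>

lemma finite_linear_greatest:
  assumes "linear_order_on M r" "finite A" "A \<noteq> {}" "A \<subseteq> M"
  obtains t where "t \<in> A" "\<And>u. u \<in> A \<Longrightarrow> (u, t) \<in> r"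
proof -
  have refl: "refl_on M r" and trans: "trans r" and total: "total_on M r"
    using assms(1) by (auto simp: order_on_defs)
  have "\<exists>t\<in>A. \<forall>u\<in>A. (u, t) \<in> r"
    using assms(2,3,4)
  proof (induction A rule: finite_ne_induct)
    case (singleton x)
    then show ?case using refl by (auto dest: refl_onD)
  next
    case (insert x F)
    then obtain t where t: "t \<in> F" "\<forall>u\<in>F. (u, t) \<in> r" by auto
    have "(t, x) \<in> r \<or> (x, t) \<in> r"
      using total insert.prems t(1) refl_onD[OF refl, of x] by (cases "x = t") (auto simp: total_on_def)
    then show ?case
    proof
      assume tx: "(t, x) \<in> r"
      have "(u, x) \<in> r" if "u \<in> insert x F" for u
        using that t(2) transD[OF trans _ tx] refl_onD[OF refl, of x] insert.prems by auto
      then show ?thesis by auto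
    next
      assume "(x, t) \<in> r"
      then show ?thesis using t by auto
    qed
  qed
  then show thesis using that by blast
qed

lemma lead_mono_eqI:
  assumes "linear_order_on M r" "supp p \<subseteq> M" "t \<in> supp p" "\<And>u. u \<in> supp p \<Longrightarrow> (u, t) \<in> r"
  shows "lead_mono r p = t"
  unfolding lead_mono_def
proof (rule the_equality)
  show "t \<in> supp p \<and> (\<forall>u\<in>supp p. (u, t) \<in> r)" using assms by blast
  have "antisym r" using assms(1) by (auto simp: order_on_defs)
  then show "u = t" if "u \<in> supp p \<and> (\<forall>v\<in>supp p. (v, u) \<in> r)" for u
    using that assms(3,4) by (auto dest: antisymD)
qed

lemma lead_mono:
  assumes "term_order V r" "p \<in> polys V" "p \<noteq> 0"
  shows "lead_mono r p \<in> supp p" "u \<in> supp p \<Longrightarrow> (u, lead_mono r p) \<in> r"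
proof -
  have lin: "linear_order_on (monomials_in V) r" using assms(1) by (simp add: term_order_def)
  have sub: "supp p \<subseteq> monomials_in V" "supp p \<noteq> {}" using assms by (auto simp: polys_def)
  obtain t where t: "t \<in> supp p" "\<And>u. u \<in> supp p \<Longrightarrow> (u, t) \<in> r"
    using finite_linear_greatest[OF lin finite_keys sub(2,1)] by blast
  have "lead_mono r p = t" using lin sub(1) t by (rule lead_mono_eqI)
  then show "lead_mono r p \<in> supp p" "u \<in> supp p \<Longrightarrow> (u, lead_mono r p) \<in> r" using t by auto
qed

text \<open>A concrete antidiagonal order, through which results on secant ideals that mention no
  order are proved. Ties are broken by the lexicographic order of exponent vectors.\<close>

definition weight_order :: "nat \<Rightarrow> (nat \<times> nat) mono rel" where
  "weight_order m = {(t, u). t \<in> monomials_in (skew_vars m) \<and> u \<in> monomials_in (skew_vars m) \<and>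
     (mono_weight m t < mono_weight m u \<or> mono_weight m t = mono_weight m u \<and> t \<le> u)}"

lemma mono_weight_eq_0: "t \<in> monomials_in (skew_vars m) \<Longrightarrow> mono_weight m t = 0 \<Longrightarrow> t = 0"
proof (rule ccontr)
  assume t: "t \<in> monomials_in (skew_vars m)" "mono_weight m t = 0" "t \<noteq> 0"
  then obtain v where v: "v \<in> supp t" by (metis keys_eq_empty ex_in_conv)
  then have "cf t v * arc_weight m v = 0" using t(2) by (simp add: mono_weight_def)
  moreover have "v \<in> skew_vars m" using v t(1) by (auto simp: monomials_in_def)
  ultimately show False using v by (auto simp: arc_weight_def skew_vars_def in_keys_iff)
qed

lemma term_order_weight_order: "term_order (skew_vars m) (weight_order m)"
  unfolding term_order_def
proof (intro conjI ballI allI impI)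
  show "linear_order_on (monomials_in (skew_vars m)) (weight_order m)"
    unfolding linear_order_on_def partial_order_on_def preorder_on_def
    by (auto simp: refl_on_def trans_def antisym_def total_on_def weight_order_def)
  show "(0, t) \<in> weight_order m" if "t \<in> monomials_in (skew_vars m)" for t
    using mono_weight_eq_0[OF that] that by (cases "mono_weight m t = 0") (auto simp: weight_order_def)
  show "(t + w, u + w) \<in> weight_order m" if "(t, u) \<in> weight_order m \<and> w \<in> monomials_in (skew_vars m)" for t u w
    using that by (auto simp: weight_order_def intro: add_right_mono)
qed

text \<open>The antidiagonal condition as a relation between monomials, without the description
  operator in \<open>lead_mono\<close>.\<close>

definition pf_order :: "'k::comm_ring_1 itself \<Rightarrow> nat \<Rightarrow> (nat \<times> nat) mono rel \<Rightarrow> bool" where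
  "pf_order K m ord \<longleftrightarrow> term_order (skew_vars m) ord \<and> (\<forall>U t u. U \<subseteq> {1..m} \<longrightarrow> card U = 2 * t \<longrightarrow>
      u \<in> supp (subpfaffian generic_skew U :: (_, 'k) mpol) \<longrightarrow> (u, antidiagonal_mono U) \<in> ord)"

lemma antidiagonal_in_supp:
  assumes "U \<subseteq> {1..m}" "card U = 2 * t"
  shows "antidiagonal_mono U \<in> supp (subpfaffian generic_skew U :: (_, 'k::comm_ring_1) mpol)"
  using subpfaffian_facts(2)[OF assms, where 'k = 'k] by (auto simp: in_keys_iff)

lemma antidiagonal_in_monomials:
  assumes "U \<subseteq> {1..m}" "card U = 2 * t"
  shows "antidiagonal_mono U \<in> monomials_in (skew_vars m)"
  using antidiagonal_in_supp[OF assms, where 'k = int] subpfaffian_facts(1)[OF assms, where 'k = int]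
  by (auto simp: polys_def)

lemma pf_order_iff: "pf_order TYPE('k::comm_ring_1) m ord \<longleftrightarrow> antidiagonal_term_order TYPE('k) m ord"
proof
  assume o: "antidiagonal_term_order TYPE('k) m ord"
  then have t: "term_order (skew_vars m) ord" by (simp add: antidiagonal_term_order_def)
  have "(u, antidiagonal_mono U) \<in> ord"
    if U: "U \<subseteq> {1..m}" "card U = 2 * n" and u: "u \<in> supp (subpfaffian generic_skew U :: (_, 'k) mpol)" for U n u
  proof -
    have "lead_mono ord (subpfaffian generic_skew U :: (_, 'k) mpol) = antidiagonal_mono U"
      using o U by (auto simp: antidiagonal_term_order_def)
    moreover have "(subpfaffian generic_skew U :: (_, 'k) mpol) \<noteq> 0" using u by auto
    ultimately show ?thesis
      using lead_mono(2)[OF t subpfaffian_facts(1)[OF U, where 'k = 'k], of u] u by auto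
  qed
  then show "pf_order TYPE('k) m ord" using t by (simp add: pf_order_def)
next
  assume o: "pf_order TYPE('k) m ord"
  then have t: "term_order (skew_vars m) ord" by (simp add: pf_order_def)
  have "lead_mono ord (subpfaffian generic_skew U :: (_, 'k) mpol) = antidiagonal_mono U"
    if U: "U \<subseteq> {1..m}" "card U = 2 * n" for U n
    using t subpfaffian_facts(1)[OF U, where 'k = 'k] antidiagonal_in_supp[OF U, where 'k = 'k] o U
    by (intro lead_mono_eqI[of "monomials_in (skew_vars m)"]) (auto simp: term_order_def polys_def pf_order_def)
  then show "antidiagonal_term_order TYPE('k) m ord"
    using t by (auto simp: antidiagonal_term_order_def)
qed

lemma pf_order_weight_order: "pf_order TYPE('k::comm_ring_1) m (weight_order m)"
  unfolding pf_order_def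
proof (intro conjI allI impI term_order_weight_order)
  fix U t u assume U: "U \<subseteq> {1..m}" "card U = 2 * t" and u: "u \<in> supp (subpfaffian generic_skew U :: (_, 'k) mpol)"
  have "u \<in> monomials_in (skew_vars m)" using subpfaffian_facts(1)[OF U, where 'k = 'k] u by (auto simp: polys_def)
  then show "(u, antidiagonal_mono U) \<in> weight_order m"
    using subpfaffian_facts(3)[OF U u] antidiagonal_in_monomials[OF U] by (auto simp: weight_order_def)
qed

lemma term_orderD:
  assumes "term_order V ord"
  shows "(s, t) \<in> ord \<Longrightarrow> (t, u) \<in> ord \<Longrightarrow> (s, u) \<in> ord"
    "(s, t) \<in> ord \<Longrightarrow> (t, s) \<in> ord \<Longrightarrow> s = t"
    "t \<in> monomials_in V \<Longrightarrow> (t, t) \<in> ord"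
    "(s, t) \<in> ord \<Longrightarrow> w \<in> monomials_in V \<Longrightarrow> (s + w, t + w) \<in> ord"
  using assms
  by (auto simp: term_order_def order_on_defs dest: transD antisymD refl_onD)

section \<open>Reduction modulo Pfaffians of one size\<close>

lemma mconst_single: "mconst c * sgl t d = sgl t (c * d)"
  by (simp add: mconst_def mult_single)

lemma mconst_uminus: "mconst (- c) = - mconst c"
  by (simp add: mconst_def single_uminus)

lemma lookup_mconst_mult: "cf (mconst c * p) t = c * cf (p :: ('v, 'k::comm_ring_1) mpol) t"
  using lookup_single_mult[of 0 c p t] by (simp add: mconst_def)

lemma supp_mconst_mult: "supp (mconst c * p) \<subseteq> supp (p :: ('v, 'k::comm_ring_1) mpol)"
  by (auto simp: in_keys_iff lookup_mconst_mult)

text \<open>Kept abstract because reduction is applied both to a secant ideal and to the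
  intersection of a secant ideal with a symbolic power.\<close>

locale pfaffian_ideal =
  fixes m r :: nat and P :: "(nat \<times> nat, 'k::comm_ring_1) mpol set"
  assumes r: "r \<ge> 1" and ideal: "ideal P (poly_ring (skew_vars m))"
    and pf_in: "\<And>U. U \<subseteq> {1..m} \<Longrightarrow> card U = 2 * Suc r \<Longrightarrow> subpfaffian generic_skew U \<in> P"
begin

text \<open>Two orders are at work. Termination is by \<open>mono_weight\<close>, which drops
  whenever an antidiagonal factor is replaced; \<open>ord\<close> is an arbitrary antidiagonal order
  and bounds the monomials that arise.\<close>

lemma monomial_normal_form:
  assumes ord: "pf_order TYPE('k) m ord" and "\<gamma> \<in> monomials_in (skew_vars m)"
  shows "\<exists>h\<in>polys (skew_vars m). sgl \<gamma> 1 - h \<in> P \<and> (\<forall>t\<in>supp h. standard r t \<and> (t, \<gamma>) \<in> ord) \<and>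
    (standard r \<gamma> \<longrightarrow> h = sgl \<gamma> 1)"
  using assms(2)
proof (induction "mono_weight m \<gamma>" arbitrary: \<gamma> rule: less_induct)
  case less
  have to: "term_order (skew_vars m) ord" using ord by (simp add: pf_order_def)
  show ?case
  proof (cases "standard r \<gamma>")
    case True
    then show ?thesis
      using less.prems ideal_poly_ringD(2)[OF ideal] term_orderD(3)[OF to]
      by (intro bexI[of _ "sgl \<gamma> 1"]) auto
  next
    case False
    obtain U \<delta> where U: "U \<subseteq> {1..m}" "card U = 2 * Suc r" and \<gamma>: "\<gamma> = antidiagonal_mono U + \<delta>"
      using not_standard_nested[OF r less.prems False] .
    define A where "A = antidiagonal_mono U"
    define p where "p = (subpfaffian generic_skew U :: (_, 'k) mpol)"
    \<comment> \<open>\<open>e\<close> is 1 or -1 and thus its own inverse; multiplying by it makes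
      the Pfaffian monic.\<close>
    define e where "e = cf p A"
    have e: "e * e = 1" using subpfaffian_facts(2)[OF U, where 'k = 'k] by (auto simp: e_def p_def A_def)
    have \<delta>: "\<delta> \<in> monomials_in (skew_vars m)" using less.prems \<gamma> by simp
    have p: "p \<in> polys (skew_vars m)" unfolding p_def by (rule subpfaffian_facts(1)[OF U])
    let ?u = "supp p - {A}"
    have "\<exists>h\<in>polys (skew_vars m). sgl (\<delta> + u) 1 - h \<in> P \<and> (\<forall>t\<in>supp h. standard r t \<and> (t, \<delta> + u) \<in> ord)"
      if u: "u \<in> ?u" for u
    proof -
      have "mono_weight m u < mono_weight m A"
        using subpfaffian_facts(3)[OF U, of u, where 'k = 'k] u by (auto simp: p_def A_def)
      moreover have "u \<in> monomials_in (skew_vars m)" using p u by (auto simp: polys_def)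
      ultimately show ?thesis using less.hyps[of "\<delta> + u"] \<delta> by (auto simp: \<gamma> A_def)
    qed
    then obtain h where h: "\<And>u. u \<in> ?u \<Longrightarrow> h u \<in> polys (skew_vars m)"
      "\<And>u. u \<in> ?u \<Longrightarrow> sgl (\<delta> + u) 1 - h u \<in> P"
      "\<And>u t. u \<in> ?u \<Longrightarrow> t \<in> supp (h u) \<Longrightarrow> standard r t \<and> (t, \<delta> + u) \<in> ord"
      by metis
    define H where "H = (\<Sum>u\<in>?u. mconst (- (e * cf p u)) * h u)"
    have "sgl \<delta> e * p = sgl (\<delta> + A) 1 + (\<Sum>u\<in>?u. sgl (\<delta> + u) (e * cf p u))"
    proof -
      have "A \<in> supp p" unfolding p_def A_def by (rule antidiagonal_in_supp[OF U])
      then show ?thesis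
        unfolding single_mult_eq_sum by (subst sum.remove[of _ A]) (auto simp: e e_def[symmetric])
    qed
    then have "sgl \<gamma> 1 - H = sgl \<delta> e * p - (\<Sum>u\<in>?u. mconst (e * cf p u) * (sgl (\<delta> + u) 1 - h u))"
      by (simp add: H_def \<gamma> A_def add.commute right_diff_distrib sum_subtractf mconst_single mconst_uminus sum_negf)
    also have "\<dots> \<in> P"
    proof (rule ideal_poly_ringD(6)[OF ideal])
      show "sgl \<delta> e * p \<in> P"
        using \<delta> pf_in[OF U] unfolding p_def by (intro ideal_poly_ringD(4)[OF ideal]) auto
      show "(\<Sum>u\<in>?u. mconst (e * cf p u) * (sgl (\<delta> + u) 1 - h u)) \<in> P"
        using h(2) by (intro ideal_poly_ring_sum[OF ideal] ideal_poly_ringD(4)[OF ideal] polys_mconst)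
    qed
    finally have "sgl \<gamma> 1 - H \<in> P" .
    moreover have "H \<in> polys (skew_vars m)" unfolding H_def using h(1) by (intro polys_sum polys_mult) auto
    moreover have "standard r t \<and> (t, \<gamma>) \<in> ord" if t: "t \<in> supp H" for t
    proof -
      obtain u where u: "u \<in> ?u" "t \<in> supp (h u)"
        using t keys_sum[of "\<lambda>u. mconst (- (e * cf p u)) * h u" ?u] supp_mconst_mult unfolding H_def by blast
      have "(u, A) \<in> ord" using ord U u unfolding pf_order_def p_def A_def by blast
      then have "(u + \<delta>, A + \<delta>) \<in> ord" using term_orderD(4)[OF to] \<delta> by blast
      then show ?thesis using h(3)[OF u] term_orderD(1)[OF to] by (auto simp: \<gamma> A_def add.commute)
    qed
    ultimately show ?thesis using False by blast
  qed
qed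

text \<open>The last clause says that a standard leading monomial survives with its coefficient: the
  other monomials of \<open>f\<close> reduce to monomials strictly below it.\<close>

lemma normal_form:
  assumes ord: "pf_order TYPE('k) m ord" and f: "f \<in> polys (skew_vars m)"
  obtains H where "H \<in> polys (skew_vars m)" "f - H \<in> P" "\<And>t. t \<in> supp H \<Longrightarrow> standard r t"
    "\<And>t. t \<in> supp f \<Longrightarrow> (\<And>u. u \<in> supp f \<Longrightarrow> (u, t) \<in> ord) \<Longrightarrow> standard r t \<Longrightarrow> cf H t = cf f t"
proof -
  have to: "term_order (skew_vars m) ord" using ord by (simp add: pf_order_def)
  have "\<exists>h\<in>polys (skew_vars m). sgl \<gamma> 1 - h \<in> P \<and> (\<forall>t\<in>supp h. standard r t \<and> (t, \<gamma>) \<in> ord) \<and>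
    (standard r \<gamma> \<longrightarrow> h = sgl \<gamma> 1)" if "\<gamma> \<in> supp f" for \<gamma>
    using that f by (intro monomial_normal_form[OF ord]) (auto simp: polys_def)
  then obtain h where h: "\<And>\<gamma>. \<gamma> \<in> supp f \<Longrightarrow> h \<gamma> \<in> polys (skew_vars m)"
    "\<And>\<gamma>. \<gamma> \<in> supp f \<Longrightarrow> sgl \<gamma> 1 - h \<gamma> \<in> P"
    "\<And>\<gamma> t. \<gamma> \<in> supp f \<Longrightarrow> t \<in> supp (h \<gamma>) \<Longrightarrow> standard r t \<and> (t, \<gamma>) \<in> ord"
    "\<And>\<gamma>. \<gamma> \<in> supp f \<Longrightarrow> standard r \<gamma> \<Longrightarrow> h \<gamma> = sgl \<gamma> 1"
    by metis
  define H where "H = (\<Sum>\<gamma>\<in>supp f. mconst (cf f \<gamma>) * h \<gamma>)"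
  show thesis
  proof (rule that)
    show "H \<in> polys (skew_vars m)" unfolding H_def using h(1) by (intro polys_sum polys_mult) auto
    have "f - H = (\<Sum>\<gamma>\<in>supp f. mconst (cf f \<gamma>) * (sgl \<gamma> 1 - h \<gamma>))"
      by (subst (1) poly_decomp[of f]) (simp add: H_def right_diff_distrib sum_subtractf mconst_single)
    also have "\<dots> \<in> P" using h(2) by (intro ideal_poly_ringD(4)[OF ideal] ideal_poly_ring_sum[OF ideal]) auto
    finally show "f - H \<in> P" .
    show "standard r t" if "t \<in> supp H" for t
      using that keys_sum[of "\<lambda>\<gamma>. mconst (cf f \<gamma>) * h \<gamma>" "supp f"] supp_mconst_mult h(3) unfolding H_def by blast
    show "cf H t = cf f t" if t: "t \<in> supp f" "\<And>u. u \<in> supp f \<Longrightarrow> (u, t) \<in> ord" "standard r t" for t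
    proof -
      have "cf (h \<gamma>) t = 0" if "\<gamma> \<in> supp f - {t}" for \<gamma>
        using h(3)[of \<gamma> t] t(2)[of \<gamma>] that term_orderD(2)[OF to, of \<gamma> t] by (auto simp: in_keys_iff)
      then have "cf H t = (\<Sum>\<gamma>\<in>{t}. cf f \<gamma> * cf (h \<gamma>) t)"
        unfolding H_def lookup_sum lookup_mconst_mult using t(1) by (intro sum.mono_neutral_right) auto
      then show ?thesis using h(4)[OF t(1,3)] by simp
    qed
  qed
qed

end

section \<open>Joins of ideals\<close>

lemma ideal_kernel: "ideal {p \<in> polys V. ev mconst \<sigma> p = 0} (poly_ring V)"
  by (rule ideal_poly_ringI) (auto simp: mconst.ev_add mconst.ev_mult)

lemma ideal_preimage:
  assumes I: "ideal I (poly_ring W)" and \<sigma>: "\<And>v. v \<in> V \<Longrightarrow> \<sigma> v \<in> polys W"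
  shows "ideal {p \<in> polys V. ev mconst \<sigma> p \<in> I} (poly_ring V)"
  by (rule ideal_poly_ringI)
    (auto simp: mconst.ev_add mconst.ev_mult ideal_poly_ringD[OF I] intro!: ideal_poly_ringD(4)[OF I] polys_ev \<sigma>)

definition copy1 :: "'v \<Rightarrow> ('v tripled, 'k::comm_ring_1) mpol" where "copy1 a = mvar (Copy1 a)"
definition copy2 :: "'v \<Rightarrow> ('v tripled, 'k::comm_ring_1) mpol" where "copy2 a = mvar (Copy2 a)"
definition orig :: "'v \<Rightarrow> ('v tripled, 'k::comm_ring_1) mpol" where "orig a = mvar (Orig a)"

lemma polys_copies:
  "v \<in> V \<Longrightarrow> copy1 v \<in> polys (tripled_vars V)" "v \<in> V \<Longrightarrow> copy2 v \<in> polys (tripled_vars V)"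
  "v \<in> V \<Longrightarrow> orig v \<in> polys (tripled_vars V)"
  by (auto simp: copy1_def copy2_def orig_def tripled_vars_def intro!: polys_mvar)

definition join_sum :: "'v set \<Rightarrow> ('v, 'k::comm_ring_1) mpol set \<Rightarrow> ('v, 'k) mpol set \<Rightarrow> ('v tripled, 'k) mpol set" where
  "join_sum V I J = Idl\<^bsub>poly_ring (tripled_vars V)\<^esub> (ev mconst copy1 ` I) <+>\<^bsub>poly_ring (tripled_vars V)\<^esub>
     Idl\<^bsub>poly_ring (tripled_vars V)\<^esub> (ev mconst copy2 ` J) <+>\<^bsub>poly_ring (tripled_vars V)\<^esub>
     Idl\<^bsub>poly_ring (tripled_vars V)\<^esub> ((\<lambda>a. orig a - copy1 a - copy2 a) ` V)"

lemma join_ideal_eq: "join_ideal V I J = {f \<in> polys V. ev mconst orig f \<in> join_sum V I J}"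
  by (auto simp: join_ideal_def Let_def poly_subst_eq_ev join_sum_def carrier_poly_ring image_def
      orig_def[abs_def] copy1_def[abs_def] copy2_def[abs_def] setcompr_eq_image simp del: poly_ring_simps(1))

context
  fixes V :: "'v set" and I J :: "('v, 'k::comm_ring_1) mpol set"
  assumes I: "I \<subseteq> polys V" and J: "J \<subseteq> polys V"
begin

lemma join_generators:
  "ev mconst copy1 ` I \<subseteq> polys (tripled_vars V)" "ev mconst copy2 ` J \<subseteq> polys (tripled_vars V)"
  "(\<lambda>a. orig a - copy1 a - copy2 a :: ('v tripled, 'k) mpol) ` V \<subseteq> polys (tripled_vars V)"
  using I J by (auto intro!: polys_ev polys_copies polys_diff)

lemma ideal_join_sum: "ideal (join_sum V I J) (poly_ring (tripled_vars V))"
  unfolding join_sum_def by (intro ideal_set_add Idl_ideal join_generators)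

lemma join_sum_superset:
  "p \<in> I \<Longrightarrow> ev mconst copy1 p \<in> join_sum V I J" "p \<in> J \<Longrightarrow> ev mconst copy2 p \<in> join_sum V I J"
  "v \<in> V \<Longrightarrow> orig v - copy1 v - copy2 v \<in> join_sum V I J"
proof -
  let ?T = "poly_ring (tripled_vars V) :: ('v tripled, 'k) mpol ring"
  note id = Idl_ideal[OF join_generators(1)] Idl_ideal[OF join_generators(2)] Idl_ideal[OF join_generators(3)]
  note s = set_add_superset[OF id(1) ideal_set_add[OF id(2,3)]] set_add_superset[OF id(2,3)]
    set_add_superset[OF ideal_set_add[OF id(1,2)] id(3)] set_add_superset[OF id(1,2)]
  note j = Idl_self[OF join_generators(1)] Idl_self[OF join_generators(2)] Idl_self[OF join_generators(3)]
  show "p \<in> I \<Longrightarrow> ev mconst copy1 p \<in> join_sum V I J" "p \<in> J \<Longrightarrow> ev mconst copy2 p \<in> join_sum V I J"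
    "v \<in> V \<Longrightarrow> orig v - copy1 v - copy2 v \<in> join_sum V I J"
    unfolding join_sum_def using s j by blast+
qed

lemma join_sum_minimal:
  assumes K: "ideal K (poly_ring (tripled_vars V))"
    and "\<And>p. p \<in> I \<Longrightarrow> ev mconst copy1 p \<in> K" "\<And>p. p \<in> J \<Longrightarrow> ev mconst copy2 p \<in> K"
      "\<And>v. v \<in> V \<Longrightarrow> orig v - copy1 v - copy2 v \<in> K"
  shows "join_sum V I J \<subseteq> K"
proof -
  note m = Idl_minimal[OF K]
  have "Idl\<^bsub>poly_ring (tripled_vars V)\<^esub> (ev mconst copy1 ` I) \<subseteq> K"
    "Idl\<^bsub>poly_ring (tripled_vars V)\<^esub> (ev mconst copy2 ` J) \<subseteq> K"
    "Idl\<^bsub>poly_ring (tripled_vars V)\<^esub> ((\<lambda>a. orig a - copy1 a - copy2 a) ` V) \<subseteq> K"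
    using assms by (intro m; blast)+
  then show ?thesis
    unfolding join_sum_def set_add_poly_ring using ideal_poly_ringD(3)[OF K] by blast
qed

lemma ideal_join: "ideal (join_ideal V I J) (poly_ring V)"
  unfolding join_ideal_eq by (rule ideal_preimage[OF ideal_join_sum]) (rule polys_copies)

end

text \<open>A Pfaffian is a polynomial in its entries. The lemma is applied to the congruence
  between x and x' + x'' in the tripled ring of a join.\<close>

lemma pfl_congruent:
  assumes K: "ideal K (poly_ring W)"
    and "\<And>i j. i \<in> set xs \<Longrightarrow> j \<in> set xs \<Longrightarrow> A i j \<in> polys W \<and> B i j \<in> polys W \<and> A i j - B i j \<in> K"
  shows "pfl A xs - pfl B xs \<in> K"
  using assms(2)
proof (induction A xs rule: pfl.induct)
  case (1 A)
  then show ?case by (simp add: ideal_poly_ringD(2)[OF K])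
next
  case (2 A x xs)
  have "(-1) ^ k * A x (xs ! k) * pfl A (del k xs) - (-1) ^ k * B x (xs ! k) * pfl B (del k xs) \<in> K"
    if k: "k < length xs" for k
  proof -
    have AB: "A i j \<in> polys W" "B i j \<in> polys W" "A i j - B i j \<in> K" if "i \<in> set (x # xs)" "j \<in> set (x # xs)" for i j
      using "2.prems"[OF that] by auto
    have x: "x \<in> set (x # xs)" "xs ! k \<in> set (x # xs)" using k by auto
    have "pfl A (del k xs) - pfl B (del k xs) \<in> K"
      using k by (intro "2.IH" "2.prems") (auto dest: in_set_delD)
    moreover have "pfl A (del k xs) \<in> polys W"
      using k by (intro polys_pfl AB) (auto dest: in_set_delD)
    ultimately have "(-1) ^ k * pfl A (del k xs) * (A x (xs ! k) - B x (xs ! k))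
       + (-1) ^ k * B x (xs ! k) * (pfl A (del k xs) - pfl B (del k xs)) \<in> K"
      using AB[OF x] by (intro ideal_poly_ringD(3,4)[OF K] polys_mult polys_power polys_uminus) auto
    then show ?thesis by (simp add: algebra_simps)
  qed
  then have "(\<Sum>k<length xs. (-1) ^ k * A x (xs ! k) * pfl A (del k xs) - (-1) ^ k * B x (xs ! k) * pfl B (del k xs)) \<in> K"
    by (intro ideal_poly_ring_sum[OF K]) auto
  then show ?case by (simp add: sum_subtractf)
qed

section \<open>Pfaffians in the secant ideals\<close>

lemma pf4_generators: "{subpfaffian generic_skew U |U. U \<subseteq> {1..m} \<and> card U = 4} \<subseteq> (polys (skew_vars m) :: (_, 'k::comm_ring_1) mpol set)"
  using subpfaffian_facts(1)[of _ m 2] by auto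

lemma ideal_pf4: "ideal (pf4_ideal m :: (_, 'k::comm_ring_1) mpol set) (poly_ring (skew_vars m))"
  unfolding pf4_ideal_def by (rule Idl_ideal[OF pf4_generators])

lemma pf4_subset: "pf4_ideal m \<subseteq> (polys (skew_vars m) :: (_, 'k::comm_ring_1) mpol set)"
  using ideal_poly_ringD(1)[OF ideal_pf4] .

lemma pfl_eq_subpfaffian:
  assumes "sorted_wrt (<) xs" "even (length xs)"
  shows "pfl A xs = subpfaffian A (set xs)"
proof -
  have "card (set xs) = 2 * (length xs div 2)"
    using assms by (simp add: strict_sorted_iff distinct_card)
  then show ?thesis
    using assms by (simp add: subpfaffian_eq_pfl[of _ "length xs div 2"] strict_sorted_iff sorted_list_of_set.idem_if_sorted_distinct)
qed

lemma pfl_in_pf4: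
  assumes "sorted_wrt (<) xs" "set xs \<subseteq> {1..m}" "even (length xs)" "length xs \<ge> 4"
  shows "pfl generic_skew xs \<in> (pf4_ideal m :: (_, 'k::comm_ring_1) mpol set)"
  using assms
proof (induction "length xs" arbitrary: xs rule: less_induct)
  case less
  show ?case
  proof (cases "length xs = 4")
    case True
    then have "card (set xs) = 4" using less.prems(1) by (simp add: strict_sorted_iff distinct_card)
    then show ?thesis
      unfolding pfl_eq_subpfaffian[OF less.prems(1,3)] pf4_ideal_def
      using less.prems(2) by (intro subsetD[OF Idl_self[OF pf4_generators]]) blast
  next
    case False
    then have l: "length xs \<ge> 6" using less.prems(3,4) by presburger
    then obtain x ys where xs: "xs = x # ys" by (cases xs) auto
    have "(-1) ^ k * generic_skew x (ys ! k) * pfl generic_skew (del k ys) \<in> (pf4_ideal m :: (_, 'k) mpol set)"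
      if k: "k < length ys" for k
    proof (rule ideal_poly_ringD(4)[OF ideal_pf4])
      show "pfl generic_skew (del k ys) \<in> (pf4_ideal m :: (_, 'k) mpol set)"
        using less.prems k l unfolding xs
        by (intro less.hyps) (auto simp: xs dest: in_set_delD intro: sorted_wrt_del)
      have "ys ! k \<in> set ys" using k by simp
      then show "(-1) ^ k * generic_skew x (ys ! k) \<in> (polys (skew_vars m) :: (_, 'k) mpol set)"
        using less.prems(2) unfolding xs
        by (intro polys_mult polys_power polys_uminus polys_one polys_generic_skew) auto
    qed
    then show ?thesis unfolding xs pfl.simps by (intro ideal_poly_ring_sum[OF ideal_pf4]) auto
  qed
qed

lemma secant_ideal_1: "secant_ideal V I 1 = I"
  by (simp add: secant_ideal_def)

lemma secant_ideal_Suc: "r \<ge> 1 \<Longrightarrow> secant_ideal V I (Suc r) = join_ideal V I (secant_ideal V I r)"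
  by (cases r) (simp_all add: secant_ideal_def)

text \<open>In the expansion of the Pfaffian of \<open>x' + x''\<close> every term has a factor of size at least \<open>4\<close> in
  \<open>x'\<close> or of size at least \<open>2r + 2\<close> in \<open>x''\<close>.\<close>

lemma pfl_split_in_join:
  fixes J :: "(nat \<times> nat, 'k::comm_ring_1) mpol set"
  assumes J: "J \<subseteq> polys (skew_vars m)"
    and pfJ: "\<And>xs. sorted_wrt (<) xs \<Longrightarrow> set xs \<subseteq> {1..m} \<Longrightarrow> even (length xs) \<Longrightarrow> length xs \<ge> 2 * Suc r \<Longrightarrow> pfl generic_skew xs \<in> J"
    and "sorted_wrt (<) (ys @ xs)" "sorted_wrt (<) (zs @ xs)" "set (ys @ zs @ xs) \<subseteq> {1..m}"
    "even (length (ys @ zs @ xs))" "length (ys @ zs @ xs) \<ge> 2 * (r + 2)"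
  shows "pfl_split (\<lambda>i j. ev mconst copy1 (generic_skew i j)) (\<lambda>i j. ev mconst copy2 (generic_skew i j)) xs ys zs
    \<in> join_sum (skew_vars m) (pf4_ideal m) J"
  using assms(3-)
proof (induction xs arbitrary: ys zs)
  case Nil
  let ?V = "skew_vars m"
  note I = pf4_subset[of m, where 'k = 'k]
  note sup = join_sum_superset[OF I J] and id = ideal_join_sum[OF I J]
  let ?S = "join_sum ?V (pf4_ideal m) J"
  have pol: "pfl (\<lambda>i j. ev mconst copy1 (generic_skew i j)) ys \<in> (polys (tripled_vars ?V) :: (_, 'k) mpol set)"
    "pfl (\<lambda>i j. ev mconst copy2 (generic_skew i j)) zs \<in> (polys (tripled_vars ?V) :: (_, 'k) mpol set)"
    using Nil.prems by (auto intro!: polys_pfl polys_ev[of _ ?V] polys_generic_skew polys_copies)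
  consider "odd (length ys)" | "even (length ys)" "length ys \<ge> 4" | "even (length zs)" "length zs \<ge> 2 * Suc r"
  proof -
    assume a: "odd (length ys) \<Longrightarrow> thesis" "even (length ys) \<Longrightarrow> 4 \<le> length ys \<Longrightarrow> thesis"
      "even (length zs) \<Longrightarrow> 2 * Suc r \<le> length zs \<Longrightarrow> thesis"
    show thesis
    proof (cases "even (length ys) \<and> length ys < 4")
      case True
      then have "length ys \<le> 2" by presburger
      then show ?thesis using True Nil.prems(4,5) by (intro a(3)) auto
    next
      case False
      then show ?thesis using a(1,2) by force
    qed
  qed
  then show ?case
  proof cases
    case 1
    then show ?thesis by (simp add: pfl_odd ideal_poly_ringD(2)[OF id])
  next
    case 2
    then have "pfl generic_skew ys \<in> (pf4_ideal m :: (_, 'k) mpol set)"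
      using Nil.prems by (intro pfl_in_pf4) auto
    from sup(1)[OF this] show ?thesis
      using ideal_poly_ringD(4)[OF id _ pol(2)] by (simp add: ev_pfl mult.commute)
  next
    case 3
    then have "pfl generic_skew zs \<in> J" using Nil.prems by (intro pfJ) auto
    from sup(2)[OF this] show ?thesis
      using ideal_poly_ringD(4)[OF id _ pol(1)] by (simp add: ev_pfl)
  qed
next
  case (Cons x xs)
  note id = ideal_join_sum[OF pf4_subset[of m, where 'k = 'k] J]
  have "sorted_wrt (<) (ys @ xs)" "sorted_wrt (<) (zs @ xs)"
    using Cons.prems by (auto simp: sorted_wrt_append)
  then show ?case
    unfolding pfl_split.simps using Cons.prems
    by (intro ideal_poly_ringD(3,4)[OF id] Cons.IH polys_power polys_uminus polys_one) auto
qed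

text \<open>The two claims are proved together, since the induction step for the Pfaffians uses both
  of them for the previous secant ideal.\<close>

lemma secant_pf4:
  assumes "r \<ge> 1"
  shows "ideal (secant_ideal (skew_vars m) (pf4_ideal m :: (_, 'k::comm_ring_1) mpol set) r) (poly_ring (skew_vars m))"
    "\<And>xs. sorted_wrt (<) xs \<Longrightarrow> set xs \<subseteq> {1..m} \<Longrightarrow> even (length xs) \<Longrightarrow> length xs \<ge> 2 * Suc r \<Longrightarrow>
      pfl generic_skew xs \<in> secant_ideal (skew_vars m) (pf4_ideal m :: (_, 'k::comm_ring_1) mpol set) r"
  using assms
proof (induction r rule: dec_induct)
  case base
  {
    case 1
    then show ?case unfolding secant_ideal_1 by (rule ideal_pf4)
  next
    case 2
    then show ?case unfolding secant_ideal_1 by (intro pfl_in_pf4) auto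
  }
next
  case (step r)
  let ?V = "skew_vars m" and ?I = "pf4_ideal m :: (_, 'k) mpol set"
  let ?J = "secant_ideal ?V ?I r"
  note I = pf4_subset[of m, where 'k = 'k]
  have J: "?J \<subseteq> polys ?V" using ideal_poly_ringD(1)[OF step.IH(1)] .
  note sup = join_sum_superset[OF I J] and id = ideal_join_sum[OF I J]
  note S = secant_ideal_Suc[OF step(1)]
  {
    case 1
    then show ?case unfolding S by (rule ideal_join[OF I J])
  next
    case (2 xs)
    let ?o = "\<lambda>i j. ev mconst orig (generic_skew i j) :: (_, 'k) mpol"
    let ?c1 = "\<lambda>i j. ev mconst copy1 (generic_skew i j) :: (_, 'k) mpol"
    let ?c2 = "\<lambda>i j. ev mconst copy2 (generic_skew i j) :: (_, 'k) mpol"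
    have "pfl_split ?c1 ?c2 xs [] [] \<in> join_sum ?V ?I ?J"
      using 2 step.IH(2) by (intro pfl_split_in_join[OF J]) auto
    moreover have "pfl ?o xs - pfl (\<lambda>i j. ?c1 i j + ?c2 i j) xs \<in> join_sum ?V ?I ?J"
    proof (intro pfl_congruent[OF id] conjI)
      fix i j assume ij: "i \<in> set xs" "j \<in> set xs"
      then have g: "generic_skew i j \<in> (polys ?V :: (_, 'k) mpol set)" using 2 by (intro polys_generic_skew) auto
      show "?o i j \<in> polys (tripled_vars ?V)" "?c1 i j + ?c2 i j \<in> polys (tripled_vars ?V)"
        using g by (auto intro!: polys_ev[of _ ?V] polys_copies)
      have v: "orig v - copy1 v - copy2 v \<in> join_sum ?V ?I ?J" if "v \<in> ?V" for v using sup(3) that .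
      consider "i < j" | "j < i" | "i = j" by linarith
      then show "?o i j - (?c1 i j + ?c2 i j) \<in> join_sum ?V ?I ?J"
      proof cases
        case 1
        then have "(i, j) \<in> ?V" using ij 2 by (auto simp: skew_vars_def)
        from v[OF this] 1 show ?thesis by (simp add: generic_skew_def algebra_simps)
      next
        case 2
        then have "(j, i) \<in> ?V" using ij \<open>set xs \<subseteq> _\<close> by (auto simp: skew_vars_def)
        from ideal_poly_ringD(5)[OF id v[OF this]] 2 show ?thesis
          by (simp add: generic_skew_def mconst.ev_uminus algebra_simps)
      next
        case 3
        then show ?thesis by (simp add: generic_skew_def ideal_poly_ringD(2)[OF id])
      qed
    qed
    ultimately have "pfl ?o xs \<in> join_sum ?V ?I ?J"
      using ideal_poly_ringD(3)[OF id, of "pfl ?o xs - pfl (\<lambda>i j. ?c1 i j + ?c2 i j) xs" "pfl (\<lambda>i j. ?c1 i j + ?c2 i j) xs"] by (simp add: pfl_add)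
    moreover have "pfl generic_skew xs \<in> (polys ?V :: (_, 'k) mpol set)" using 2 by (intro polys_pfl_generic)
    ultimately show ?case unfolding S join_ideal_eq by (simp add: ev_pfl)
  }
qed

text \<open>The entries are the 2 by 2 minors of a pair of vectors, and the 4 by 4 Pfaffian is their
  Pluecker relation.\<close>

lemma wedge_entry_kills_pf4:
  assumes "p \<in> (pf4_ideal m :: (_, 'k::comm_ring_1) mpol set)"
  shows "ev mconst (wedge_entry k) p = 0"
proof -
  let ?K = "{p \<in> polys (skew_vars m). ev mconst (wedge_entry k) (p :: (_, 'k) mpol) = 0}"
  have "ev mconst (wedge_entry k) (subpfaffian generic_skew U :: (_, 'k) mpol) = 0" if U: "card U = 4" for U
  proof -
    have "length (sorted_list_of_set U) = 4" using U by simp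
    moreover have "\<exists>a b c d. xs = [a, b, c, d]" if "length xs = 4" for xs :: "nat list"
      using that by (auto simp: numeral_eq_Suc length_Suc_conv)
    ultimately obtain a b c d where abcd: "sorted_list_of_set U = [a, b, c, d]" by blast
    have e: "ev mconst (wedge_entry k) (generic_skew i j :: (_, 'k) mpol) = wedge_entry k (i, j)" for i j
      by (auto simp: generic_skew_def mconst.ev_uminus wedge_entry_def algebra_simps)
    have "ev mconst (wedge_entry k) (subpfaffian generic_skew U :: (_, 'k) mpol)
      = pfl (\<lambda>i j. wedge_entry k (i, j) :: (_, 'k) mpol) [a, b, c, d]"
      using subpfaffian_eq_pfl[of U 2 "generic_skew :: nat \<Rightarrow> nat \<Rightarrow> (_, 'k) mpol"] U by (simp only: ev_pfl abcd e)
    also have "\<dots> = 0"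
      by (simp add: numeral_eq_Suc del_def wedge_entry_def algebra_simps)
    finally show ?thesis .
  qed
  then have "pf4_ideal m \<subseteq> ?K"
    unfolding pf4_ideal_def using subpfaffian_facts(1)[of _ m 2, where 'k = 'k]
    by (intro Idl_minimal ideal_kernel) auto
  then show ?thesis using assms by blast
qed

text \<open>A join is tested at a sum of points: \<open>\<Psi>\<close> sends x' to the new wedge,
  x'' to the previous rank point and x to their sum, and so kills all generators of the
  join.\<close>

lemma rank_point_kills_secant:
  assumes "r \<ge> 1" "f \<in> secant_ideal (skew_vars m) (pf4_ideal m :: (_, 'k::comm_ring_1) mpol set) r"
  shows "ev mconst (rank_point r) f = 0"
  using assms
proof (induction r arbitrary: f rule: dec_induct)
  case base
  have "rank_point 1 = (wedge_entry 0 :: _ \<Rightarrow> (_, 'k) mpol)" by (simp add: rank_point_def fun_eq_iff)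
  then show ?case using wedge_entry_kills_pf4[of f m 0] base by (simp add: secant_ideal_1[simplified])
next
  case (step r)
  let ?V = "skew_vars m" and ?I = "pf4_ideal m :: (_, 'k) mpol set"
  let ?J = "secant_ideal ?V ?I r"
  note I = pf4_subset[of m, where 'k = 'k]
  have J: "?J \<subseteq> polys ?V" using ideal_poly_ringD(1)[OF secant_pf4(1)[OF step(1)]] .
  define \<Psi> where "\<Psi> = case_tripled (rank_point (Suc r)) (wedge_entry r) (rank_point r :: _ \<Rightarrow> (_, 'k) mpol)"
  have [simp]: "ev mconst \<Psi> (copy1 v) = wedge_entry r v" "ev mconst \<Psi> (copy2 v) = rank_point r v"
    "ev mconst \<Psi> (orig v) = rank_point (Suc r) v" for v
    by (simp_all add: copy1_def copy2_def orig_def \<Psi>_def)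
  let ?K = "{p \<in> polys (tripled_vars ?V). ev mconst \<Psi> p = 0}"
  have "join_sum ?V ?I ?J \<subseteq> ?K"
  proof (rule join_sum_minimal[OF I J ideal_kernel])
    show "ev mconst copy1 p \<in> ?K" if "p \<in> ?I" for p
      using that I wedge_entry_kills_pf4[OF that, of r] by (auto simp: ev_mconst_comp intro!: polys_ev polys_copies)
    show "ev mconst copy2 p \<in> ?K" if "p \<in> ?J" for p
      using that J step.IH[OF that] by (auto simp: ev_mconst_comp intro!: polys_ev polys_copies)
    show "orig v - copy1 v - copy2 v \<in> ?K" if "v \<in> ?V" for v
      using that by (auto simp: mconst.ev_diff rank_point_def intro!: polys_diff polys_copies)
  qed
  then have "ev mconst \<Psi> (ev mconst orig f) = 0"
    using step.prems unfolding secant_ideal_Suc[OF step(1)] join_ideal_eq by auto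
  then show ?case by (simp add: ev_mconst_comp)
qed

section \<open>The secant ideals are prime\<close>

abbreviation pf_secant :: "nat \<Rightarrow> nat \<Rightarrow> (nat \<times> nat, 'k::comm_ring_1) mpol set" where
  "pf_secant m r \<equiv> secant_ideal (skew_vars m) (pf4_ideal m) r"

lemma subpfaffian_in_secant:
  assumes "r \<ge> 1" "U \<subseteq> {1..m}" "card U = 2 * t" "t \<ge> Suc r"
  shows "subpfaffian generic_skew U \<in> (pf_secant m r :: (_, 'k::comm_ring_1) mpol set)"
proof -
  have fin: "finite U" using assms(2) by (rule finite_subset) simp
  show ?thesis
    unfolding subpfaffian_eq_pfl[OF assms(3)]
    using assms fin by (intro secant_pf4(2)) (simp_all add: strict_sorted_iff)
qed

lemma pfaffian_ideal_secant: "r \<ge> 1 \<Longrightarrow> pfaffian_ideal m r (pf_secant m r :: (_, 'k::comm_ring_1) mpol set)"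
  by (rule pfaffian_ideal.intro) (blast intro: secant_pf4(1) subpfaffian_in_secant le_refl)+

text \<open>The normal form of a polynomial that vanishes at the rank point is standard and vanishes
  there too, hence is 0.\<close>

lemma secant_eq_kernel:
  assumes "r \<ge> 1"
  shows "(pf_secant m r :: (_, 'k::comm_ring_1) mpol set) = {f \<in> polys (skew_vars m). ev mconst (rank_point r) f = 0}"
proof (intro equalityI subsetI)
  interpret pfaffian_ideal m r "pf_secant m r :: (_, 'k) mpol set" using assms by (rule pfaffian_ideal_secant)
  note sub = ideal_poly_ringD(1)[OF ideal]
  show "f \<in> {f \<in> polys (skew_vars m). ev mconst (rank_point r) f = 0}" if "f \<in> pf_secant m r" for f :: "(_, 'k) mpol"
    using that sub rank_point_kills_secant[OF assms that] by blast
  show "f \<in> pf_secant m r" if "f \<in> {f \<in> polys (skew_vars m). ev mconst (rank_point r) f = 0}" for f :: "(_, 'k) mpol"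
  proof -
    have f: "f \<in> polys (skew_vars m)" "ev mconst (rank_point r) f = 0" using that by auto
    obtain H where H: "H \<in> polys (skew_vars m)" "f - H \<in> pf_secant m r" "\<And>t. t \<in> supp H \<Longrightarrow> standard r t"
      using normal_form[OF pf_order_weight_order f(1)] by metis
    have "ev mconst (rank_point r) H = 0"
      using rank_point_kills_secant[OF assms H(2)] f(2) by (simp add: mconst.ev_diff)
    then have "H = 0" using standard_independent[OF H(1) _ H(3)] by (auto simp: poly_subst_eq_ev)
    then show ?thesis using H(2) by simp
  qed
qed

text \<open>A standard leading monomial would survive in the normal form, which is 0 because it is
  standard and vanishes at the rank point.\<close>

lemma lead_not_standard:
  assumes "r \<ge> 1" "pf_order TYPE('k::comm_ring_1) m ord" "f \<in> (pf_secant m r :: (_, 'k) mpol set)"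
    and t: "t \<in> supp f" "\<And>u. u \<in> supp f \<Longrightarrow> (u, t) \<in> ord"
  shows "\<not> standard r t"
proof
  interpret pfaffian_ideal m r "pf_secant m r :: (_, 'k) mpol set" using assms(1) by (rule pfaffian_ideal_secant)
  assume std: "standard r t"
  have f: "f \<in> polys (skew_vars m)" using assms(3) ideal_poly_ringD(1)[OF ideal] by blast
  obtain H where H: "H \<in> polys (skew_vars m)" "f - H \<in> pf_secant m r" "\<And>t. t \<in> supp H \<Longrightarrow> standard r t"
    "cf H t = cf f t"
    using normal_form[OF assms(2) f] t std by metis
  have "f - (f - H) \<in> pf_secant m r" using ideal_poly_ringD(6)[OF ideal assms(3) H(2)] .
  then have "ev mconst (rank_point r) H = 0" using rank_point_kills_secant[OF assms(1)] by auto
  then have "H = 0" using standard_independent[OF H(1) _ H(3)] by (auto simp: poly_subst_eq_ev)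
  then show False using H(4) t(1) by (simp add: in_keys_iff)
qed

lemma prime_secant:
  assumes "r \<ge> 1"
  shows "primeideal (pf_secant m r :: (_, 'k::field) mpol set) (poly_ring (skew_vars m))"
proof (rule primeidealI[OF _ cring_poly_ring])
  show "ideal (pf_secant m r :: (_, 'k) mpol set) (poly_ring (skew_vars m))" using assms by (rule secant_pf4(1))
  have "(1 :: (_, 'k) mpol) \<notin> pf_secant m r" unfolding secant_eq_kernel[OF assms] by simp
  then show "carrier (poly_ring (skew_vars m)) \<noteq> (pf_secant m r :: (_, 'k) mpol set)"
    using polys_one unfolding carrier_poly_ring by blast
  show "a \<in> pf_secant m r \<or> b \<in> pf_secant m r"
    if "a \<in> carrier (poly_ring (skew_vars m))" "b \<in> carrier (poly_ring (skew_vars m))"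
      "a \<otimes>\<^bsub>poly_ring (skew_vars m)\<^esub> b \<in> pf_secant m r" for a b :: "(_, 'k) mpol"
    using that unfolding secant_eq_kernel[OF assms] carrier_poly_ring by (simp add: mconst.ev_mult)
qed

section \<open>Symbolic powers of prime ideals\<close>

lemma ideal_pow_0 [simp]: "ideal_pow (poly_ring V) I 0 = polys V"
  by (simp add: ideal_pow_def nat_pow_def ideals_set_def carrier_poly_ring del: poly_ring_simps(1))

lemma ideal_pow_Suc: "ideal_pow R I (Suc n) = ideal_prod R (ideal_pow R I n) I"
  by (simp add: ideal_pow_def nat_pow_def ideals_set_def)

lemma ideal_ideal_pow:
  assumes "ideal I (poly_ring V :: ('v, 'k::comm_ring_1) mpol ring)"
  shows "ideal (ideal_pow (poly_ring V) I n) (poly_ring V)"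
proof (induction n)
  case 0
  show ?case using ring.oneideal[OF ring_poly_ring, of V] by (simp add: carrier_poly_ring del: poly_ring_simps(1))
next
  case (Suc n)
  then show ?case unfolding ideal_pow_Suc by (rule ring.ideal_prod_is_ideal[OF ring_poly_ring _ assms])
qed

lemma ideal_pow_mult:
  assumes "ideal I (poly_ring V :: ('v, 'k::comm_ring_1) mpol ring)"
    and "a \<in> ideal_pow (poly_ring V) I i" "b \<in> ideal_pow (poly_ring V) I j"
  shows "a * b \<in> ideal_pow (poly_ring V) I (i + j)"
proof -
  interpret S: comm_monoid "ideals_set (poly_ring V :: ('v, 'k) mpol ring)"
    by (rule cring.ideals_set_is_comm_monoid[OF cring_poly_ring])
  have "I \<in> carrier (ideals_set (poly_ring V))" using assms(1) by (simp add: ideals_set_def)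
  from S.nat_pow_mult[OF this, of i j]
  have "ideal_prod (poly_ring V) (ideal_pow (poly_ring V) I i) (ideal_pow (poly_ring V) I j) = ideal_pow (poly_ring V) I (i + j)"
    by (simp add: ideal_pow_def ideals_set_def)
  then show ?thesis using ideal_prod.prod[OF assms(2,3), of "poly_ring V"] by auto
qed

text \<open>A prime ideal is its own unique minimal prime, so the denominators are the elements
  outside \<open>J\<close>. The linear order on the variables makes the absence of zero divisors
  available for these polynomials.\<close>

locale prime_poly_ideal =
  fixes V :: "'v::linorder set" and J :: "('v, 'k::field) mpol set"
  assumes prime: "primeideal J (poly_ring V)"
begin

abbreviation "R \<equiv> poly_ring V :: ('v, 'k) mpol ring"

lemma ideal_J: "ideal J R"
  using prime by (rule primeideal.axioms(1))

lemma J_polys: "J \<subseteq> polys V"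
  using ideal_poly_ringD(1)[OF ideal_J] .

lemma J_prime: "a \<in> polys V \<Longrightarrow> b \<in> polys V \<Longrightarrow> a * b \<in> J \<Longrightarrow> a \<in> J \<or> b \<in> J"
  using primeideal.I_prime[OF prime, of a b] by (simp add: polys_def)

lemma one_notin_J: "1 \<notin> J"
proof
  assume "1 \<in> J"
  then have "polys V \<subseteq> J" using ideal_poly_ringD(4)[OF ideal_J, of 1] by auto
  then show False using primeideal.I_notcarr[OF prime] J_polys by (simp add: polys_def)
qed

lemma minimal_primes_J: "minimal_primes R J = {J}"
  using prime by (auto simp: minimal_primes_def)

text \<open>Removes the localization: without zero divisors two fractions agree exactly if their
  cross products do, so a fraction equal to \<open>f\<close> with numerator in the power amounts to
  a multiplier outside \<open>J\<close> that brings \<open>f\<close> into the power.\<close>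

lemma symbolic_power_iff:
  "f \<in> symbolic_power R J n \<longleftrightarrow> f \<in> polys V \<and> (\<exists>u\<in>polys V - J. u * f \<in> ideal_pow R J n)"
proof -
  let ?S = "polys V - J"
  have nz: "u \<noteq> 0" if "u \<in> ?S" for u using that ideal_poly_ringD(2)[OF ideal_J] by auto
  have one: "1 \<in> ?S" using one_notin_J by simp
  have ex: "(\<exists>u\<in>?S. u * x = 0) \<longleftrightarrow> x = 0" for x
  proof
    assume "\<exists>u\<in>?S. u * x = 0"
    then obtain u where "u \<in> ?S" "u * x = 0" by blast
    then show "x = 0" using nz[of u] mult_eq_0_iff[of u x] by blast
  next
    assume "x = 0"
    then show "\<exists>u\<in>?S. u * x = 0" using one by (intro bexI[of _ 1]) simp_all
  qed
  have rel: "((a, s), (b, t)) \<in> loc_rel R ?S \<longleftrightarrow>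
      a \<in> polys V \<and> b \<in> polys V \<and> s \<in> ?S \<and> t \<in> ?S \<and> a * t = b * s" for a b s t
  proof -
    have "a * t \<ominus>\<^bsub>R\<^esub> b * s = a * t - b * s" if "b \<in> polys V" "s \<in> ?S"
      using that by (intro a_minus_poly_ring) auto
    then have "((a, s), (b, t)) \<in> loc_rel R ?S \<longleftrightarrow>
      a \<in> polys V \<and> b \<in> polys V \<and> s \<in> ?S \<and> t \<in> ?S \<and> (\<exists>u\<in>?S. u * (a * t - b * s) = 0)"
      unfolding loc_rel_def carrier_poly_ring poly_ring_simps(2-) mem_Collect_eq prod.case by metis
    then show ?thesis unfolding ex by simp
  qed
  have frac: "loc_frac R ?S f 1 = loc_frac R ?S a s \<longleftrightarrow> f * s = a"
    if "f \<in> polys V" "a \<in> polys V" "s \<in> ?S" for f a s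
  proof
    assume eq: "loc_frac R ?S f 1 = loc_frac R ?S a s"
    have "(a, s) \<in> loc_frac R ?S a s" using that rel by (simp add: loc_frac_def)
    then have "((f, 1), (a, s)) \<in> loc_rel R ?S" unfolding eq[symmetric] by (simp add: loc_frac_def)
    then show "f * s = a" unfolding rel by simp
  next
    assume a: "f * s = a"
    have "f * t = b \<longleftrightarrow> a * t = b * s" for b t
      using nz[OF that(3)] by (auto simp: a[symmetric] mult_ac)
    then show "loc_frac R ?S f 1 = loc_frac R ?S a s"
      using that one by (auto simp: loc_frac_def rel)
  qed
  have pow: "ideal_pow R J n \<subseteq> polys V" using ideal_poly_ringD(1)[OF ideal_ideal_pow[OF ideal_J]] .
  have "f \<in> symbolic_power R J n \<longleftrightarrow> f \<in> polys V \<and> (\<exists>a\<in>ideal_pow R J n. \<exists>s\<in>?S. loc_frac R ?S f 1 = loc_frac R ?S a s)"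
    by (auto simp: symbolic_power_def Let_def minimal_primes_J localized_ideal_def carrier_poly_ring simp del: poly_ring_simps(1))
  also have "\<dots> \<longleftrightarrow> f \<in> polys V \<and> (\<exists>u\<in>?S. u * f \<in> ideal_pow R J n)"
  proof (intro conj_cong refl iffI)
    assume f: "f \<in> polys V"
    {
      assume "\<exists>a\<in>ideal_pow R J n. \<exists>s\<in>?S. loc_frac R ?S f 1 = loc_frac R ?S a s"
      then obtain a s where "a \<in> ideal_pow R J n" "s \<in> ?S" "f * s = a" using frac[OF f] pow by blast
      then show "\<exists>u\<in>?S. u * f \<in> ideal_pow R J n" by (metis mult.commute)
    next
      assume "\<exists>u\<in>?S. u * f \<in> ideal_pow R J n"
      then obtain u where u: "u \<in> ?S" "u * f \<in> ideal_pow R J n" by blast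
      then have "loc_frac R ?S f 1 = loc_frac R ?S (u * f) u"
        using frac[OF f subsetD[OF pow u(2)] u(1)] by (simp add: mult.commute)
      then show "\<exists>a\<in>ideal_pow R J n. \<exists>s\<in>?S. loc_frac R ?S f 1 = loc_frac R ?S a s" using u by blast
    }
  qed
  finally show ?thesis .
qed

lemma symbolic_powerI:
  "f \<in> polys V \<Longrightarrow> u \<in> polys V - J \<Longrightarrow> u * f \<in> ideal_pow R J n \<Longrightarrow> f \<in> symbolic_power R J n"
  by (auto simp only: symbolic_power_iff)

lemma symbolic_power_subset: "symbolic_power R J n \<subseteq> polys V"
  by (auto simp: symbolic_power_iff)

lemma symbolic_power_0: "symbolic_power R J 0 = polys V"
  using one_notin_J by (auto simp: symbolic_power_iff intro!: bexI[of _ 1])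

lemma J_subset_symbolic_power_1: "J \<subseteq> symbolic_power R J 1"
proof
  fix f assume f: "f \<in> J"
  have "1 * f \<in> ideal_pow R J 1"
    using ideal_prod.prod[OF polys_one f, of R V] by (simp add: ideal_pow_Suc)
  then show "f \<in> symbolic_power R J 1"
    using f J_polys one_notin_J by (auto simp: symbolic_power_iff intro!: bexI[of _ 1])
qed

lemma mult_notin_J: "u \<in> polys V - J \<Longrightarrow> v \<in> polys V - J \<Longrightarrow> u * v \<in> polys V - J"
  using J_prime by blast

lemma ideal_symbolic_power: "ideal (symbolic_power R J n) R"
proof (rule ideal_poly_ringI)
  note id = ideal_ideal_pow[OF ideal_J, of n]
  show "symbolic_power R J n \<subseteq> polys V" by (auto simp: symbolic_power_iff)
  show "0 \<in> symbolic_power R J n"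
    using ideal_poly_ringD(2)[OF id] one_notin_J by (auto simp: symbolic_power_iff intro!: bexI[of _ 1])
  show "a + b \<in> symbolic_power R J n" if ab: "a \<in> symbolic_power R J n" "b \<in> symbolic_power R J n" for a b
  proof -
    obtain u v where uv: "u \<in> polys V - J" "v \<in> polys V - J" "u * a \<in> ideal_pow R J n" "v * b \<in> ideal_pow R J n"
      using ab unfolding symbolic_power_iff by blast
    have "v * (u * a) + u * (v * b) \<in> ideal_pow R J n"
      using uv(1,2)
      by (intro ideal_poly_ringD(3)[OF id] ideal_poly_ringD(4)[OF id uv(3)] ideal_poly_ringD(4)[OF id uv(4)]) auto
    then have "(u * v) * (a + b) \<in> ideal_pow R J n" by (simp add: algebra_simps)
    then show ?thesis using ab symbolic_power_subset
      by (intro symbolic_powerI[OF _ mult_notin_J[OF uv(1,2)]] polys_add) auto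
  qed
  show "c * a \<in> symbolic_power R J n" if ac: "a \<in> symbolic_power R J n" "c \<in> polys V" for a c
  proof -
    obtain u where u: "u \<in> polys V - J" "u * a \<in> ideal_pow R J n" using ac unfolding symbolic_power_iff by blast
    have "c * (u * a) \<in> ideal_pow R J n" using ideal_poly_ringD(4)[OF id u(2) ac(2)] .
    then have "u * (c * a) \<in> ideal_pow R J n" by (simp add: mult_ac)
    then show ?thesis using ac symbolic_power_subset by (intro symbolic_powerI[OF _ u(1)] polys_mult) auto
  qed
qed

lemma symbolic_power_mult:
  assumes "a \<in> symbolic_power R J i" "b \<in> symbolic_power R J j"
  shows "a * b \<in> symbolic_power R J (i + j)"
proof -
  obtain u v where uv: "u \<in> polys V - J" "v \<in> polys V - J" "u * a \<in> ideal_pow R J i" "v * b \<in> ideal_pow R J j"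
    using assms unfolding symbolic_power_iff by blast
  have "(u * a) * (v * b) \<in> ideal_pow R J (i + j)" using ideal_pow_mult[OF ideal_J uv(3,4)] .
  then have "(u * v) * (a * b) \<in> ideal_pow R J (i + j)" by (simp add: mult_ac)
  then show ?thesis using assms symbolic_power_subset
    by (intro symbolic_powerI[OF _ mult_notin_J[OF uv(1,2)]] polys_mult) auto
qed

lemma symbolic_power_cancel:
  assumes "u \<in> polys V" "u \<notin> J" "f \<in> polys V" "u * f \<in> symbolic_power R J n"
  shows "f \<in> symbolic_power R J n"
proof -
  obtain v where v: "v \<in> polys V - J" "v * (u * f) \<in> ideal_pow R J n" using assms unfolding symbolic_power_iff by blast
  then have "(v * u) * f \<in> ideal_pow R J n" by (simp add: mult_ac)
  then show ?thesis using assms mult_notin_J[OF v(1), of u] by (intro symbolic_powerI[of f "v * u"]) auto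
qed

end

section \<open>Hasse derivatives\<close>

definition shift_point :: "'v \<Rightarrow> 'v \<Rightarrow> ('v, 'k::comm_ring_1) mpol poly" where
  "shift_point v w = (if w = v then [:mvar v, 1:] else [:mvar w:])"

text \<open>The coefficient of \<open>z ^ n\<close> after replacing the variable \<open>v\<close> by
  \<open>v + z\<close>: the divided derivative, which makes sense even where \<open>n!\<close>
  vanishes.\<close>

definition hasse :: "'v \<Rightarrow> nat \<Rightarrow> ('v, 'k::comm_ring_1) mpol \<Rightarrow> ('v, 'k) mpol" where
  "hasse v n f = coeff (ev (\<lambda>c. [:mconst c:]) (shift_point v) f) n"

interpretation pconst: coeff_hom "\<lambda>c :: 'k::comm_ring_1. [:mconst c :: ('v, 'k) mpol:]"
  by unfold_locales (simp_all add: mconst.zero mconst.one mconst.add mconst.mult)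

lemma hasse_add: "hasse v n (f + g) = hasse v n f + hasse v n g"
  by (simp add: hasse_def pconst.ev_add)

lemma hasse_sum: "hasse v n (sum f A) = (\<Sum>i\<in>A. hasse v n (f i))"
  by (simp add: hasse_def pconst.ev_sum coeff_sum)

lemma hasse_mult: "hasse v n (f * g) = (\<Sum>i\<le>n. hasse v i f * hasse v (n - i) g)"
  by (simp add: hasse_def pconst.ev_mult coeff_mult)

lemma mvar_power: "mvar v ^ n = sgl (sgl v n) 1"
  by (induction n) (simp_all add: mvar_def mult_single single_add[symmetric])

lemma mono_val_mvar: "mono_val mvar t = (sgl t 1 :: ('v, 'k::comm_ring_1) mpol)"
proof -
  have "(\<Prod>v\<in>supp t. sgl (sgl v (cf t v)) (1 :: 'k)) = sgl (\<Sum>v\<in>supp t. sgl v (cf t v)) 1"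
    by (simp add: prod_single)
  then show ?thesis by (simp add: mono_val_def mvar_power flip: poly_decomp)
qed

lemma hasse_single:
  "hasse v n (sgl t c) = (if n \<le> cf t v then sgl (t - sgl v n) (of_nat (cf t v choose n) * c) else 0 :: ('v, 'k::comm_ring_1) mpol)"
proof -
  let ?k = "cf t v"
  \<comment> \<open>Splits off the power of \<open>v\<close>, the only part that involves the new
    indeterminate; the binomial theorem gives its coefficients.\<close>
  define t' where "t' = t - sgl v ?k"
  have t: "t = sgl v ?k + t'"
    unfolding t'_def by (rule poly_mapping_eqI) (simp add: lookup_add lookup_minus lookup_single when_def)
  have t'v: "v \<notin> supp t'" by (simp add: t'_def in_keys_iff lookup_minus)
  have "mono_val (shift_point v :: 'v \<Rightarrow> ('v, 'k) mpol poly) t' = mono_val (\<lambda>w. [:mvar w:]) t'"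
    using t'v by (intro mono_val_cong) (auto simp: shift_point_def)
  also have "\<dots> = [:mono_val mvar t':]"
  proof -
    have p: "(\<Prod>w\<in>A. [:mvar w :: ('v, 'k) mpol:] ^ f w) = [:\<Prod>w\<in>A. mvar w ^ f w:]" for f A
      by (induction A rule: infinite_finite_induct) (simp_all add: one_pCons poly_const_pow mult.commute)
    show ?thesis unfolding mono_val_def by (rule p)
  qed
  finally have "ev (\<lambda>c. [:mconst c:]) (shift_point v) (sgl t c) = [:mconst c:] * ([:mvar v, 1:] ^ ?k * [:sgl t' 1:])"
    by (subst (1) t) (simp add: pconst.ev_single mono_val_add mono_val_mvar shift_point_def)
  then have "hasse v n (sgl t c) = mconst c * sgl t' 1 * coeff ([:mvar v, 1:] ^ ?k) n"
    by (simp add: hasse_def mult_ac)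
  also have "\<dots> = (if n \<le> ?k then sgl (t - sgl v n) (of_nat (?k choose n) * c) else 0)"
  proof (cases "n \<le> ?k")
    case True
    have e: "t - sgl v n = sgl v (?k - n) + t'"
      unfolding t'_def using True
      by (intro poly_mapping_eqI) (auto simp: lookup_add lookup_minus lookup_single when_def)
    have "coeff ([:mvar v, 1:] ^ ?k) n = (of_nat (?k choose n) * mvar v ^ (?k - n) :: ('v, 'k) mpol)"
      using coeff_linear_poly_power[of n "cf t v" "mvar v :: ('v, 'k) mpol" 1] True by simp
    also have "\<dots> = sgl (sgl v (?k - n)) (of_nat (?k choose n))"
      by (simp add: mvar_power mult_single flip: single_of_nat)
    finally show ?thesis using True by (simp add: e mconst_def mult_single add.commute mult.commute)
  next
    case False
    have "degree ([:mvar v :: ('v, 'k) mpol, 1:] ^ ?k) \<le> ?k"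
      using degree_power_le[of "[:mvar v :: ('v, 'k) mpol, 1:]" ?k] by (simp split: if_splits)
    then have "coeff ([:mvar v :: ('v, 'k) mpol, 1:] ^ ?k) n = 0" using False by (intro coeff_eq_0) simp
    then show ?thesis using False by simp
  qed
  finally show ?thesis .
qed

lemma hasse_0 [simp]: "hasse v 0 f = f"
  by (subst (1 2) poly_decomp) (simp add: hasse_sum hasse_single)

lemma hasse_expand:
  "hasse v n f = (\<Sum>t\<in>supp f. if n \<le> cf t v then sgl (t - sgl v n) (of_nat (cf t v choose n) * cf f t) else 0)"
  by (subst (1) poly_decomp[of f]) (simp add: hasse_sum hasse_single)

lemma supp_hasse: "supp (hasse v n f) \<subseteq> {t - sgl v n |t. t \<in> supp f \<and> n \<le> cf t v}"
proof
  fix u assume "u \<in> supp (hasse v n f)"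
  then obtain t where "t \<in> supp f" "u \<in> supp (if n \<le> cf t v then sgl (t - sgl v n) (of_nat (cf t v choose n) * cf f t) else 0)"
    unfolding hasse_expand using keys_sum[of "\<lambda>t. if n \<le> cf t v then sgl (t - sgl v n) (of_nat (cf t v choose n) * cf f t) else 0" "supp f"]
    by blast
  then show "u \<in> {t - sgl v n |t. t \<in> supp f \<and> n \<le> cf t v}" by (auto split: if_splits)
qed

lemma minus_single_add: "n \<le> cf t v \<Longrightarrow> t - sgl v n + sgl v n = (t :: 'v mono)"
  by (rule poly_mapping_eqI) (auto simp: lookup_add lookup_minus lookup_single when_def)

lemma lookup_hasse:
  assumes "n \<le> cf t v"
  shows "cf (hasse v n f) (t - sgl v n) = of_nat (cf t v choose n) * cf f t"
proof -
  have "cf (hasse v n f) (t - sgl v n)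
     = (\<Sum>s\<in>supp f. if s = t then of_nat (cf t v choose n) * cf f t else 0)"
    unfolding hasse_expand lookup_sum
  proof (intro sum.cong refl)
    fix s
    have "s = t" if "n \<le> cf s v" "s - sgl v n = t - sgl v n"
      using minus_single_add[OF that(1)] minus_single_add[OF assms] that(2) by metis
    then show "cf (if n \<le> cf s v then sgl (s - sgl v n) (of_nat (cf s v choose n) * cf f s) else 0) (t - sgl v n)
      = (if s = t then of_nat (cf t v choose n) * cf f t else 0)"
      using assms by (auto simp: lookup_single when_def)
  qed
  then show ?thesis by (simp add: in_keys_iff)
qed

lemma polys_hasse: "f \<in> polys V \<Longrightarrow> hasse v n f \<in> polys V"
proof -
  assume f: "f \<in> polys V"
  have "supp (t - sgl v n) \<subseteq> supp t" for t :: "'a mono" by (auto simp: in_keys_iff lookup_minus)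
  then show ?thesis using f supp_hasse[of v n f] by (fastforce simp: polys_def monomials_in_def)
qed

section \<open>Differential powers\<close>

definition hasse_ops :: "('v \<times> nat) list \<Rightarrow> ('v, 'k::comm_ring_1) mpol \<Rightarrow> ('v, 'k) mpol" where
  "hasse_ops = fold (\<lambda>(v, n). hasse v n)"

lemma hasse_ops_simps [simp]:
  "hasse_ops [] f = f" "hasse_ops ((v, n) # ops) f = hasse_ops ops (hasse v n f)"
  "hasse_ops (ops @ [(v, n)]) f = hasse v n (hasse_ops ops f)"
  by (simp_all add: hasse_ops_def)

lemma hasse_ops_sum: "hasse_ops ops (sum f A) = (\<Sum>i\<in>A. hasse_ops ops (f i))"
  by (induction ops arbitrary: f) (auto simp: hasse_sum)

lemma hasse_ops_add: "hasse_ops ops (f + g) = hasse_ops ops f + hasse_ops ops g"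
  by (induction ops arbitrary: f g) (auto simp: hasse_add)

text \<open>The differential power of order \<open>s\<close>; lists of operators in single
  variables, whose orders add up, stand for mixed derivatives.\<close>

definition diff_power :: "'v set \<Rightarrow> ('v, 'k::comm_ring_1) mpol set \<Rightarrow> nat \<Rightarrow> ('v, 'k) mpol set" where
  "diff_power V J s = {f \<in> polys V. \<forall>ops. sum_list (map snd ops) < s \<longrightarrow> hasse_ops ops f \<in> J}"

context prime_poly_ideal
begin

lemma diff_power_hasse: "f \<in> diff_power V J s \<Longrightarrow> hasse v n f \<in> diff_power V J (s - n)"
  unfolding diff_power_def
proof (safe, goal_cases)
  case (2 ops)
  have "hasse_ops ((v, n) # ops) f \<in> J" using 2 by (intro 2(2)[rule_format]) auto
  then show ?case by simp
qed (rule polys_hasse)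

lemma diff_power_mono: "f \<in> diff_power V J s \<Longrightarrow> s' \<le> s \<Longrightarrow> f \<in> diff_power V J s'"
  by (auto simp: diff_power_def)

lemma diff_power_J: "f \<in> diff_power V J s \<Longrightarrow> s > 0 \<Longrightarrow> f \<in> J"
  unfolding diff_power_def by (auto dest: spec[of _ "[]"])

lemma diff_powerI:
  assumes "f \<in> J" "\<And>v n. n \<ge> 1 \<Longrightarrow> hasse v n f \<in> diff_power V J (s - n)"
  shows "f \<in> diff_power V J s"
proof -
  have "hasse_ops ops f \<in> J" if "sum_list (map snd ops) < s" for ops
    using that
  proof (induction ops)
    case Nil
    then show ?case using assms(1) by simp
  next
    case (Cons p ops)
    obtain v n where p: "p = (v, n)" by (cases p)
    show ?case
    proof (cases "n = 0")
      case True
      then show ?thesis using Cons p by simp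
    next
      case False
      then have "hasse v n f \<in> diff_power V J (s - n)" by (intro assms(2)) simp
      then show ?thesis using Cons.prems p by (auto simp: diff_power_def)
    qed
  qed
  then show ?thesis using assms(1) J_polys by (auto simp: diff_power_def)
qed

text \<open>By the Leibniz rule each operator spreads its order over the two factors. Truncated
  subtraction is harmless: it can only enlarge the bound
  \<open>i - k + (j - (n - k))\<close>.\<close>

lemma hasse_ops_mult:
  assumes "f \<in> diff_power V J i" "g \<in> diff_power V J j" "sum_list (map snd ops) < i + j"
  shows "hasse_ops ops (f * g) \<in> J"
  using assms
proof (induction ops arbitrary: f g i j)
  case Nil
  have "f \<in> polys V" "g \<in> polys V" using Nil by (auto simp: diff_power_def)
  moreover have "f \<in> J \<or> g \<in> J" using Nil diff_power_J by (cases i; cases j) auto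
  ultimately show ?case
    using ideal_poly_ringD(4)[OF ideal_J, of g f] ideal_poly_ringD(4)[OF ideal_J, of f g] by (auto simp: mult.commute)
next
  case (Cons p ops)
  obtain v n where p: "p = (v, n)" by (cases p)
  have "hasse_ops ops (hasse v k f * hasse v (n - k) g) \<in> J" if "k \<le> n" for k
  proof (rule Cons.IH)
    show "hasse v k f \<in> diff_power V J (i - k)" "hasse v (n - k) g \<in> diff_power V J (j - (n - k))"
      using Cons.prems by (auto intro: diff_power_hasse)
    show "sum_list (map snd ops) < i - k + (j - (n - k))" using Cons.prems(3) that p by simp
  qed
  then show ?case
    unfolding p hasse_ops_simps hasse_mult hasse_ops_sum by (intro ideal_poly_ring_sum[OF ideal_J]) auto
qed

lemma diff_power_mult:
  "f \<in> diff_power V J i \<Longrightarrow> g \<in> diff_power V J j \<Longrightarrow> f * g \<in> diff_power V J (i + j)"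
  using hasse_ops_mult[of f i g j] by (auto simp: diff_power_def)

lemma diff_power_0: "diff_power V J 0 = polys V"
  by (simp add: diff_power_def)

lemma diff_power_add: "f \<in> diff_power V J s \<Longrightarrow> g \<in> diff_power V J s \<Longrightarrow> f + g \<in> diff_power V J s"
  by (auto simp: diff_power_def hasse_ops_add ideal_poly_ringD(3)[OF ideal_J])

lemma diff_power_cmult: "c \<in> polys V \<Longrightarrow> f \<in> diff_power V J s \<Longrightarrow> c * f \<in> diff_power V J s"
  using diff_power_mult[of c 0 f s] by (simp add: diff_power_0)

lemma diff_power_zero: "0 \<in> diff_power V J s"
  using hasse_ops_sum[of _ "\<lambda>_ :: nat. 0 :: ('v, 'k) mpol" "{}"] ideal_poly_ringD(2)[OF ideal_J]
  by (simp add: diff_power_def)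

lemma diff_power_sum: "(\<And>i. i \<in> A \<Longrightarrow> f i \<in> diff_power V J s) \<Longrightarrow> sum f A \<in> diff_power V J s"
  by (induction A rule: infinite_finite_induct) (simp_all add: diff_power_zero diff_power_add)

text \<open>The Leibniz rule is solved for \<open>u * hasse v n f\<close>. The other terms contain
  lower derivatives of \<open>f\<close>, covered by the inner induction on \<open>n\<close>, and
  \<open>f\<close> itself, covered by the outer one on \<open>s\<close>, which finally also cancels
  \<open>u\<close>.\<close>

lemma diff_power_cancel:
  assumes u: "u \<in> polys V" "u \<notin> J"
  shows "f \<in> polys V \<Longrightarrow> u * f \<in> diff_power V J s \<Longrightarrow> f \<in> diff_power V J s"
proof (induction s arbitrary: f rule: less_induct)
  case (less s)
  note f = less.prems and IH = less.IH
  show ?case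
  proof (cases "s = 0")
    case True
    then show ?thesis using f by (simp add: diff_power_0)
  next
    case s: False
    have "u * f \<in> J" using diff_power_J[OF f(2)] s by simp
    then have fJ: "f \<in> J" using J_prime[OF u(1) f(1)] u(2) by blast
    have "hasse v n f \<in> diff_power V J (s - n)" if "n \<ge> 1" for v and n :: nat
      using that
    proof (induction n rule: less_induct)
      case (less n)
      have sn: "s - n < s" using less.prems s by simp
      have lower: "hasse v (n - i) f \<in> diff_power V J (s - n)" if i: "i \<in> {1..n}" for i
      proof (cases "i = n")
        case True
        have "u * f \<in> diff_power V J (s - n)" using f(2) by (rule diff_power_mono) simp
        then show ?thesis using True IH[OF sn f(1)] by simp
      next
        case False
        then have "hasse v (n - i) f \<in> diff_power V J (s - (n - i))" using i by (intro less.IH) auto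
        then show ?thesis by (rule diff_power_mono) simp
      qed
      have "{..n} = insert 0 {1..n}" by auto
      then have "hasse v n (u * f) = u * hasse v n f + (\<Sum>i\<in>{1..n}. hasse v i u * hasse v (n - i) f)"
        unfolding hasse_mult by simp
      then have "u * hasse v n f = hasse v n (u * f) + (- 1) * (\<Sum>i\<in>{1..n}. hasse v i u * hasse v (n - i) f)"
        by simp
      also have "\<dots> \<in> diff_power V J (s - n)"
      proof (rule diff_power_add)
        show "hasse v n (u * f) \<in> diff_power V J (s - n)" using f(2) by (rule diff_power_hasse)
        have "(\<Sum>i\<in>{1..n}. hasse v i u * hasse v (n - i) f) \<in> diff_power V J (s - n)"
          using lower by (intro diff_power_sum diff_power_cmult polys_hasse u(1))
        then show "(- 1) * (\<Sum>i\<in>{1..n}. hasse v i u * hasse v (n - i) f) \<in> diff_power V J (s - n)"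
          by (rule diff_power_cmult[rotated]) (intro polys_uminus polys_one)
      qed
      finally show ?case by (rule IH[OF sn polys_hasse[OF f(1)]])
    qed
    then show ?thesis by (rule diff_powerI[OF fJ])
  qed
qed

lemma ideal_pow_diff_power: "ideal_pow R J n \<subseteq> diff_power V J n"
proof (induction n)
  case 0
  then show ?case by (simp add: diff_power_0)
next
  case (Suc n)
  have J1: "f \<in> diff_power V J 1" if "f \<in> J" for f
    by (rule diff_powerI[OF that]) (use that J_polys in \<open>auto simp: diff_power_0 intro: polys_hasse\<close>)
  show ?case
  proof
    fix f assume "f \<in> ideal_pow R J (Suc n)"
    then have "f \<in> ideal_prod R (ideal_pow R J n) J" by (simp add: ideal_pow_Suc)
    then show "f \<in> diff_power V J (Suc n)"
    proof (induction f rule: ideal_prod.induct)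
      case (prod i j)
      then show ?case using diff_power_mult[of i n j 1] Suc J1 by auto
    next
      case (sum a b)
      then show ?case by (simp add: diff_power_add)
    qed
  qed
qed

text \<open>The multiplier outside \<open>J\<close> that comes from the localization is cancelled
  inside the differential power.\<close>

lemma symbolic_power_diff_power: "symbolic_power R J n \<subseteq> diff_power V J n"
proof
  fix f assume "f \<in> symbolic_power R J n"
  then obtain u where "f \<in> polys V" "u \<in> polys V" "u \<notin> J" "u * f \<in> ideal_pow R J n"
    unfolding symbolic_power_iff by blast
  then show "f \<in> diff_power V J n" using diff_power_cancel[of u f n] ideal_pow_diff_power[of n] by blast
qed

end

section \<open>Groebner bases of the symbolic powers of the secant ideals\<close>

lemma prime_poly_ideal_secant: "r \<ge> 1 \<Longrightarrow> prime_poly_ideal (skew_vars m) (pf_secant m r :: (_, 'k::field) mpol set)"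
  by (rule prime_poly_ideal.intro) (rule prime_secant)

section \<open>Leading monomials of products and derivatives\<close>

definition leads :: "'v mono rel \<Rightarrow> ('v, 'k::zero) mpol \<Rightarrow> 'v mono \<Rightarrow> bool" where
  "leads ord p t \<longleftrightarrow> t \<in> supp p \<and> (\<forall>u\<in>supp p. (u, t) \<in> ord)"

lemma leads_lead_mono: "term_order V ord \<Longrightarrow> p \<in> polys V \<Longrightarrow> p \<noteq> 0 \<Longrightarrow> leads ord p (lead_mono ord p)"
  using lead_mono[of V ord p] by (auto simp: leads_def)

lemma lead_mono_leads: "term_order V ord \<Longrightarrow> p \<in> polys V \<Longrightarrow> leads ord p t \<Longrightarrow> lead_mono ord p = t"
  by (rule lead_mono_eqI[of "monomials_in V"]) (auto simp: leads_def term_order_def polys_def)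

lemma mult_eq_sum: "p * q = (\<Sum>s\<in>supp p. \<Sum>t\<in>supp q. sgl (s + t) (cf p s * cf q t))"
  for p q :: "('v, 'k::comm_ring_1) mpol"
  by (subst (1) poly_decomp[of p], subst (1) poly_decomp[of q]) (simp add: sum_product mult_single)

lemma leads_mult:
  fixes p q :: "('v, 'k::field) mpol"
  assumes to: "term_order V ord" and pq: "p \<in> polys V" "q \<in> polys V" and lead: "leads ord p a" "leads ord q b"
  shows "leads ord (p * q) (a + b)"
proof -
  have mon: "s \<in> supp p \<Longrightarrow> s \<in> monomials_in V" "t \<in> supp q \<Longrightarrow> t \<in> monomials_in V" for s t
    using pq by (auto simp: polys_def)
  have le: "(s + t, a + b) \<in> ord" and eq: "s + t = a + b \<Longrightarrow> s = a \<and> t = b" if st: "s \<in> supp p" "t \<in> supp q" for s t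
  proof -
    have 1: "(s + t, a + t) \<in> ord" using lead st mon by (intro term_orderD(4)[OF to]) (auto simp: leads_def)
    have "(t + a, b + a) \<in> ord" using lead st mon by (intro term_orderD(4)[OF to]) (auto simp: leads_def)
    then have 2: "(a + t, a + b) \<in> ord" by (simp add: add.commute)
    show "(s + t, a + b) \<in> ord" using term_orderD(1)[OF to 1 2] .
    show "s = a \<and> t = b" if e: "s + t = a + b"
    proof -
      have "a + t = a + b" using term_orderD(2)[OF to 2] 1 unfolding e by blast
      then show ?thesis using e by simp
    qed
  qed
  have "cf (p * q) (a + b) = (\<Sum>s\<in>supp p. \<Sum>t\<in>supp q. if s = a then if t = b then cf p a * cf q b else 0 else 0)"
    unfolding mult_eq_sum lookup_sum lookup_single when_def
    by (intro sum.cong refl) (use eq in auto)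
  also have "\<dots> = (\<Sum>s\<in>supp p. if s = a then cf p a * cf q b else 0)"
    using lead by (intro sum.cong refl) (auto simp: leads_def)
  also have "\<dots> = cf p a * cf q b" using lead by (simp add: leads_def)
  finally have "a + b \<in> supp (p * q)" using lead by (simp add: leads_def in_keys_iff)
  moreover have "(u, a + b) \<in> ord" if "u \<in> supp (p * q)" for u
    using that keys_mult[of p q] le by blast
  ultimately show ?thesis by (simp add: leads_def)
qed

text \<open>The order of differentiation is the full exponent of \<open>v\<close> in the leading
  monomial, so the binomial coefficient is 1 and the term survives. Dividing by a power of
  \<open>v\<close> preserves the order among the monomials divisible by it.\<close>

lemma hasse_leads:
  assumes to: "term_order V ord" and f: "f \<in> polys V" and t: "leads ord f t" and v: "v \<in> V"
  shows "leads ord (hasse v (cf t v) f) (t - sgl v (cf t v))"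
proof -
  let ?n = "cf t v"
  have lin: "linear_order_on (monomials_in V) ord" using to by (simp add: term_order_def)
  have mon: "u \<in> monomials_in V" if "u \<in> supp f" for u using f that by (auto simp: polys_def)
  have sv: "sgl v ?n \<in> monomials_in V" using v by (simp add: monomials_in_def)
  have sub: "u - sgl v n \<in> monomials_in V" if "u \<in> monomials_in V" for u n
  proof -
    have "supp (u - sgl v n) \<subseteq> supp u" by (auto simp: in_keys_iff lookup_minus)
    then show ?thesis using that by (auto simp: monomials_in_def)
  qed
  have "t - sgl v ?n \<in> supp (hasse v ?n f)"
    using t lookup_hasse[of ?n t v f] by (simp add: leads_def in_keys_iff)
  moreover have "(w, t - sgl v ?n) \<in> ord" if w: "w \<in> supp (hasse v ?n f)" for w
  proof (rule ccontr)
    assume no: "(w, t - sgl v ?n) \<notin> ord"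
    obtain u where u: "u \<in> supp f" "?n \<le> cf u v" "w = u - sgl v ?n" using w supp_hasse[of v ?n f] by blast
    have m: "w \<in> monomials_in V" "t - sgl v ?n \<in> monomials_in V"
      using u t mon sub unfolding leads_def by blast+
    have "w \<noteq> t - sgl v ?n" using no term_orderD(3)[OF to m(2)] by auto
    then have "(t - sgl v ?n, w) \<in> ord"
      using lin m no by (auto simp: linear_order_on_def total_on_def)
    then have "(t - sgl v ?n + sgl v ?n, w + sgl v ?n) \<in> ord" by (rule term_orderD(4)[OF to _ sv])
    then have "(t, u) \<in> ord" using u by (simp add: minus_single_add)
    moreover have "(u, t) \<in> ord" using t u by (simp add: leads_def)
    ultimately have "t = u" using term_orderD(2)[OF to] by blast
    then show False using \<open>w \<noteq> _\<close> u by simp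
  qed
  ultimately show ?thesis by (simp add: leads_def)
qed

text \<open>Differentiating the leading monomial away on \<open>C\<close> leaves a monomial with a height function,
  which cannot lead an element of the secant ideal.\<close>

lemma diff_power_cover:
  fixes f :: "(nat \<times> nat, 'k::comm_ring_1) mpol"
  assumes r: "r \<ge> 1" and ord: "pf_order TYPE('k) m ord" and f: "f \<in> diff_power (skew_vars m) (pf_secant m r) s"
    and \<beta>: "leads ord f \<beta>" and C: "C \<subseteq> supp \<beta>" and h: "height_on nest r (supp \<beta> - C) h"
  shows "s \<le> (\<Sum>v\<in>C. cf \<beta> v)"
proof (rule ccontr)
  assume less: "\<not> s \<le> (\<Sum>v\<in>C. cf \<beta> v)"
  let ?V = "skew_vars m"
  have to: "term_order ?V ord" using ord by (simp add: pf_order_def)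
  have fp: "f \<in> polys ?V" using f by (simp add: diff_power_def)
  have "supp \<beta> \<subseteq> ?V" using fp \<beta> by (auto simp: leads_def polys_def monomials_in_def)
  have "finite C" using C by (rule finite_subset) simp
  \<comment> \<open>One variable of \<open>C\<close> at a time: the orders of the operators add up
    to the weight of \<open>C\<close>, and the leading monomial loses exactly its part on
    \<open>C\<close>.\<close>
  then have "C \<subseteq> supp \<beta> \<Longrightarrow> \<exists>ops \<gamma>. sum_list (map snd ops) = (\<Sum>v\<in>C. cf \<beta> v) \<and> hasse_ops ops f \<in> polys ?V \<and>
      leads ord (hasse_ops ops f) \<gamma> \<and> (\<forall>w. cf \<gamma> w = (if w \<in> C then 0 else cf \<beta> w))"
  proof (induction C rule: finite_induct)
    case empty
    show ?case using fp \<beta> by (intro exI[of _ "[]"] exI[of _ \<beta>]) simp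
  next
    case (insert v C)
    then obtain ops \<gamma> where o: "sum_list (map snd ops) = (\<Sum>v\<in>C. cf \<beta> v)" "hasse_ops ops f \<in> polys ?V"
      "leads ord (hasse_ops ops f) \<gamma>" "\<forall>w. cf \<gamma> w = (if w \<in> C then 0 else cf \<beta> w)" by auto
    have \<gamma>v: "cf \<gamma> v = cf \<beta> v" using o(4)[rule_format, of v] insert.hyps by simp
    have "v \<in> ?V" using insert.prems \<open>supp \<beta> \<subseteq> ?V\<close> by blast
    then have "leads ord (hasse v (cf \<beta> v) (hasse_ops ops f)) (\<gamma> - sgl v (cf \<beta> v))"
      using hasse_leads[OF to o(2,3)] unfolding \<gamma>v[symmetric] by blast
    moreover have "cf (\<gamma> - sgl v (cf \<beta> v)) w = (if w \<in> insert v C then 0 else cf \<beta> w)" for w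
      using o(4)[rule_format, of w] by (simp add: lookup_minus lookup_single when_def)
    moreover have "sum_list (map snd (ops @ [(v, cf \<beta> v)])) = (\<Sum>v\<in>insert v C. cf \<beta> v)"
      using o(1) insert.hyps by simp
    moreover have "hasse_ops (ops @ [(v, cf \<beta> v)]) f \<in> polys ?V"
      using polys_hasse[OF o(2)] by simp
    ultimately show ?case unfolding hasse_ops_simps(3)[symmetric] by blast
  qed
  then obtain ops \<gamma> where o: "sum_list (map snd ops) = (\<Sum>v\<in>C. cf \<beta> v)"
    "leads ord (hasse_ops ops f) \<gamma>" "\<forall>w. cf \<gamma> w = (if w \<in> C then 0 else cf \<beta> w)" using C by blast
  have "hasse_ops ops f \<in> pf_secant m r" using f o(1) less by (simp add: diff_power_def)
  moreover have "v \<in> supp \<gamma> \<longleftrightarrow> v \<in> supp \<beta> - C" for v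
    using o(3)[rule_format, of v] by (simp add: in_keys_iff)
  then have "supp \<gamma> = supp \<beta> - C" by blast
  then have "standard r \<gamma>" using h by (auto simp: standard_def)
  ultimately show False using lead_not_standard[OF r ord _ _ _, of "hasse_ops ops f" \<gamma>] o(2) by (auto simp: leads_def)
qed

section \<open>Products of Pfaffians as lists of index sets\<close>

definition pf_prod :: "nat set list \<Rightarrow> (nat \<times> nat, 'k::comm_ring_1) mpol" where
  "pf_prod us = prod_list (map (subpfaffian generic_skew) us)"

definition pf_shape :: "nat \<Rightarrow> nat \<Rightarrow> nat set \<Rightarrow> bool" where
  "pf_shape m r U \<longleftrightarrow> U \<subseteq> {1..m} \<and> (\<exists>t\<ge>Suc r. card U = 2 * t)"

lemma total_degree_subpfaffian:
  assumes "U \<subseteq> {1..m}" "card U = 2 * t"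
  shows "total_degree (subpfaffian generic_skew U :: (_, 'k::comm_ring_1) mpol) = t"
proof -
  let ?p = "subpfaffian generic_skew U :: (_, 'k) mpol"
  have "(\<lambda>u. \<Sum>v\<in>supp u. cf u v) ` supp ?p = {t}"
    using subpfaffian_facts(4)[OF assms, where 'k = 'k] antidiagonal_in_supp[OF assms, where 'k = 'k]
    by (force simp: mono_degree_def)
  then show ?thesis by (simp add: total_degree_def)
qed

text \<open>The degree of a Pfaffian is half the size of its index set. As all sizes are at least
  \<open>2r + 2\<close>, natural subtraction agrees with the integer one.\<close>

lemma pfaffian_products_eq:
  "pfaffian_products m r s = {pf_prod us :: (_, 'k::comm_ring_1) mpol |us. us \<noteq> [] \<and> (\<forall>U\<in>set us. pf_shape m r U) \<and>
    (\<Sum>U\<leftarrow>us. card U div 2 - r) = s}" (is "_ = ?R")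
proof (intro equalityI subsetI)
  fix g :: "(_, 'k) mpol" assume "g \<in> pfaffian_products m r s"
  then obtain f and l :: nat where g: "g = (\<Prod>i=1..l. f i)" and l: "l \<ge> 1"
    and f: "\<forall>i\<in>{1..l}. f i \<in> (subpfaffians_ge m (r + 1) generic_skew :: (_, 'k) mpol set)"
    and s: "(\<Sum>i=1..l. int (total_degree (f i)) - int r) = int s"
    unfolding pfaffian_products_def by blast
  have "\<exists>U. \<forall>i\<in>{1..l}. f i = subpfaffian generic_skew (U i) \<and> pf_shape m r (U i)"
  proof (rule bchoice, rule ballI)
    fix i assume "i \<in> {1..l}"
    then obtain U t where "f i = subpfaffian generic_skew U" "U \<subseteq> {1..m}" "card U = 2 * t" "t \<ge> r + 1"
      using f unfolding subpfaffians_ge_def by blast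
    then show "\<exists>U. f i = subpfaffian generic_skew U \<and> pf_shape m r U"
      by (intro exI[of _ U]) (auto simp: pf_shape_def)
  qed
  then obtain U where U: "\<And>i. i \<in> {1..l} \<Longrightarrow> f i = subpfaffian generic_skew (U i) \<and> pf_shape m r (U i)" by blast
  define us where "us = map U [1..<Suc l]"
  have "pf_prod us = (\<Prod>i=1..l. subpfaffian generic_skew (U i) :: (_, 'k) mpol)"
    by (simp add: pf_prod_def us_def comp_def atLeastLessThanSuc_atLeastAtMost
        flip: prod.distinct_set_conv_list del: upt_Suc)
  also have "\<dots> = g" using U by (simp add: g)
  finally have "g = pf_prod us" ..
  moreover have "(\<Sum>U\<leftarrow>us. card U div 2 - r) = s"
  proof -
    have "int (\<Sum>U\<leftarrow>us. card U div 2 - r) = (\<Sum>i=1..l. int (card (U i) div 2 - r))"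
      by (simp add: us_def comp_def atLeastLessThanSuc_atLeastAtMost
        flip: sum.distinct_set_conv_list del: upt_Suc)
    also have "\<dots> = (\<Sum>i=1..l. int (total_degree (f i)) - int r)"
    proof (intro sum.cong refl)
      fix i assume "i \<in> {1..l}"
      then obtain t where "f i = subpfaffian generic_skew (U i)" "U i \<subseteq> {1..m}" "card (U i) = 2 * t" "t \<ge> Suc r"
        using U[of i] by (auto simp: pf_shape_def)
      then show "int (card (U i) div 2 - r) = int (total_degree (f i)) - int r"
        by (simp add: total_degree_subpfaffian)
    qed
    finally show ?thesis using s by simp
  qed
  moreover have "us \<noteq> []" "\<forall>U\<in>set us. pf_shape m r U" using l U by (auto simp: us_def)
  ultimately show "g \<in> ?R" by blast
next
  fix g :: "(_, 'k) mpol" assume "g \<in> ?R"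
  then obtain us where g: "g = pf_prod us" and us: "us \<noteq> []" "\<And>U. U \<in> set us \<Longrightarrow> pf_shape m r U"
    and s: "(\<Sum>U\<leftarrow>us. card U div 2 - r) = s" by blast
  define f :: "nat \<Rightarrow> (_, 'k) mpol" where "f i = subpfaffian generic_skew (us ! (i - 1))" for i
  let ?l = "length us"
  have "g = (\<Prod>i=1..?l. f i)"
    by (simp add: g pf_prod_def prod.list_conv_set_nth f_def prod.atLeast1_atMost_eq atLeast0LessThan)
  moreover have "\<forall>i\<in>{1..?l}. f i \<in> subpfaffians_ge m (r + 1) generic_skew"
  proof
    fix i assume "i \<in> {1..?l}"
    then have "us ! (i - 1) \<in> set us" by (intro nth_mem) auto
    from us(2)[OF this] show "f i \<in> subpfaffians_ge m (r + 1) generic_skew"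
      by (auto simp: f_def subpfaffians_ge_def pf_shape_def)
  qed
  moreover have "(\<Sum>i=1..?l. int (total_degree (f i)) - int r) = int s"
  proof -
    have "(\<Sum>i=1..?l. int (total_degree (f i)) - int r) = (\<Sum>i<?l. int (card (us ! i) div 2 - r))"
      unfolding One_nat_def sum.atLeast1_atMost_eq
    proof (rule sum.cong[OF refl])
      fix i assume "i \<in> {..<?l}"
      then have "us ! i \<in> set us" by simp
      from us(2)[OF this] obtain t where "us ! i \<subseteq> {1..m}" "card (us ! i) = 2 * t" "t \<ge> Suc r"
        by (auto simp: pf_shape_def)
      then show "int (total_degree (f (Suc i))) - int r = int (card (us ! i) div 2 - r)"
        by (simp add: f_def total_degree_subpfaffian)
    qed
    also have "\<dots> = int s" unfolding s[symmetric]
      by (simp add: sum.list_conv_set_nth atLeast0LessThan)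
    finally show ?thesis .
  qed
  ultimately show "g \<in> pfaffian_products m r s"
    unfolding pfaffian_products_def using us(1) by (auto intro!: exI[of _ f] exI[of _ ?l] simp: Suc_le_eq)
qed

text \<open>Every factor contributes at least 1 to \<open>s\<close>, which bounds the number of
  factors.\<close>

lemma finite_pfaffian_products: "finite (pfaffian_products m r s :: (_, 'k::comm_ring_1) mpol set)"
proof -
  have "length us \<le> (\<Sum>U\<leftarrow>us. card U div 2 - r)" if "\<forall>U\<in>set us. pf_shape m r U" for us
    using that by (induction us) (fastforce simp: pf_shape_def)+
  then have "pfaffian_products m r s \<subseteq> (pf_prod :: _ \<Rightarrow> (_, 'k) mpol) ` {us. set us \<subseteq> Pow {1..m} \<and> length us \<le> s}"
    unfolding pfaffian_products_eq by (auto simp: pf_shape_def)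
  then show ?thesis by (rule finite_subset) (intro finite_imageI finite_lists_length_le finite_Pow_iff[THEN iffD2] finite_atLeastAtMost)
qed

lemma polys_pf_prod: "(\<And>U. U \<in> set us \<Longrightarrow> pf_shape m r U) \<Longrightarrow> pf_prod us \<in> polys (skew_vars m)"
proof (induction us)
  case Nil
  then show ?case by (simp add: pf_prod_def)
next
  case (Cons U us)
  obtain t where "U \<subseteq> {1..m}" "card U = 2 * t" using Cons.prems[of U] by (auto simp: pf_shape_def)
  from subpfaffian_facts(1)[OF this] show ?case using Cons by (auto simp: pf_prod_def)
qed

lemma leads_pf_prod:
  assumes "pf_order TYPE('k::field) m ord"
  shows "(\<And>U. U \<in> set us \<Longrightarrow> pf_shape m r U) \<Longrightarrow>
    leads ord (pf_prod us :: (_, 'k) mpol) (\<Sum>U\<leftarrow>us. antidiagonal_mono U)"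
proof (induction us)
  case Nil
  have "(0, 0) \<in> ord" using assms by (auto simp: pf_order_def term_order_def)
  then show ?case by (simp add: pf_prod_def leads_def)
next
  case (Cons U us)
  have to: "term_order (skew_vars m) ord" using assms by (simp add: pf_order_def)
  obtain t where U: "U \<subseteq> {1..m}" "card U = 2 * t" using Cons.prems[of U] by (auto simp: pf_shape_def)
  have lU: "leads ord (subpfaffian generic_skew U :: (_, 'k) mpol) (antidiagonal_mono U)"
    using assms U antidiagonal_in_supp[OF U, where 'k = 'k] unfolding leads_def pf_order_def by blast
  have "leads ord (subpfaffian generic_skew U * pf_prod us :: (_, 'k) mpol) (antidiagonal_mono U + (\<Sum>U\<leftarrow>us. antidiagonal_mono U))"
  proof (rule leads_mult[OF to subpfaffian_facts(1)[OF U] _ lU])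
    show "pf_prod us \<in> (polys (skew_vars m) :: (_, 'k) mpol set)" using Cons.prems by (intro polys_pf_prod) auto
    show "leads ord (pf_prod us :: (_, 'k) mpol) (\<Sum>U\<leftarrow>us. antidiagonal_mono U)" using Cons by simp
  qed
  then show ?case by (simp add: pf_prod_def)
qed

section \<open>Pfaffians in symbolic powers\<close>

lemma pfl_word_in_secant:
  assumes r: "r \<ge> 1" and w: "set w \<subseteq> {1..m}" "length w = 2 * Suc r"
  shows "pfl generic_skew w \<in> (pf_secant m r :: (_, 'k::comm_ring_1) mpol set)"
proof -
  interpret skew_form "generic_skew :: nat \<Rightarrow> nat \<Rightarrow> (_, 'k) mpol" by (rule skew_form_generic_skew)
  note id = secant_pf4(1)[OF r, of m, where 'k = 'k]
  show ?thesis
  proof (cases "distinct w")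
    case True
    have "pfl generic_skew (sort w) \<in> (pf_secant m r :: (_, 'k) mpol set)"
      using True w by (intro secant_pf4(2)[OF r]) (auto simp: strict_sorted_iff)
    then show ?thesis
      using pfl_perm[of w "sort w" "[]"] ideal_poly_ringD(5)[OF id] by fastforce
  next
    case False
    show ?thesis using pfl_not_distinct[OF False] ideal_poly_ringD(2)[OF id] by simp
  qed
qed

lemma mono_degree_antidiagonal:
  assumes "U \<subseteq> {1..m}" "card U = 2 * t"
  shows "mono_degree (antidiagonal_mono U) = t"
  by (rule subpfaffian_facts(4)[OF assms antidiagonal_in_supp[OF assms, where 'k = int]])

text \<open>The leading monomial has degree \<open>r\<close> and cannot be divisible by a chain of
  \<open>r + 1\<close> elements. This provides the multiplier to be cancelled in the symbolic
  powers.\<close>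

lemma small_pfl_notin_secant:
  assumes r: "r \<ge> 1" and S: "sorted_wrt (<) S" "set S \<subseteq> {1..m}" "length S = 2 * r"
  shows "pfl generic_skew S \<notin> (pf_secant m r :: (_, 'k::comm_ring_1) mpol set)"
proof
  assume in_J: "pfl generic_skew S \<in> (pf_secant m r :: (_, 'k) mpol set)"
  have U: "set S \<subseteq> {1..m}" "card (set S) = 2 * r"
    using S by (simp_all add: strict_sorted_iff distinct_card)
  have eq: "pfl generic_skew S = (subpfaffian generic_skew (set S) :: (_, 'k) mpol)"
    using S by (intro pfl_eq_subpfaffian) auto
  let ?A = "antidiagonal_mono (set S)"
  note ord = pf_order_weight_order[of m, where 'k = 'k]
  have "\<not> standard r ?A"
    using in_J antidiagonal_in_supp[OF U, where 'k = 'k] ord U unfolding eq pf_order_def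
    by (intro lead_not_standard[OF r ord in_J[unfolded eq]]) blast+
  then obtain U' \<delta> where U': "U' \<subseteq> {1..m}" "card U' = 2 * Suc r" "?A = antidiagonal_mono U' + \<delta>"
    using not_standard_nested[OF r antidiagonal_in_monomials[OF U]] by blast
  show False using U'(3) mono_degree_antidiagonal[OF U] mono_degree_antidiagonal[OF U'(1,2)] by simp
qed

text \<open>By the Pluecker relation, \<open>pfl S * pfl (S @ T)\<close> is a combination of products of a Pfaffian of
  size \<open>2r + 2\<close> with a Pfaffian on \<open>S\<close> and two letters less of \<open>T\<close>, and \<open>pfl S\<close> can be cancelled.\<close>

lemma pfl_append_symbolic_power:
  assumes r: "r \<ge> 1" and S: "sorted_wrt (<) S" "set S \<subseteq> {1..m}" "length S = 2 * r"
  shows "length T = 2 * q \<Longrightarrow> set T \<subseteq> {1..m} \<Longrightarrow>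
    pfl generic_skew (S @ T) \<in> symbolic_power (poly_ring (skew_vars m)) (pf_secant m r :: (_, 'k::field) mpol set) q"
proof (induction q arbitrary: T)
  interpret prime_poly_ideal "skew_vars m" "pf_secant m r :: (_, 'k) mpol set"
    by (rule prime_poly_ideal_secant[OF r])
  interpret skew_form "generic_skew :: nat \<Rightarrow> nat \<Rightarrow> (_, 'k) mpol" by (rule skew_form_generic_skew)
  {
    case 0
    then show ?case using S by (simp add: symbolic_power_0 polys_pfl_generic)
  next
    case (Suc q)
    then obtain i T' where T: "T = i # T'" by (cases T) auto
    let ?sym = "symbolic_power R (pf_secant m r)"
    note id = ideal_symbolic_power[of "Suc q"]
    have i: "i \<in> {1..m}" and T': "set T' \<subseteq> {1..m}" using Suc.prems(2) by (auto simp: T)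
    have "(-1) ^ k * pfl generic_skew (S @ del k T') * pfl generic_skew (T' ! k # S @ [i]) \<in> ?sym (Suc q)"
      if k: "k < length T'" for k
    proof -
      have "set (del k T') \<subseteq> {1..m}" using T' set_del[of k T'] by blast
      then have 1: "pfl generic_skew (S @ del k T') \<in> ?sym q"
        using Suc.prems(1) k by (intro Suc.IH) (auto simp: T)
      have "T' ! k \<in> {1..m}" using T' nth_mem[OF k] by blast
      then have "pfl generic_skew (T' ! k # S @ [i]) \<in> pf_secant m r"
        using S i by (intro pfl_word_in_secant[OF r]) auto
      then have 2: "pfl generic_skew (T' ! k # S @ [i]) \<in> ?sym 1" using J_subset_symbolic_power_1 by blast
      have "(-1) ^ k \<in> (polys (skew_vars m) :: (_, 'k) mpol set)" by (intro polys_power polys_uminus polys_one)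
      from ideal_poly_ringD(4)[OF id _ this] symbolic_power_mult[OF 1 2]
      have "(-1) ^ k * (pfl generic_skew (S @ del k T') * pfl generic_skew (T' ! k # S @ [i])) \<in> ?sym (Suc q)"
        unfolding Suc_eq_plus1 by blast
      then show ?thesis by (simp only: mult.assoc)
    qed
    moreover have "even (length S)" using S(3) by simp
    ultimately have "pfl generic_skew S * pfl generic_skew (i # S @ T') \<in> ?sym (Suc q)"
      unfolding pfl_pluecker[OF \<open>even _\<close>]
      by (intro ideal_poly_ringD(5)[OF id] ideal_poly_ring_sum[OF id]) auto
    then have "pfl generic_skew (i # S @ T') \<in> ?sym (Suc q)"
      using S i T' by (intro symbolic_power_cancel[OF polys_pfl_generic small_pfl_notin_secant[OF r S] polys_pfl_generic]) auto
    then show ?case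
      using pfl_perm[of "S @ i # T'" "i # S @ T'" "[]"] ideal_poly_ringD(5)[OF id] by (force simp: T)
  }
qed

text \<open>The \<open>2r\<close> smallest indices serve as \<open>S\<close>, and half the number of
  the others is the exponent.\<close>

lemma subpfaffian_symbolic_power:
  assumes r: "r \<ge> 1" and U: "pf_shape m r U"
  shows "subpfaffian generic_skew U \<in> symbolic_power (poly_ring (skew_vars m)) (pf_secant m r :: (_, 'k::field) mpol set) (card U div 2 - r)"
proof -
  obtain t where t: "U \<subseteq> {1..m}" "card U = 2 * t" "t \<ge> Suc r" using U by (auto simp: pf_shape_def)
  let ?xs = "sorted_list_of_set U"
  let ?S = "take (2 * r) ?xs" and ?T = "drop (2 * r) ?xs"
  have fin: "finite U" using t(1) by (rule finite_subset) simp
  have xs: "sorted_wrt (<) ?xs" "set ?xs \<subseteq> {1..m}" "length ?xs = 2 * t"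
    using t fin by (simp_all add: strict_sorted_iff)
  have "pfl generic_skew (?S @ ?T) \<in> symbolic_power (poly_ring (skew_vars m)) (pf_secant m r :: (_, 'k) mpol set) (t - r)"
    using xs t(3) by (intro pfl_append_symbolic_power[OF r])
      (auto intro: sorted_wrt_take dest!: in_set_takeD in_set_dropD simp del: set_sorted_list_of_set sorted_list_of_set.set_sorted_key_list_of_set)
  then show ?thesis using t(2) by (simp add: subpfaffian_eq_pfl[OF t(2)])
qed

lemma pf_prod_symbolic_power:
  assumes r: "r \<ge> 1"
  shows "(\<And>U. U \<in> set us \<Longrightarrow> pf_shape m r U) \<Longrightarrow>
    pf_prod us \<in> symbolic_power (poly_ring (skew_vars m)) (pf_secant m r :: (_, 'k::field) mpol set) (\<Sum>U\<leftarrow>us. card U div 2 - r)"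
proof (induction us)
  interpret prime_poly_ideal "skew_vars m" "pf_secant m r :: (_, 'k) mpol set"
    by (rule prime_poly_ideal_secant[OF r])
  {
    case Nil
    then show ?case by (simp add: pf_prod_def symbolic_power_0)
  next
    case (Cons U us)
    have "subpfaffian generic_skew U * pf_prod us \<in> symbolic_power R (pf_secant m r) (card U div 2 - r + (\<Sum>U\<leftarrow>us. card U div 2 - r))"
      using Cons by (intro symbolic_power_mult subpfaffian_symbolic_power[OF r]) auto
    then show ?case by (simp add: pf_prod_def)
  }
qed

text \<open>The bound of \<open>diff_power_cover\<close> is the hypothesis of
  \<open>greene_kleitman\<close>. Each chain found is the antidiagonal monomial of an index set of
  twice its length, so surpluses over \<open>r\<close> become contributions to \<open>s\<close>;
  \<open>s \<ge> 1\<close> keeps the list nonempty.\<close>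

lemma symbolic_power_lead:
  fixes f :: "(nat \<times> nat, 'k::field) mpol"
  assumes r: "r \<ge> 1" and s: "s \<ge> 1" and ord: "pf_order TYPE('k) m ord"
    and f: "f \<in> symbolic_power (poly_ring (skew_vars m)) (pf_secant m r) s" and lead: "leads ord f \<beta>"
  obtains us \<delta> where "us \<noteq> []" "\<And>U. U \<in> set us \<Longrightarrow> pf_shape m r U" "(\<Sum>U\<leftarrow>us. card U div 2 - r) = s"
    "\<beta> = (\<Sum>U\<leftarrow>us. antidiagonal_mono U) + \<delta>"
proof -
  interpret prime_poly_ideal "skew_vars m" "pf_secant m r :: (_, 'k) mpol set"
    by (rule prime_poly_ideal_secant[OF r])
  have fd: "f \<in> diff_power (skew_vars m) (pf_secant m r) s" using f symbolic_power_diff_power by blast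
  obtain cs \<delta> where cs: "\<And>c. c \<in> set cs \<Longrightarrow> sorted_wrt nest c \<and> length c > r"
    "(\<Sum>c\<leftarrow>cs. length c - r) = s" and \<beta>: "\<beta> = (\<Sum>c\<leftarrow>cs. \<Sum>v\<leftarrow>c. sgl v 1) + \<delta>"
    by (rule greene_kleitman[OF transp_nest irreflp_nest r, of \<beta> s])
      (use diff_power_cover[OF r ord fd lead] in auto)
  have pos: "cf (\<Sum>v\<leftarrow>c. sgl v (1::nat)) u > 0" if "u \<in> set c" for u :: "nat \<times> nat" and c
    using that by (induction c) (auto simp: lookup_add lookup_single when_def)
  have "cf (\<Sum>c\<leftarrow>cs. \<Sum>v\<leftarrow>c. sgl v (1::nat)) u > 0" if "u \<in> set c" "c \<in> set cs" for u c
    using that(2)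
  proof (induction cs)
    case (Cons d ds)
    then show ?case using pos[OF that(1)] by (auto simp: lookup_add)
  qed simp
  then have "set c \<subseteq> supp \<beta>" if "c \<in> set cs" for c
    using that unfolding \<beta> by (fastforce simp: in_keys_iff lookup_add)
  moreover have "supp \<beta> \<subseteq> skew_vars m"
    using f lead symbolic_power_subset by (auto simp: leads_def polys_def monomials_in_def)
  ultimately have "\<exists>U. U \<subseteq> {1..m} \<and> card U = 2 * length c \<and> antidiagonal_mono U = (\<Sum>v\<leftarrow>c. sgl v 1)"
    if "c \<in> set cs" for c
    using nest_chain_nested[of c m] cs(1)[OF that] that by (metis subset_trans)
  then obtain U where U: "\<And>c. c \<in> set cs \<Longrightarrow> U c \<subseteq> {1..m} \<and> card (U c) = 2 * length c \<and> antidiagonal_mono (U c) = (\<Sum>v\<leftarrow>c. sgl v 1)"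
    by metis
  show thesis
  proof (rule that[of "map U cs" \<delta>])
    show "map U cs \<noteq> []" using cs(2) s by auto
    show "pf_shape m r V" if "V \<in> set (map U cs)" for V
      using that U cs(1) by (auto simp: pf_shape_def Suc_le_eq)
    have "(\<Sum>V\<leftarrow>map U cs. card V div 2 - r) = (\<Sum>c\<leftarrow>cs. length c - r)"
      using U by (simp add: comp_def cong: map_cong)
    then show "(\<Sum>V\<leftarrow>map U cs. card V div 2 - r) = s" using cs(2) by simp
    have "(\<Sum>V\<leftarrow>map U cs. antidiagonal_mono V) = (\<Sum>c\<leftarrow>cs. \<Sum>v\<leftarrow>c. sgl v 1)"
      using U by (simp add: comp_def cong: map_cong)
    then show "\<beta> = (\<Sum>V\<leftarrow>map U cs. antidiagonal_mono V) + \<delta>" using \<beta> by simp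
  qed
qed

theorem groebner_basis_symbolic_power:
  assumes r: "r \<ge> 1" and s: "s \<ge> 1" and ord: "pf_order TYPE('k::field) m ord"
  shows "is_groebner_basis (skew_vars m) ord (pfaffian_products m r s)
    (symbolic_power (poly_ring (skew_vars m)) (pf_secant m r :: (_, 'k) mpol set) s)"
proof -
  interpret prime_poly_ideal "skew_vars m" "pf_secant m r :: (_, 'k) mpol set"
    by (rule prime_poly_ideal_secant[OF r])
  let ?V = "skew_vars m" and ?sym = "symbolic_power R (pf_secant m r) s"
  let ?G = "pfaffian_products m r s :: (_, 'k) mpol set"
  let ?in = "\<lambda>F. {sgl (lead_mono ord f) (1 :: 'k) |f. f \<in> F \<and> f \<noteq> 0}"
  have to: "term_order ?V ord" using ord by (simp add: pf_order_def)
  have sub: "?G \<subseteq> ?sym"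
    using pf_prod_symbolic_power[OF r, where 'k = 'k] unfolding pfaffian_products_eq by auto
  have in_polys: "?in F \<subseteq> polys ?V" if "F \<subseteq> polys ?V" for F
  proof
    fix x assume "x \<in> ?in F"
    then obtain f where f: "x = sgl (lead_mono ord f) 1" "f \<in> F" "f \<noteq> 0" by blast
    then have "lead_mono ord f \<in> supp f" using that by (intro lead_mono(1)[OF to]) auto
    then have "lead_mono ord f \<in> monomials_in ?V" using that f by (auto simp: polys_def)
    then show "x \<in> polys ?V" unfolding f(1) by (rule polys_single)
  qed
  note iG = in_polys[OF order_trans[OF sub symbolic_power_subset]] and iS = in_polys[OF symbolic_power_subset[of s]]
  have "Idl\<^bsub>R\<^esub> (?in ?G) \<subseteq> Idl\<^bsub>R\<^esub> (?in ?sym)"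
    using sub Idl_self[OF iS] by (intro Idl_minimal Idl_ideal[OF iS]) blast
  moreover have "Idl\<^bsub>R\<^esub> (?in ?sym) \<subseteq> Idl\<^bsub>R\<^esub> (?in ?G)"
  proof (rule Idl_minimal[OF Idl_ideal[OF iG]], rule subsetI)
    fix x assume "x \<in> ?in ?sym"
    then obtain f where f: "f \<in> ?sym" "f \<noteq> 0" and x: "x = sgl (lead_mono ord f) 1" by blast
    have fp: "f \<in> polys ?V" using f symbolic_power_subset by blast
    have lead: "leads ord f (lead_mono ord f)" using leads_lead_mono[OF to fp f(2)] .
    obtain us \<delta> where us: "us \<noteq> []" "\<And>U. U \<in> set us \<Longrightarrow> pf_shape m r U" "(\<Sum>U\<leftarrow>us. card U div 2 - r) = s"
      and \<delta>: "lead_mono ord f = (\<Sum>U\<leftarrow>us. antidiagonal_mono U) + \<delta>"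
      using symbolic_power_lead[OF r s ord f(1) lead] by blast
    have g: "pf_prod us \<in> ?G" unfolding pfaffian_products_eq using us by blast
    have lg: "leads ord (pf_prod us :: (_, 'k) mpol) (\<Sum>U\<leftarrow>us. antidiagonal_mono U)"
      using us(2) by (rule leads_pf_prod[OF ord])
    then have "pf_prod us \<noteq> (0 :: (_, 'k) mpol)" by (auto simp: leads_def)
    moreover have "lead_mono ord (pf_prod us :: (_, 'k) mpol) = (\<Sum>U\<leftarrow>us. antidiagonal_mono U)"
      using us(2) by (intro lead_mono_leads[OF to _ lg] polys_pf_prod)
    ultimately have "sgl (\<Sum>U\<leftarrow>us. antidiagonal_mono U) 1 \<in> ?in ?G" using g by force
    then have "sgl (\<Sum>U\<leftarrow>us. antidiagonal_mono U) 1 \<in> Idl\<^bsub>R\<^esub> (?in ?G)" using Idl_self[OF iG] by blast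
    moreover have "\<delta> \<in> monomials_in ?V"
      using lead fp unfolding \<delta> by (auto simp: leads_def polys_def)
    ultimately have "sgl \<delta> 1 * sgl (\<Sum>U\<leftarrow>us. antidiagonal_mono U) 1 \<in> Idl\<^bsub>R\<^esub> (?in ?G)"
      by (intro ideal_poly_ringD(4)[OF Idl_ideal[OF iG]] polys_single)
    then show "x \<in> Idl\<^bsub>R\<^esub> (?in ?G)" by (simp add: x \<delta> mult_single add.commute)
  qed
  ultimately show ?thesis
    using sub by (auto simp: is_groebner_basis_def initial_ideal_def finite_pfaffian_products)
qed

section \<open>Generation and differential perfection\<close>

text \<open>All variables have positive weight, which bounds the exponents. This makes the division
  below terminate.\<close>

lemma finite_mono_weight_le: "finite {u \<in> monomials_in (skew_vars m). mono_weight m u \<le> W}" (is "finite ?F")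
proof (rule finite_imageD[of cf])
  let ?B = "{g. \<forall>v. (v \<in> skew_vars m \<longrightarrow> g v \<in> {..W}) \<and> (v \<notin> skew_vars m \<longrightarrow> g v = 0)}"
  have fin: "finite (skew_vars m)" by (rule finite_subset[of _ "{1..m} \<times> {1..m}"]) (auto simp: skew_vars_def)
  have 1: "cf u v \<le> W" if "u \<in> ?F" "v \<in> skew_vars m" for u v
  proof (cases "v \<in> supp u")
    case True
    have "arc_weight m v \<ge> 1" using that(2) by (auto simp: arc_weight_def skew_vars_def Suc_le_eq)
    then have "cf u v \<le> cf u v * arc_weight m v" by simp
    also have "\<dots> \<le> mono_weight m u" unfolding mono_weight_def using True by (intro member_le_sum) auto
    finally show ?thesis using that by simp
  qed (simp add: in_keys_iff)
  have 2: "cf u v = 0" if "u \<in> ?F" "v \<notin> skew_vars m" for u v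
    using that by (auto simp: monomials_in_def in_keys_iff)
  have "cf ` ?F \<subseteq> ?B"
  proof (rule image_subsetI)
    fix u assume u: "u \<in> ?F"
    show "cf u \<in> ?B" unfolding mem_Collect_eq atMost_iff using 1[OF u] 2[OF u] by blast
  qed
  then show "finite (cf ` ?F)" by (rule finite_subset) (rule finite_set_of_finite_funs[OF fin finite_atMost])
  show "inj_on cf ?F" by (rule inj_onI) (rule poly_mapping_eqI, simp only:)
qed

text \<open>Division by the products of Pfaffians: a multiple of one of them cancels the leading
  term without leaving the symbolic power, and fewer monomials lie below the new leading one. With
  \<open>K\<close> arbitrary, this applies directly to the right-hand side of differential
  perfection.\<close>

lemma symbolic_power_generated:
  assumes r: "r \<ge> 1" and s: "s \<ge> 1" and K: "ideal K (poly_ring (skew_vars m))"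
    and G: "pfaffian_products m r s \<subseteq> K"
  shows "symbolic_power (poly_ring (skew_vars m)) (pf_secant m r :: (_, 'k::field) mpol set) s \<subseteq> K"
proof
  interpret prime_poly_ideal "skew_vars m" "pf_secant m r :: (_, 'k) mpol set"
    by (rule prime_poly_ideal_secant[OF r])
  let ?V = "skew_vars m" and ?ord = "weight_order m"
  note ord = pf_order_weight_order[of m, where 'k = 'k]
  note to = term_order_weight_order[of m]
  define below where "below t = {u. (u, t) \<in> ?ord}" for t
  have fin: "finite (below t)" for t
    by (rule finite_subset[OF _ finite_mono_weight_le[of m "mono_weight m t"]])
      (auto simp: below_def weight_order_def)
  fix f assume "f \<in> symbolic_power R (pf_secant m r) s"
  then show "f \<in> K"
  proof (induction "if f = 0 then 0 else card (below (lead_mono ?ord f))" arbitrary: f rule: less_induct)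
    case less
    show ?case
    proof (cases "f = 0")
      case True
      then show ?thesis using ideal_poly_ringD(2)[OF K] by simp
    next
      case False
      define t where "t = lead_mono ?ord f"
      have fp: "f \<in> polys ?V" using less.prems symbolic_power_subset by blast
      have lead: "leads ?ord f t" unfolding t_def by (rule leads_lead_mono[OF to fp False])
      obtain us \<delta> where us: "us \<noteq> []" "\<And>U. U \<in> set us \<Longrightarrow> pf_shape m r U" "(\<Sum>U\<leftarrow>us. card U div 2 - r) = s"
        and \<delta>: "t = (\<Sum>U\<leftarrow>us. antidiagonal_mono U) + \<delta>"
        using symbolic_power_lead[OF r s ord less.prems lead] by blast
      define a where "a = (\<Sum>U\<leftarrow>us. antidiagonal_mono U)"
      define g where "g = (pf_prod us :: (_, 'k) mpol)"
      have g: "g \<in> K" "g \<in> symbolic_power R (pf_secant m r) s" "g \<in> polys ?V"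
        using G us pf_prod_symbolic_power[OF r us(2), where 'k = 'k] polys_pf_prod[OF us(2)]
        unfolding pfaffian_products_eq g_def by auto
      have lg: "leads ?ord g a" unfolding g_def a_def using us(2) by (rule leads_pf_prod[OF ord])
      have \<delta>V: "\<delta> \<in> monomials_in ?V" using lead fp unfolding \<delta> by (auto simp: leads_def polys_def)
      define c where "c = cf f t / cf g a"
      have cg: "cf g a \<noteq> 0" using lg by (simp add: leads_def in_keys_iff)
      define h where "h = sgl \<delta> c * g"
      have h: "h \<in> K" "h \<in> symbolic_power R (pf_secant m r) s"
        unfolding h_def using \<delta>V g by (auto intro: ideal_poly_ringD(4)[OF K] ideal_poly_ringD(4)[OF ideal_symbolic_power])
      have ht: "cf h t = cf f t"
        using lookup_single_mult[of \<delta> c g a] cg by (simp add: h_def \<delta> a_def[symmetric] add.commute c_def)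
      have hsupp: "(u, t) \<in> ?ord" if u: "u \<in> supp h" for u
      proof -
        obtain w where "w \<in> supp g" "u = \<delta> + w"
          using u keys_mult[of "sgl \<delta> c" g] by (auto simp: h_def split: if_splits)
        then have "(w + \<delta>, a + \<delta>) \<in> ?ord" using lg \<delta>V by (intro term_orderD(4)[OF to]) (auto simp: leads_def)
        then show ?thesis using \<open>u = _\<close> \<delta> by (simp add: a_def add.commute)
      qed
      have fh: "f - h \<in> symbolic_power R (pf_secant m r) s"
        using ideal_poly_ringD(6)[OF ideal_symbolic_power less.prems h(2)] .
      have "f - h \<in> K"
      proof (cases "f - h = 0")
        case True
        then show ?thesis using ideal_poly_ringD(2)[OF K] by simp
      next
        case nz: False
        define t' where "t' = lead_mono ?ord (f - h)"
        have "f - h \<in> polys ?V" using fh symbolic_power_subset by blast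
        then have l': "leads ?ord (f - h) t'" unfolding t'_def by (rule leads_lead_mono[OF to _ nz])
        then have t': "t' \<in> supp (f - h)" by (simp add: leads_def)
        have "cf (f - h) t = 0" using ht by (simp add: lookup_minus)
        then have ne: "t' \<noteq> t" using t' by (auto simp: in_keys_iff)
        have t't: "(t', t) \<in> ?ord"
          using t' keys_diff[of f h] lead hsupp by (auto simp: leads_def)
        have "below t' \<subseteq> below t" using term_orderD(1)[OF to _ t't] by (auto simp: below_def)
        moreover have "t \<in> below t" using term_orderD(3)[OF to] t't by (auto simp: below_def weight_order_def)
        moreover have "t \<notin> below t'" using term_orderD(2)[OF to t't] ne by (auto simp: below_def)
        ultimately have "card (below t') < card (below t)" using fin by (intro psubset_card_mono) auto
        then show ?thesis
          using False nz fh by (intro less.hyps) (simp_all add: t'_def t_def)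
      qed
      then show ?thesis using ideal_poly_ringD(3)[OF K _ h(1), of "f - h"] by simp
    qed
  qed
qed

text \<open>Identifies the sum in the semiring of ideals as the least ideal that contains the
  summands.\<close>

lemma finsum_ideals:
  fixes X :: "'i \<Rightarrow> ('v, 'k::comm_ring_1) mpol set"
  assumes "finite A" "\<And>i. i \<in> A \<Longrightarrow> ideal (X i) (poly_ring V)"
  defines "S \<equiv> finsum (ideals_set (poly_ring V)) X A"
  shows "ideal S (poly_ring V)" "i \<in> A \<Longrightarrow> X i \<subseteq> S"
    "ideal K (poly_ring V) \<Longrightarrow> (\<And>i. i \<in> A \<Longrightarrow> X i \<subseteq> K) \<Longrightarrow> S \<subseteq> K"
proof -
  interpret S: semiring "ideals_set (poly_ring V :: ('v, 'k) mpol ring)"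
    by (rule cring.ideals_set_is_semiring[OF cring_poly_ring])
  have "ideal (finsum (ideals_set (poly_ring V)) X A) (poly_ring V) \<and> (\<forall>i\<in>A. X i \<subseteq> finsum (ideals_set (poly_ring V)) X A) \<and>
    (\<forall>K. ideal K (poly_ring V) \<longrightarrow> (\<forall>i\<in>A. X i \<subseteq> K) \<longrightarrow> finsum (ideals_set (poly_ring V)) X A \<subseteq> K)"
    using assms(1,2)
  proof (induction A rule: finite_induct)
    case empty
    have "finsum (ideals_set (poly_ring V)) X {} = {0}" by (simp add: S.finsum_empty) (simp add: ideals_set_def)
    then show ?case
      using ideal_poly_ringD(2) ring.zeroideal[OF ring_poly_ring, of V] by auto
  next
    case (insert i A)
    let ?T = "finsum (ideals_set (poly_ring V)) X A"
    have IH: "ideal ?T (poly_ring V)" "\<forall>j\<in>A. X j \<subseteq> ?T"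
      "\<And>K. ideal K (poly_ring V) \<Longrightarrow> \<forall>i\<in>A. X i \<subseteq> K \<Longrightarrow> ?T \<subseteq> K" using insert by auto
    have i: "ideal (X i) (poly_ring V)" using insert by blast
    have "finsum (ideals_set (poly_ring V)) X (insert i A) = X i <+>\<^bsub>poly_ring V\<^esub> ?T"
      using insert S.finsum_insert[of A i X] by (auto simp: ideals_set_def)
    moreover have "X i <+>\<^bsub>poly_ring V\<^esub> ?T \<subseteq> K" if "ideal K (poly_ring V)" "\<forall>j\<in>insert i A. X j \<subseteq> K" for K
      using IH(3)[OF that(1)] that(2) ideal_poly_ringD(3)[OF that(1)] unfolding set_add_poly_ring by blast
    moreover have "X j \<subseteq> X i <+>\<^bsub>poly_ring V\<^esub> ?T" if "j \<in> insert i A" for j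
      using that set_add_superset[OF i IH(1)] IH(2) by blast
    ultimately show ?case using ideal_set_add[OF i IH(1)] by simp
  qed
  then show "ideal S (poly_ring V)" "i \<in> A \<Longrightarrow> X i \<subseteq> S"
    "ideal K (poly_ring V) \<Longrightarrow> (\<And>i. i \<in> A \<Longrightarrow> X i \<subseteq> K) \<Longrightarrow> S \<subseteq> K"
    unfolding S_def by blast+
qed

text \<open>Reduction takes place in the intersection of the symbolic power with the higher secant
  ideal, which contains the Pfaffians of size \<open>2(r + s)\<close>. The normal form of an element
  of that secant ideal is standard and vanishes at the rank point, so it is 0, and the element lies
  in the intersection.\<close>

lemma secant_subset_symbolic_power:
  assumes r: "r \<ge> 1" and s: "s \<ge> 1"
  shows "(pf_secant m (r + s - 1) :: (_, 'k::field) mpol set) \<subseteq> symbolic_power (poly_ring (skew_vars m)) (pf_secant m r) s"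
proof
  interpret prime_poly_ideal "skew_vars m" "pf_secant m r :: (_, 'k) mpol set"
    by (rule prime_poly_ideal_secant[OF r])
  let ?q = "r + s - 1" and ?V = "skew_vars m"
  let ?sym = "symbolic_power R (pf_secant m r) s" and ?J = "pf_secant m ?q :: (_, 'k) mpol set"
  have q: "?q \<ge> 1" using r s by simp
  note idJ = secant_pf4(1)[OF q, of m, where 'k = 'k] and idS = ideal_symbolic_power[of s]
  interpret P: pfaffian_ideal m ?q "?sym \<inter> ?J"
  proof (rule pfaffian_ideal.intro[OF q])
    show "ideal (?sym \<inter> ?J) R"
      using ideal_poly_ringD[OF idJ] ideal_poly_ringD[OF idS] by (intro ideal_poly_ringI) auto
    fix U assume U: "U \<subseteq> {1..m}" "card U = 2 * Suc ?q"
    have "pf_shape m r U" using U r s by (auto simp: pf_shape_def intro!: exI[of _ "Suc ?q"])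
    from subpfaffian_symbolic_power[OF r this, where 'k = 'k] U s r
    show "subpfaffian generic_skew U \<in> ?sym \<inter> ?J"
      using subpfaffian_in_secant[OF q U, where 'k = 'k] by simp
  qed
  fix f assume f: "f \<in> ?J"
  then have fp: "f \<in> polys ?V" using ideal_poly_ringD(1)[OF idJ] by blast
  obtain H where H: "H \<in> polys ?V" "f - H \<in> ?sym \<inter> ?J" "\<And>t. t \<in> supp H \<Longrightarrow> standard ?q t"
    using P.normal_form[OF pf_order_weight_order fp] by metis
  have "f - (f - H) \<in> ?J" using H(2) ideal_poly_ringD(6)[OF idJ f] by blast
  then have "ev mconst (rank_point ?q) H = 0" using rank_point_kills_secant[OF q, of H m] by simp
  then have "H = 0" using standard_independent[OF H(1) _ H(3)] by (auto simp: poly_subst_eq_ev)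
  then show "f \<in> ?sym" using H(2) by simp
qed

text \<open>A generator with one factor is a Pfaffian of size \<open>2(r + s)\<close> and lies in
  the higher secant ideal. With more factors, splitting off the first one gives an element of a
  product of two lower symbolic powers.\<close>

theorem diff_perfect_pf4:
  assumes r: "r \<ge> 1"
  shows "diff_perfect_at (skew_vars m) (pf4_ideal m :: (_, 'k::field) mpol set) r"
  unfolding diff_perfect_at_def Let_def
proof (intro allI impI)
  interpret prime_poly_ideal "skew_vars m" "pf_secant m r :: (_, 'k) mpol set"
    by (rule prime_poly_ideal_secant[OF r])
  fix s :: nat assume s: "s \<ge> 1"
  let ?sym = "symbolic_power R (pf_secant m r)" and ?J = "pf_secant m (r + s - 1) :: (_, 'k) mpol set"
  define X where "X i = ideal_prod R (?sym i) (?sym (s - i))" for i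
  let ?S = "finsum (ideals_set R) X {1..s - 1}"
  have q: "r + s - 1 \<ge> 1" using r s by simp
  note idJ = secant_pf4(1)[OF q, of m, where 'k = 'k]
  have idX: "ideal (X i) R" for i
    unfolding X_def by (intro ring.ideal_prod_is_ideal[OF ring_poly_ring] ideal_symbolic_power)
  note S = finsum_ideals[where X = X and A = "{1..s - 1}", OF finite_atLeastAtMost idX]
  note K = ideal_set_add[OF idJ S(1)]
  have Xsym: "X i \<subseteq> ?sym s" if "i \<in> {1..s - 1}" for i
  proof
    fix f assume "f \<in> X i"
    then have "f \<in> ideal_prod R (?sym i) (?sym (s - i))" by (simp add: X_def)
    then show "f \<in> ?sym s"
    proof (induction f rule: ideal_prod.induct)
      case (prod a b)
      then show ?case using symbolic_power_mult[of a i b "s - i"] that by auto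
    next
      case (sum a b)
      then show ?case using ideal_poly_ringD(3)[OF ideal_symbolic_power] by auto
    qed
  qed
  have "?J <+>\<^bsub>R\<^esub> ?S \<subseteq> ?sym s"
    using secant_subset_symbolic_power[OF r s, of m, where 'k = 'k] S(3)[OF ideal_symbolic_power Xsym]
      ideal_poly_ringD(3)[OF ideal_symbolic_power] unfolding set_add_poly_ring by blast
  moreover have "?sym s \<subseteq> ?J <+>\<^bsub>R\<^esub> ?S"
  proof (rule symbolic_power_generated[OF r s K], rule subsetI)
    fix g :: "(_, 'k) mpol" assume "g \<in> pfaffian_products m r s"
    then obtain us where g: "g = pf_prod us" and us: "us \<noteq> []" "\<And>U. U \<in> set us \<Longrightarrow> pf_shape m r U"
      "(\<Sum>U\<leftarrow>us. card U div 2 - r) = s" unfolding pfaffian_products_eq by blast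
    obtain U vs where uv: "us = U # vs" using us(1) by (cases us) auto
    obtain t where U: "U \<subseteq> {1..m}" "card U = 2 * t" "t \<ge> Suc r" using us(2)[of U] uv by (auto simp: pf_shape_def)
    show "g \<in> ?J <+>\<^bsub>R\<^esub> ?S"
    proof (cases vs)
      case Nil
      then have "t = r + s" using us(3) U uv by simp
      then have "subpfaffian generic_skew U \<in> ?J"
        using U s r by (intro subpfaffian_in_secant[OF q U(1,2)]) simp
      then show ?thesis using set_add_superset(1)[OF idJ S(1)] by (auto simp: g uv Nil pf_prod_def)
    next
      case (Cons U' vs')
      obtain t' where "card U' = 2 * t'" "t' \<ge> Suc r" using us(2)[of U'] uv Cons by (auto simp: pf_shape_def)
      \<comment> \<open>The next factor contributes at least 1 to \<open>s\<close>, so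
        \<open>t - r\<close> stays below \<open>s\<close>.\<close>
      then have i: "t - r \<in> {1..s - 1}" "(\<Sum>U\<leftarrow>vs. card U div 2 - r) = s - (t - r)"
        using us(3) U by (auto simp: uv Cons)
      have "subpfaffian generic_skew U \<in> ?sym (t - r)"
        using subpfaffian_symbolic_power[OF r us(2)[of U], where 'k = 'k] uv U by simp
      moreover have "pf_prod vs \<in> ?sym (s - (t - r))"
        unfolding i(2)[symmetric] using us(2) uv by (intro pf_prod_symbolic_power[OF r]) simp
      ultimately have "g \<in> X (t - r)"
        using ideal_prod.prod[of "subpfaffian generic_skew U" "?sym (t - r)" "pf_prod vs" "?sym (s - (t - r))" R]
        by (simp add: X_def g uv pf_prod_def)
      then show ?thesis using S(2)[OF i(1)] set_add_superset(2)[OF idJ S(1)] by blast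
    qed
  qed
  ultimately show "?sym s = ?J <+>\<^bsub>R\<^esub> (\<Oplus>\<^bsub>ideals_set R\<^esub>i\<in>{1..s - 1}. ideal_prod R (?sym i) (?sym (s - i)))"
    unfolding X_def by (rule equalityI[rotated])
qed

theorem theorem5p9:
  fixes m :: nat
  shows "differentially_perfect (skew_vars m)
           (pf4_ideal m :: (nat \<times> nat, 'k::alg_closed_field) mpol set) \<and>
    (\<forall>r\<ge>1. \<forall>s\<ge>1. \<forall>ord. antidiagonal_term_order TYPE('k) m ord \<longrightarrow>
       is_groebner_basis (skew_vars m) ord
         (pfaffian_products m r s)
         (symbolic_power (poly_ring (skew_vars m))
            (secant_ideal (skew_vars m) (pf4_ideal m :: (nat \<times> nat, 'k) mpol set) r) s))"
  unfolding differentially_perfect_def pf_order_iff[symmetric]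
  by (blast intro: diff_perfect_pf4 groebner_basis_symbolic_power)

end
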